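(* Let $(E,[\cdot,\cdot]_E,\rho)$ be a Lie algebroid over $M$, let $S$ be a spray on the prolongation $\pounds^\pi E$, let $\mathcal H$ be the Berwald connection of $S$, and let $\eta\in\Gamma(E)$ be a Lie symmetry of $S$, i.e. $\llbracket S,\eta^C\rrbracket=0$. Then $\eta^C$ is a curvature collineation of the Jacobi endomorphism $\mathcal K$, of the fundamental affine curvature $\mathcal R$ and of the affine curvature $\mathsf H$ of $S$; that is, $$\widetilde{\mathcal L}_{\eta^C}\mathcal K=0,\qquad \widetilde{\mathcal L}_{\eta^C}\mathcal R=0,\qquad \widetilde{\mathcal L}_{\eta^C}\mathsf H=0 .$$
   Context: **Lie algebroid and prolongation.** $\pi:E\to M$ is a smooth vector bundle with a Lie algebroid structure $([\cdot,\cdot]_E,\rho)$: a Lie bracket on $\Gamma(E)$ and a bundle map (anchor) $\rho:E\to TM$ with $[\xi,f\eta]_E=f[\xi,\eta]_E+(\rho(\xi)f)\eta$. The prolongation is $\pounds^\pi E=\{(u,z)\in E\times TE:\rho(u)=\pi_*(z)\}$, a vector bundle over $E$ with projection $\pi_\pounds(u,z)=v$ for $z\in T_vE$. It is a Lie algebroid over $E$ with anchor $\rho_\pounds(u,z)=z$ and the bracket $\llbracket\cdot,\cdot\rrbracket$ determined by the Leibniz rule and, for sections of the form $(X\circ\pi,U)$, $(Y\circ\pi,W)$ with $X,Y\in\Gamma(E)$ and $U,W$ vector fields on $E$ that are $\pi$-related to $\rho(X),\rho(Y)$, by $\llbracket (X\circ\pi,U),(Y\circ\pi,W)\rrbracket=([X,Y]_E\circ\pi,[U,W])$.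 **Pullback bundle, $i$, $j$.** $\pi^*E=E\times_ME\to E$ is the pullback bundle (projection to the first factor); its $C^\infty(E)$-module of sections is written $\Gamma(\pi^*\pi)$. For $\eta\in\Gamma(E)$, $\widehat\eta(u)=(u,\eta(\pi(u)))$; $\delta(u)=(u,u)$. The bundle maps $i:\pi^*E\to\pounds^\pi E$, $i(u,v)=(0,\frac{d}{dt}|_{t=0}(u+tv))$, and $j:\pounds^\pi E\to\pi^*E$, $j(u,z)=(v,u)$ for $z\in T_vE$, form a short exact sequence $0\to\pi^*E\to\pounds^\pi E\to\pi^*E\to0$. Put $J=i\circ j$ and $C=i\circ\delta$ (Liouville section). **Lifts.** For $\eta\in\Gamma(E)$: the vertical lift is $\eta^V=i(\widehat\eta)$; the complete lift is $\eta^C(u)=(\eta(\pi(u)),\eta^c(u))$, where $\eta^c$ is the unique vector field on $E$ that is $\pi$-projectable onto $\rho(\eta)$ and satisfies $\eta^c(\widehat\theta)=\widehat{\pounds^E_\eta\theta}$ for all $\theta\in\Gamma(E^* )$, with $\widehat\theta(u)=\theta_{\pi(u)}(u)$ and $(\pounds^E_\eta\theta)(\xi)=\rho(\eta)(\theta(\xi))-\theta([\eta,\xi]_E)$. **Spray and Berwald connection.** A semispray is a section $S$ of $\pounds^\pi E$ with $J(S)=C$; it is a spray if moreover $\llbracket C,S\rrbracket=S$. An Ehresmann connection is a $C^\infty(E)$-linear map $\mathcal H:\Gamma(\pi^*\pi)\to\Gamma(\pounds^\pi E)$ with $j\circ\mathcal H=\mathrm{id}$; its vertical map $\mathcal V:\Gamma(\pounds^\pi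 E)\to\Gamma(\pi^*\pi)$ is the $C^\infty(E)$-linear map with $\mathcal V\circ i=\mathrm{id}$ and $\ker\mathcal V=\operatorname{Im}\mathcal H$. The Berwald connection of a spray $S$ is the Ehresmann connection with $\mathcal H(\widehat\eta)=\tfrac12(\eta^C+\llbracket\eta^V,S\rrbracket)$ for all $\eta\in\Gamma(E)$. **Vertical differential.** For $\bar\xi\in\Gamma(\pi^*\pi)$: $\nabla^v_{\bar\xi}F=\rho_\pounds(i\bar\xi)F$ for $F\in C^\infty(E)$, and $\nabla^v_{\bar\xi}\bar\eta=j\llbracket i\bar\xi,\widetilde\sigma\rrbracket$ for any $\widetilde\sigma$ with $j\widetilde\sigma=\bar\eta$. Extend $\nabla^v_{\bar\xi}$ to all tensors on $\pi^*\pi$ as a tensor derivation (commuting with contractions), and set $(\nabla^vA)(\bar\xi,\dots)=(\nabla^v_{\bar\xi}A)(\dots)$. **Lie derivation.** A section $\widetilde\xi$ of $\pounds^\pi E$ is projectable if its first component is $X\circ\pi$ for some $X\in\Gamma(E)$ ($\eta^C$ and $\eta^V$ are projectable). For projectable $\widetilde\xi$, $\widetilde{\mathcal L}_{\widetilde\xi}$ is the tensor derivation on tensors of $\pi^*\pi$ with $\widetilde{\mathcal L}_{\widetilde\xi}F=\rho_\pounds(\widetilde\xi)F$ and $\widetilde{\mathcal L}_{\widetilde\xi}\bar\eta=i^{-1}\llbracket\widetilde\xi,i\bar\eta\rrbracket$. A projectable section $\widetilde\xi$ is a curvature collineation of a tensor $A$ of type $(1,k)$, $k\in\{1,2,3\}$,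 on $\pi^*\pi$ if $\widetilde{\mathcal L}_{\widetilde\xi}A=0$. **Curvature tensors of $S$** (with $\mathcal H$ the Berwald connection; arguments in $\Gamma(\pi^*\pi)$): $\mathcal K(\bar\eta)=\mathcal V\llbracket S,\mathcal H(\bar\eta)\rrbracket$; $\mathcal R(\bar\eta,\bar\xi)=\tfrac13\big(\nabla^v\mathcal K(\bar\xi,\bar\eta)-\nabla^v\mathcal K(\bar\eta,\bar\xi)\big)$; $\mathsf H(\bar\eta,\bar\xi)\bar\sigma=\nabla^v\mathcal R(\bar\sigma,\bar\eta,\bar\xi)$. *)

theory Defs
  imports "HOL-Analysis.Analysis"
begin

section \<open>Smooth functions and smooth manifolds\<close>

text \<open>Both notions are used on open sets of finite-dimensional inner product spaces only.\<close>

primrec Ck_on :: "nat \<Rightarrow> 'a::real_normed_vector set \<Rightarrow> ('a \<Rightarrow> 'b::real_normed_vector) \<Rightarrow> bool" where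
  "Ck_on 0 S f \<longleftrightarrow> continuous_on S f"
| "Ck_on (Suc k) S f \<longleftrightarrow>
     (\<forall>x\<in>S. f differentiable (at x)) \<and> (\<forall>v. Ck_on k S (\<lambda>x. frechet_derivative f (at x) v))"

definition smooth_on :: "'a::real_normed_vector set \<Rightarrow> ('a \<Rightarrow> 'b::real_normed_vector) \<Rightarrow> bool" where
  "smooth_on S f \<longleftrightarrow> (\<forall>k. Ck_on k S f)"

text \<open>A manifold is the whole of a Hausdorff second countable type. The model space is a
  finite-dimensional inner product space given by a type of class \<^class>\<open>real_inner\<close> (rather than
  \<^class>\<open>euclidean_space\<close>, whose members have positive dimension), so that dimension \<open>0\<close> is allowed.
  An atlas need not be maximal; charts are pairs of a domain and a map.\<close>

type_synonym ('m, 'a) atlas = "('m set \<times> ('m \<Rightarrow> 'a)) set"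

definition is_chart :: "'m::topological_space set \<Rightarrow> ('m \<Rightarrow> 'a::real_inner) \<Rightarrow> bool" where
  "is_chart U \<phi> \<longleftrightarrow> open U \<and> open (\<phi> ` U) \<and> homeomorphism U (\<phi> ` U) \<phi> (inv_into U \<phi>)"

definition smooth_manifold ::
    "('m::{t2_space, second_countable_topology}, 'a::real_inner) atlas \<Rightarrow> bool" where
  "smooth_manifold A \<longleftrightarrow>
     (\<exists>B::'a set. finite B \<and> span B = UNIV) \<and>
     (\<forall>(U, \<phi>)\<in>A. is_chart U \<phi>) \<and>
     (\<forall>p. \<exists>(U, \<phi>)\<in>A. p \<in> U) \<and>
     (\<forall>(U, \<phi>)\<in>A. \<forall>(V, \<psi>)\<in>A. smooth_on (\<phi> ` (U \<inter> V)) (\<psi> \<circ> inv_into U \<phi>))"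

text \<open>Charts of the smooth structure, i.e. members of the maximal atlas.\<close>

definition admissible_chart ::
    "('m::{t2_space, second_countable_topology}, 'a::real_inner) atlas \<Rightarrow> 'm set \<Rightarrow> ('m \<Rightarrow> 'a) \<Rightarrow> bool" where
  "admissible_chart A U \<phi> \<longleftrightarrow> smooth_manifold (insert (U, \<phi>) A)"

definition Cinf :: "('m::topological_space, 'a::real_inner) atlas \<Rightarrow> ('m \<Rightarrow> real) set" where
  "Cinf A = {f. \<forall>(U, \<phi>)\<in>A. smooth_on (\<phi> ` U) (f \<circ> inv_into U \<phi>)}"

definition smooth_map :: "('m::topological_space, 'a::real_inner) atlas \<Rightarrow>
    ('n::topological_space, 'b::real_inner) atlas \<Rightarrow> ('m \<Rightarrow> 'n) \<Rightarrow> bool" where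
  "smooth_map A B F \<longleftrightarrow> continuous_on UNIV F \<and>
     (\<forall>(U, \<phi>)\<in>A. \<forall>(V, \<psi>)\<in>B. smooth_on (\<phi> ` (U \<inter> F -` V)) (\<psi> \<circ> F \<circ> inv_into U \<phi>))"

section \<open>Tangent vectors and vector fields\<close>

text \<open>A tangent vector is a pair of its foot point and a derivation of \<open>C\<^sup>\<infinity>(M)\<close> at that point.
  Derivations are extended by \<open>0\<close> to all functions, so that equality of tangent vectors is
  equality in HOL. The derivation alone would not determine the foot point of a zero vector.\<close>

type_synonym 'm tangent = "'m \<times> (('m \<Rightarrow> real) \<Rightarrow> real)"

definition restrict0 :: "('m \<Rightarrow> real) set \<Rightarrow> (('m \<Rightarrow> real) \<Rightarrow> real) \<Rightarrow> ('m \<Rightarrow> real) \<Rightarrow> real" where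
  "restrict0 C D = (\<lambda>f. if f \<in> C then D f else 0)"

definition tangent_vectors :: "('m::topological_space, 'a::real_inner) atlas \<Rightarrow> 'm tangent set" where
  "tangent_vectors A = {(p, D).
     (\<forall>f\<in>Cinf A. \<forall>g\<in>Cinf A. D (\<lambda>x. f x + g x) = D f + D g) \<and>
     (\<forall>c. \<forall>f\<in>Cinf A. D (\<lambda>x. c * f x) = c * D f) \<and>
     (\<forall>f\<in>Cinf A. \<forall>g\<in>Cinf A. D (\<lambda>x. f x * g x) = f p * D g + D f * g p) \<and>
     (\<forall>f. f \<notin> Cinf A \<longrightarrow> D f = 0)}"

definition tan_add :: "'m tangent \<Rightarrow> 'm tangent \<Rightarrow> 'm tangent" where
  "tan_add z w = (fst z, \<lambda>f. snd z f + snd w f)"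

definition tan_scale :: "real \<Rightarrow> 'm tangent \<Rightarrow> 'm tangent" where
  "tan_scale c z = (fst z, \<lambda>f. c * snd z f)"

definition tan_zero :: "'m \<Rightarrow> 'm tangent" where
  "tan_zero p = (p, \<lambda>_. 0)"

definition pushforward :: "('n::topological_space, 'b::real_inner) atlas \<Rightarrow> ('m \<Rightarrow> 'n) \<Rightarrow> 'm tangent \<Rightarrow> 'n tangent" where
  "pushforward B F z = (F (fst z), restrict0 (Cinf B) (\<lambda>f. snd z (f \<circ> F)))"

definition vf_apply :: "('m \<Rightarrow> 'm tangent) \<Rightarrow> ('m \<Rightarrow> real) \<Rightarrow> 'm \<Rightarrow> real" where
  "vf_apply Z f = (\<lambda>p. snd (Z p) f)"

definition vector_fields :: "('m::topological_space, 'a::real_inner) atlas \<Rightarrow> ('m \<Rightarrow> 'm tangent) set" where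
  "vector_fields A = {Z. (\<forall>p. Z p \<in> tangent_vectors A \<and> fst (Z p) = p) \<and>
                         (\<forall>f\<in>Cinf A. vf_apply Z f \<in> Cinf A)}"

definition vf_bracket :: "('m::topological_space, 'a::real_inner) atlas \<Rightarrow>
    ('m \<Rightarrow> 'm tangent) \<Rightarrow> ('m \<Rightarrow> 'm tangent) \<Rightarrow> 'm \<Rightarrow> 'm tangent" where
  "vf_bracket A Z W = (\<lambda>p. (p, restrict0 (Cinf A)
     (\<lambda>f. snd (Z p) (vf_apply W f) - snd (W p) (vf_apply Z f))))"

section \<open>Vector bundles and Lie algebroids\<close>

record ('m, 'e, 'a, 'f) vbundle =
  base_atlas :: "('m, 'a) atlas"
  total_atlas :: "('e, 'a \<times> 'f) atlas"
  bproj :: "'e \<Rightarrow> 'm"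
  fib_add :: "'e \<Rightarrow> 'e \<Rightarrow> 'e"
  fib_scale :: "real \<Rightarrow> 'e \<Rightarrow> 'e"
  fib_zero :: "'m \<Rightarrow> 'e"

text \<open>The fibre operations are relevant only within a single fibre. In a local trivialization
  \<open>u \<mapsto> (\<phi> (\<pi> u), \<Phi> u)\<close> the map \<open>\<Phi>\<close> restricts to a bijection from each fibre onto the typical
  fibre; as it also respects the operations, these make each fibre a vector space and \<open>\<Phi>\<close> a
  linear isomorphism on it.\<close>

definition vector_bundle :: "('m::{t2_space, second_countable_topology},
    'e::{t2_space, second_countable_topology}, 'a::real_inner, 'f::real_inner, 'z) vbundle_scheme \<Rightarrow> bool" where
  "vector_bundle E \<longleftrightarrow>
     smooth_manifold (base_atlas E) \<and> smooth_manifold (total_atlas E) \<and>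
     smooth_map (total_atlas E) (base_atlas E) (bproj E) \<and>
     (\<forall>u v. bproj E u = bproj E v \<longrightarrow> bproj E (fib_add E u v) = bproj E u) \<and>
     (\<forall>c u. bproj E (fib_scale E c u) = bproj E u) \<and>
     (\<forall>p. bproj E (fib_zero E p) = p) \<and>
     (\<forall>p. \<exists>U \<phi> \<Phi>. p \<in> U \<and> admissible_chart (base_atlas E) U \<phi> \<and>
        admissible_chart (total_atlas E) (bproj E -` U) (\<lambda>u. (\<phi> (bproj E u), \<Phi> u)) \<and>
        (\<lambda>u. (\<phi> (bproj E u), \<Phi> u)) ` (bproj E -` U) = (\<phi> ` U) \<times> UNIV \<and>
        (\<forall>u v. bproj E u \<in> U \<longrightarrow> bproj E u = bproj E v \<longrightarrow> \<Phi> (fib_add E u v) = \<Phi> u + \<Phi> v) \<and>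
        (\<forall>c u. bproj E u \<in> U \<longrightarrow> \<Phi> (fib_scale E c u) = c *\<^sub>R \<Phi> u) \<and>
        (\<forall>q\<in>U. \<Phi> (fib_zero E q) = 0))"

definition sections :: "('m::topological_space, 'e::topological_space, 'a::real_inner, 'f::real_inner, 'z) vbundle_scheme
    \<Rightarrow> ('m \<Rightarrow> 'e) set" where
  "sections E = {\<xi>. smooth_map (base_atlas E) (total_atlas E) \<xi> \<and> (\<forall>p. bproj E (\<xi> p) = p)}"

definition sec_add :: "('m, 'e, 'a, 'f, 'z) vbundle_scheme \<Rightarrow> ('m \<Rightarrow> 'e) \<Rightarrow> ('m \<Rightarrow> 'e) \<Rightarrow> 'm \<Rightarrow> 'e" where
  "sec_add E \<xi> \<eta> = (\<lambda>p. fib_add E (\<xi> p) (\<eta> p))"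

definition sec_scale :: "('m, 'e, 'a, 'f, 'z) vbundle_scheme \<Rightarrow> ('m \<Rightarrow> real) \<Rightarrow> ('m \<Rightarrow> 'e) \<Rightarrow> 'm \<Rightarrow> 'e" where
  "sec_scale E f \<xi> = (\<lambda>p. fib_scale E (f p) (\<xi> p))"

text \<open>Algebraic axioms of a Lie algebroid bracket \<open>br\<close> on a module \<open>\<Gamma>\<close> of sections over the ring
  \<open>R\<close> of smooth functions; \<open>act s f\<close> is the derivative of \<open>f\<close> along the anchor of \<open>s\<close>.\<close>

definition lie_bracket_on :: "('x \<Rightarrow> real) set \<Rightarrow> 's set \<Rightarrow> ('s \<Rightarrow> 's \<Rightarrow> 's) \<Rightarrow> (('x \<Rightarrow> real) \<Rightarrow> 's \<Rightarrow> 's) \<Rightarrow>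
    's \<Rightarrow> ('s \<Rightarrow> ('x \<Rightarrow> real) \<Rightarrow> ('x \<Rightarrow> real)) \<Rightarrow> ('s \<Rightarrow> 's \<Rightarrow> 's) \<Rightarrow> bool" where
  "lie_bracket_on R \<Gamma> add smul zer act br \<longleftrightarrow>
     (\<forall>s\<in>\<Gamma>. \<forall>t\<in>\<Gamma>. br s t \<in> \<Gamma>) \<and>
     (\<forall>r\<in>\<Gamma>. \<forall>s\<in>\<Gamma>. \<forall>t\<in>\<Gamma>. br (add r s) t = add (br r t) (br s t)) \<and>
     (\<forall>r\<in>\<Gamma>. \<forall>s\<in>\<Gamma>. \<forall>t\<in>\<Gamma>. br r (add s t) = add (br r s) (br r t)) \<and>
     (\<forall>c. \<forall>s\<in>\<Gamma>. \<forall>t\<in>\<Gamma>. br (smul (\<lambda>_. c) s) t = smul (\<lambda>_. c) (br s t)) \<and>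
     (\<forall>c. \<forall>s\<in>\<Gamma>. \<forall>t\<in>\<Gamma>. br s (smul (\<lambda>_. c) t) = smul (\<lambda>_. c) (br s t)) \<and>
     (\<forall>s\<in>\<Gamma>. br s s = zer) \<and>
     (\<forall>r\<in>\<Gamma>. \<forall>s\<in>\<Gamma>. \<forall>t\<in>\<Gamma>. add (br r (br s t)) (add (br s (br t r)) (br t (br r s))) = zer) \<and>
     (\<forall>f\<in>R. \<forall>s\<in>\<Gamma>. \<forall>t\<in>\<Gamma>. br s (smul f t) = add (smul f (br s t)) (smul (act s f) t))"

record ('m, 'e, 'a, 'f) lie_algd = "('m, 'e, 'a, 'f) vbundle" +
  la_bracket :: "('m \<Rightarrow> 'e) \<Rightarrow> ('m \<Rightarrow> 'e) \<Rightarrow> 'm \<Rightarrow> 'e"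
  la_anchor :: "'e \<Rightarrow> 'm tangent"

definition anchor_deriv :: "('m, 'e, 'a, 'f, 'z) lie_algd_scheme \<Rightarrow> ('m \<Rightarrow> 'e) \<Rightarrow> ('m \<Rightarrow> real) \<Rightarrow> 'm \<Rightarrow> real" where
  "anchor_deriv E \<xi> = vf_apply (la_anchor E \<circ> \<xi>)"

text \<open>A map into a tangent bundle is smooth iff all functions obtained by applying it to smooth
  functions are smooth; this expresses the smoothness of the anchor.\<close>

definition lie_algebroid :: "('m::{t2_space, second_countable_topology},
    'e::{t2_space, second_countable_topology}, 'a::real_inner, 'f::real_inner, 'z) lie_algd_scheme \<Rightarrow> bool" where
  "lie_algebroid E \<longleftrightarrow> vector_bundle E \<and>
     (\<forall>u. la_anchor E u \<in> tangent_vectors (base_atlas E) \<and> fst (la_anchor E u) = bproj E u) \<and>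
     (\<forall>u v. bproj E u = bproj E v \<longrightarrow>
        la_anchor E (fib_add E u v) = tan_add (la_anchor E u) (la_anchor E v)) \<and>
     (\<forall>c u. la_anchor E (fib_scale E c u) = tan_scale c (la_anchor E u)) \<and>
     (\<forall>f\<in>Cinf (base_atlas E). (\<lambda>u. snd (la_anchor E u) f) \<in> Cinf (total_atlas E)) \<and>
     lie_bracket_on (Cinf (base_atlas E)) (sections E) (sec_add E) (sec_scale E) (fib_zero E)
       (anchor_deriv E) (la_bracket E)"

section \<open>The pullback bundle\<close>

text \<open>Points of \<open>\<pi>\<^sup>*E\<close> are pairs \<open>(u, v)\<close> with \<open>\<pi> u = \<pi> v\<close>.\<close>

definition pb_sections :: "('m::topological_space, 'e::topological_space, 'a::real_inner, 'f::real_inner, 'z) vbundle_scheme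
    \<Rightarrow> ('e \<Rightarrow> 'e \<times> 'e) set" where
  "pb_sections E = {s. (\<forall>u. fst (s u) = u \<and> bproj E (snd (s u)) = bproj E u) \<and>
                       smooth_map (total_atlas E) (total_atlas E) (snd \<circ> s)}"

definition pb_add :: "('m, 'e, 'a, 'f, 'z) vbundle_scheme \<Rightarrow>
    ('e \<Rightarrow> 'e \<times> 'e) \<Rightarrow> ('e \<Rightarrow> 'e \<times> 'e) \<Rightarrow> 'e \<Rightarrow> 'e \<times> 'e" where
  "pb_add E s t = (\<lambda>u. (u, fib_add E (snd (s u)) (snd (t u))))"

definition pb_scale :: "('m, 'e, 'a, 'f, 'z) vbundle_scheme \<Rightarrow>
    ('e \<Rightarrow> real) \<Rightarrow> ('e \<Rightarrow> 'e \<times> 'e) \<Rightarrow> 'e \<Rightarrow> 'e \<times> 'e" where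
  "pb_scale E F s = (\<lambda>u. (u, fib_scale E (F u) (snd (s u))))"

definition pb_zero :: "('m, 'e, 'a, 'f, 'z) vbundle_scheme \<Rightarrow> 'e \<Rightarrow> 'e \<times> 'e" where
  "pb_zero E = (\<lambda>u. (u, fib_zero E (bproj E u)))"

definition pb_diff :: "('m, 'e, 'a, 'f, 'z) vbundle_scheme \<Rightarrow>
    ('e \<Rightarrow> 'e \<times> 'e) \<Rightarrow> ('e \<Rightarrow> 'e \<times> 'e) \<Rightarrow> 'e \<Rightarrow> 'e \<times> 'e" where
  "pb_diff E s t = pb_add E s (pb_scale E (\<lambda>_. -1) t)"

definition pb_sum_list :: "('m, 'e, 'a, 'f, 'z) vbundle_scheme \<Rightarrow> ('e \<Rightarrow> 'e \<times> 'e) list \<Rightarrow> 'e \<Rightarrow> 'e \<times> 'e" where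
  "pb_sum_list E ss = foldr (pb_add E) ss (pb_zero E)"

definition hat :: "('m, 'e, 'a, 'f, 'z) vbundle_scheme \<Rightarrow> ('m \<Rightarrow> 'e) \<Rightarrow> 'e \<Rightarrow> 'e \<times> 'e" where
  "hat E \<eta> = (\<lambda>u. (u, \<eta> (bproj E u)))"

definition pb_delta :: "'e \<Rightarrow> 'e \<times> 'e" where
  "pb_delta = (\<lambda>u. (u, u))"

section \<open>The prolongation\<close>

definition prolongation :: "('m::topological_space, 'e::topological_space, 'a::real_inner, 'f::real_inner, 'z) lie_algd_scheme
    \<Rightarrow> ('e \<times> 'e tangent) set" where
  "prolongation E = {(u, z). z \<in> tangent_vectors (total_atlas E) \<and>
                             la_anchor E u = pushforward (base_atlas E) (bproj E) z}"

definition pr_sections :: "('m::topological_space, 'e::topological_space, 'a::real_inner, 'f::real_inner, 'z) lie_algd_scheme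
    \<Rightarrow> ('e \<Rightarrow> 'e \<times> 'e tangent) set" where
  "pr_sections E = {s. (\<forall>v. s v \<in> prolongation E \<and> fst (snd (s v)) = v) \<and>
     smooth_map (total_atlas E) (total_atlas E) (fst \<circ> s) \<and>
     snd \<circ> s \<in> vector_fields (total_atlas E)}"

definition pr_add :: "('m, 'e, 'a, 'f, 'z) vbundle_scheme \<Rightarrow>
    ('e \<Rightarrow> 'e \<times> 'e tangent) \<Rightarrow> ('e \<Rightarrow> 'e \<times> 'e tangent) \<Rightarrow> 'e \<Rightarrow> 'e \<times> 'e tangent" where
  "pr_add E s t = (\<lambda>v. (fib_add E (fst (s v)) (fst (t v)), tan_add (snd (s v)) (snd (t v))))"

definition pr_scale :: "('m, 'e, 'a, 'f, 'z) vbundle_scheme \<Rightarrow>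
    ('e \<Rightarrow> real) \<Rightarrow> ('e \<Rightarrow> 'e \<times> 'e tangent) \<Rightarrow> 'e \<Rightarrow> 'e \<times> 'e tangent" where
  "pr_scale E F s = (\<lambda>v. (fib_scale E (F v) (fst (s v)), tan_scale (F v) (snd (s v))))"

definition pr_zero :: "('m, 'e, 'a, 'f, 'z) vbundle_scheme \<Rightarrow> 'e \<Rightarrow> 'e \<times> 'e tangent" where
  "pr_zero E = (\<lambda>v. (fib_zero E (bproj E v), tan_zero v))"

text \<open>The anchor of the prolongation is the second projection.\<close>

definition pr_deriv :: "('e \<Rightarrow> 'e \<times> 'e tangent) \<Rightarrow> ('e \<Rightarrow> real) \<Rightarrow> 'e \<Rightarrow> real" where
  "pr_deriv s = vf_apply (snd \<circ> s)"

text \<open>The bracket of the prolongation is uniquely determined by these conditions. That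
  \<open>(X \<circ> \<pi>, U)\<close> is a section of the prolongation means precisely that \<open>U\<close> is \<open>\<pi>\<close>-related to
  \<open>\<rho>(X)\<close>.\<close>

definition prolongation_bracket :: "('m::topological_space, 'e::topological_space, 'a::real_inner, 'f::real_inner, 'z) lie_algd_scheme
    \<Rightarrow> (('e \<Rightarrow> 'e \<times> 'e tangent) \<Rightarrow> ('e \<Rightarrow> 'e \<times> 'e tangent) \<Rightarrow> 'e \<Rightarrow> 'e \<times> 'e tangent) \<Rightarrow> bool" where
  "prolongation_bracket E br \<longleftrightarrow>
     lie_bracket_on (Cinf (total_atlas E)) (pr_sections E) (pr_add E) (pr_scale E) (pr_zero E) pr_deriv br \<and>
     (\<forall>X\<in>sections E. \<forall>Y\<in>sections E.
      \<forall>U\<in>vector_fields (total_atlas E). \<forall>W\<in>vector_fields (total_atlas E).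
        (\<forall>v. pushforward (base_atlas E) (bproj E) (U v) = la_anchor E (X (bproj E v))) \<longrightarrow>
        (\<forall>v. pushforward (base_atlas E) (bproj E) (W v) = la_anchor E (Y (bproj E v))) \<longrightarrow>
        br (\<lambda>v. (X (bproj E v), U v)) (\<lambda>v. (Y (bproj E v), W v)) =
          (\<lambda>v. (la_bracket E X Y (bproj E v), vf_bracket (total_atlas E) U W v)))"

definition projectable :: "('m::topological_space, 'e::topological_space, 'a::real_inner, 'f::real_inner, 'z) lie_algd_scheme
    \<Rightarrow> ('e \<Rightarrow> 'e \<times> 'e tangent) \<Rightarrow> bool" where
  "projectable E s \<longleftrightarrow> s \<in> pr_sections E \<and> (\<exists>X\<in>sections E. fst \<circ> s = X \<circ> bproj E)"

definition i_map :: "('m, 'e::topological_space, 'a::real_inner, 'f::real_inner, 'z) vbundle_scheme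
    \<Rightarrow> 'e \<times> 'e \<Rightarrow> 'e \<times> 'e tangent" where
  "i_map E = (\<lambda>(u, v). (fib_zero E (bproj E u),
     (u, restrict0 (Cinf (total_atlas E)) (\<lambda>f. deriv (\<lambda>t. f (fib_add E u (fib_scale E t v))) 0))))"

definition j_map :: "'e \<times> 'e tangent \<Rightarrow> 'e \<times> 'e" where
  "j_map = (\<lambda>(u, z). (fst z, u))"

definition liouville :: "('m, 'e::topological_space, 'a::real_inner, 'f::real_inner, 'z) vbundle_scheme
    \<Rightarrow> 'e \<Rightarrow> 'e \<times> 'e tangent" where
  "liouville E = i_map E \<circ> pb_delta"

text \<open>The preimage of a vertical section under the injective map \<open>i\<close>, on the level of sections.\<close>

definition i_inv :: "('m::topological_space, 'e::topological_space, 'a::real_inner, 'f::real_inner, 'z) vbundle_scheme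
    \<Rightarrow> ('e \<Rightarrow> 'e \<times> 'e tangent) \<Rightarrow> 'e \<Rightarrow> 'e \<times> 'e" where
  "i_inv E s = (THE t. t \<in> pb_sections E \<and> i_map E \<circ> t = s)"

section \<open>Lifts\<close>

text \<open>A section \<open>\<theta>\<close> of \<open>E\<^sup>*\<close> is given by a linear functional \<open>\<theta> p\<close> on each fibre, extended by
  \<open>0\<close> off that fibre. It is smooth iff its pairings with all smooth sections of \<open>E\<close> are.\<close>

definition dual_pair :: "('m \<Rightarrow> 'e \<Rightarrow> real) \<Rightarrow> ('m \<Rightarrow> 'e) \<Rightarrow> 'm \<Rightarrow> real" where
  "dual_pair \<theta> \<xi> = (\<lambda>p. \<theta> p (\<xi> p))"

definition dual_sections :: "('m::topological_space, 'e::topological_space, 'a::real_inner, 'f::real_inner, 'z) vbundle_scheme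
    \<Rightarrow> ('m \<Rightarrow> 'e \<Rightarrow> real) set" where
  "dual_sections E = {\<theta>.
     (\<forall>p u v. bproj E u = p \<longrightarrow> bproj E v = p \<longrightarrow> \<theta> p (fib_add E u v) = \<theta> p u + \<theta> p v) \<and>
     (\<forall>p c u. bproj E u = p \<longrightarrow> \<theta> p (fib_scale E c u) = c * \<theta> p u) \<and>
     (\<forall>p u. bproj E u \<noteq> p \<longrightarrow> \<theta> p u = 0) \<and>
     (\<forall>\<xi>\<in>sections E. dual_pair \<theta> \<xi> \<in> Cinf (base_atlas E))}"

definition dual_hat :: "('m, 'e, 'a, 'f, 'z) vbundle_scheme \<Rightarrow> ('m \<Rightarrow> 'e \<Rightarrow> real) \<Rightarrow> 'e \<Rightarrow> real" where
  "dual_hat E \<theta> = (\<lambda>u. \<theta> (bproj E u) u)"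

definition dual_lie :: "('m::topological_space, 'e::topological_space, 'a::real_inner, 'f::real_inner, 'z) lie_algd_scheme
    \<Rightarrow> ('m \<Rightarrow> 'e) \<Rightarrow> ('m \<Rightarrow> 'e \<Rightarrow> real) \<Rightarrow> 'm \<Rightarrow> 'e \<Rightarrow> real" where
  "dual_lie E \<eta> \<theta> = (THE \<theta>'. \<theta>' \<in> dual_sections E \<and>
     (\<forall>\<xi>\<in>sections E. \<forall>p. dual_pair \<theta>' \<xi> p =
        anchor_deriv E \<eta> (dual_pair \<theta> \<xi>) p - dual_pair \<theta> (la_bracket E \<eta> \<xi>) p))"

definition vertical_lift :: "('m, 'e::topological_space, 'a::real_inner, 'f::real_inner, 'z) vbundle_scheme
    \<Rightarrow> ('m \<Rightarrow> 'e) \<Rightarrow> 'e \<Rightarrow> 'e \<times> 'e tangent" where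
  "vertical_lift E \<eta> = i_map E \<circ> hat E \<eta>"

definition complete_lift_vf :: "('m::topological_space, 'e::topological_space, 'a::real_inner, 'f::real_inner, 'z) lie_algd_scheme
    \<Rightarrow> ('m \<Rightarrow> 'e) \<Rightarrow> 'e \<Rightarrow> 'e tangent" where
  "complete_lift_vf E \<eta> = (THE Z. Z \<in> vector_fields (total_atlas E) \<and>
     (\<forall>u. pushforward (base_atlas E) (bproj E) (Z u) = la_anchor E (\<eta> (bproj E u))) \<and>
     (\<forall>\<theta>\<in>dual_sections E. vf_apply Z (dual_hat E \<theta>) = dual_hat E (dual_lie E \<eta> \<theta>)))"

definition complete_lift :: "('m::topological_space, 'e::topological_space, 'a::real_inner, 'f::real_inner, 'z) lie_algd_scheme
    \<Rightarrow> ('m \<Rightarrow> 'e) \<Rightarrow> 'e \<Rightarrow> 'e \<times> 'e tangent" where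
  "complete_lift E \<eta> = (\<lambda>u. (\<eta> (bproj E u), complete_lift_vf E \<eta> u))"

section \<open>Sprays and the Berwald connection\<close>

text \<open>From here on \<open>br\<close> is the bracket of the prolongation.\<close>

type_synonym 'e pb_sec = "'e \<Rightarrow> 'e \<times> 'e"
type_synonym 'e pr_sec = "'e \<Rightarrow> 'e \<times> 'e tangent"

definition semispray :: "('m::topological_space, 'e::topological_space, 'a::real_inner, 'f::real_inner, 'z) lie_algd_scheme
    \<Rightarrow> 'e pr_sec \<Rightarrow> bool" where
  "semispray E S \<longleftrightarrow> S \<in> pr_sections E \<and> i_map E \<circ> j_map \<circ> S = liouville E"

definition spray :: "('m::topological_space, 'e::topological_space, 'a::real_inner, 'f::real_inner, 'z) lie_algd_scheme
    \<Rightarrow> ('e pr_sec \<Rightarrow> 'e pr_sec \<Rightarrow> 'e pr_sec) \<Rightarrow> 'e pr_sec \<Rightarrow> bool" where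
  "spray E br S \<longleftrightarrow> semispray E S \<and> br (liouville E) S = S"

definition lie_symmetry :: "('m::topological_space, 'e::topological_space, 'a::real_inner, 'f::real_inner, 'z) lie_algd_scheme
    \<Rightarrow> ('e pr_sec \<Rightarrow> 'e pr_sec \<Rightarrow> 'e pr_sec) \<Rightarrow> 'e pr_sec \<Rightarrow> ('m \<Rightarrow> 'e) \<Rightarrow> bool" where
  "lie_symmetry E br S \<eta> \<longleftrightarrow> br S (complete_lift E \<eta>) = pr_zero E"

definition ehresmann_connection :: "('m::topological_space, 'e::topological_space, 'a::real_inner, 'f::real_inner, 'z) lie_algd_scheme
    \<Rightarrow> ('e pb_sec \<Rightarrow> 'e pr_sec) \<Rightarrow> bool" where
  "ehresmann_connection E H \<longleftrightarrow>
     (\<forall>s\<in>pb_sections E. H s \<in> pr_sections E \<and> j_map \<circ> H s = s) \<and>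
     (\<forall>s\<in>pb_sections E. \<forall>t\<in>pb_sections E. H (pb_add E s t) = pr_add E (H s) (H t)) \<and>
     (\<forall>F\<in>Cinf (total_atlas E). \<forall>s\<in>pb_sections E. H (pb_scale E F s) = pr_scale E F (H s))"

definition vertical_map :: "('m::topological_space, 'e::topological_space, 'a::real_inner, 'f::real_inner, 'z) lie_algd_scheme
    \<Rightarrow> ('e pb_sec \<Rightarrow> 'e pr_sec) \<Rightarrow> ('e pr_sec \<Rightarrow> 'e pb_sec) \<Rightarrow> bool" where
  "vertical_map E H V \<longleftrightarrow>
     (\<forall>s\<in>pr_sections E. V s \<in> pb_sections E) \<and>
     (\<forall>s\<in>pr_sections E. \<forall>t\<in>pr_sections E. V (pr_add E s t) = pb_add E (V s) (V t)) \<and>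
     (\<forall>F\<in>Cinf (total_atlas E). \<forall>s\<in>pr_sections E. V (pr_scale E F s) = pb_scale E F (V s)) \<and>
     (\<forall>s\<in>pb_sections E. V (i_map E \<circ> s) = s) \<and>
     {s \<in> pr_sections E. V s = pb_zero E} = H ` pb_sections E"

definition berwald_connection :: "('m::topological_space, 'e::topological_space, 'a::real_inner, 'f::real_inner, 'z) lie_algd_scheme
    \<Rightarrow> ('e pr_sec \<Rightarrow> 'e pr_sec \<Rightarrow> 'e pr_sec) \<Rightarrow> 'e pr_sec \<Rightarrow> ('e pb_sec \<Rightarrow> 'e pr_sec) \<Rightarrow> bool" where
  "berwald_connection E br S H \<longleftrightarrow> ehresmann_connection E H \<and>
     (\<forall>\<eta>\<in>sections E. H (hat E \<eta>) =
        pr_scale E (\<lambda>_. 1/2) (pr_add E (complete_lift E \<eta>) (br (vertical_lift E \<eta>) S)))"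

section \<open>Tensor derivations and curvature tensors\<close>

text \<open>A type \<open>(1,k)\<close> tensor on \<open>\<pi>\<^sup>*\<pi>\<close> is viewed as a map taking a list of \<open>k\<close> sections of
  \<open>\<pi>\<^sup>*E\<close> to a section of \<open>\<pi>\<^sup>*E\<close>. Given the action of a tensor derivation on sections, its
  compatibility with tensor products and contractions yields its value on such a tensor:
  \<open>(D A)(s\<^sub>1, \<dots>, s\<^sub>k) = D (A(s\<^sub>1, \<dots>, s\<^sub>k)) - \<Sum>\<^sub>i A(s\<^sub>1, \<dots>, D s\<^sub>i, \<dots>, s\<^sub>k)\<close>.\<close>

definition tensor_deriv :: "('m, 'e, 'a, 'f, 'z) vbundle_scheme \<Rightarrow> ('e pb_sec \<Rightarrow> 'e pb_sec)
    \<Rightarrow> ('e pb_sec list \<Rightarrow> 'e pb_sec) \<Rightarrow> 'e pb_sec list \<Rightarrow> 'e pb_sec" where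
  "tensor_deriv E D A ss =
     pb_diff E (D (A ss)) (pb_sum_list E (map (\<lambda>k. A (ss[k := D (ss ! k)])) [0..<length ss]))"

definition nabla_v :: "('m::topological_space, 'e::topological_space, 'a::real_inner, 'f::real_inner, 'z) lie_algd_scheme
    \<Rightarrow> ('e pr_sec \<Rightarrow> 'e pr_sec \<Rightarrow> 'e pr_sec) \<Rightarrow> 'e pb_sec \<Rightarrow> 'e pb_sec \<Rightarrow> 'e pb_sec" where
  "nabla_v E br \<xi> \<eta> = j_map \<circ> br (i_map E \<circ> \<xi>) (SOME \<sigma>. \<sigma> \<in> pr_sections E \<and> j_map \<circ> \<sigma> = \<eta>)"

text \<open>The new argument of \<open>\<nabla>\<^sup>v A\<close> is the first one.\<close>

definition vert_differential :: "('m::topological_space, 'e::topological_space, 'a::real_inner, 'f::real_inner, 'z) lie_algd_scheme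
    \<Rightarrow> ('e pr_sec \<Rightarrow> 'e pr_sec \<Rightarrow> 'e pr_sec) \<Rightarrow> ('e pb_sec list \<Rightarrow> 'e pb_sec) \<Rightarrow> 'e pb_sec list \<Rightarrow> 'e pb_sec" where
  "vert_differential E br A ss = tensor_deriv E (nabla_v E br (hd ss)) A (tl ss)"

definition lie_pb :: "('m::topological_space, 'e::topological_space, 'a::real_inner, 'f::real_inner, 'z) lie_algd_scheme
    \<Rightarrow> ('e pr_sec \<Rightarrow> 'e pr_sec \<Rightarrow> 'e pr_sec) \<Rightarrow> 'e pr_sec \<Rightarrow> 'e pb_sec \<Rightarrow> 'e pb_sec" where
  "lie_pb E br \<xi> \<eta> = i_inv E (br \<xi> (i_map E \<circ> \<eta>))"

definition curvature_collineation :: "('m::topological_space, 'e::topological_space, 'a::real_inner, 'f::real_inner, 'z) lie_algd_scheme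
    \<Rightarrow> ('e pr_sec \<Rightarrow> 'e pr_sec \<Rightarrow> 'e pr_sec) \<Rightarrow> nat \<Rightarrow> ('e pb_sec list \<Rightarrow> 'e pb_sec) \<Rightarrow> 'e pr_sec \<Rightarrow> bool" where
  "curvature_collineation E br k A \<xi> \<longleftrightarrow> k \<in> {1, 2, 3} \<and> projectable E \<xi> \<and>
     (\<forall>ss. length ss = k \<longrightarrow> set ss \<subseteq> pb_sections E \<longrightarrow>
        tensor_deriv E (lie_pb E br \<xi>) A ss = pb_zero E)"

definition jacobi_endomorphism :: "('e pr_sec \<Rightarrow> 'e pr_sec \<Rightarrow> 'e pr_sec) \<Rightarrow> 'e pr_sec
    \<Rightarrow> ('e pb_sec \<Rightarrow> 'e pr_sec) \<Rightarrow> ('e pr_sec \<Rightarrow> 'e pb_sec) \<Rightarrow> 'e pb_sec list \<Rightarrow> 'e pb_sec" where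
  "jacobi_endomorphism br S H V ss = V (br S (H (ss ! 0)))"

definition fundamental_affine_curvature ::
    "('m::topological_space, 'e::topological_space, 'a::real_inner, 'f::real_inner, 'z) lie_algd_scheme
    \<Rightarrow> ('e pr_sec \<Rightarrow> 'e pr_sec \<Rightarrow> 'e pr_sec) \<Rightarrow> 'e pr_sec
    \<Rightarrow> ('e pb_sec \<Rightarrow> 'e pr_sec) \<Rightarrow> ('e pr_sec \<Rightarrow> 'e pb_sec) \<Rightarrow> 'e pb_sec list \<Rightarrow> 'e pb_sec" where
  "fundamental_affine_curvature E br S H V ss = pb_scale E (\<lambda>_. 1/3)
     (pb_diff E (vert_differential E br (jacobi_endomorphism br S H V) [ss ! 1, ss ! 0])
                (vert_differential E br (jacobi_endomorphism br S H V) [ss ! 0, ss ! 1]))"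

text \<open>The list of arguments for \<open>H(\<eta>, \<xi>)\<sigma>\<close> is \<open>[\<eta>, \<xi>, \<sigma>]\<close>.\<close>

definition affine_curvature ::
    "('m::topological_space, 'e::topological_space, 'a::real_inner, 'f::real_inner, 'z) lie_algd_scheme
    \<Rightarrow> ('e pr_sec \<Rightarrow> 'e pr_sec \<Rightarrow> 'e pr_sec) \<Rightarrow> 'e pr_sec
    \<Rightarrow> ('e pb_sec \<Rightarrow> 'e pr_sec) \<Rightarrow> ('e pr_sec \<Rightarrow> 'e pb_sec) \<Rightarrow> 'e pb_sec list \<Rightarrow> 'e pb_sec" where
  "affine_curvature E br S H V ss =
     vert_differential E br (fundamental_affine_curvature E br S H V) [ss ! 2, ss ! 0, ss ! 1]"

end

theory Submission
  imports Defs "HOL-Computational_Algebra.Polynomial"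
begin

text \<open>
  The Lie derivation \<open>L\<close> along \<open>\<eta>\<^sup>C\<close> commutes with every ingredient of the curvature tensors. Since
  \<open>[\<eta>\<^sup>C, \<xi>\<^sup>C] = [\<eta>, \<xi>]\<^sup>C\<close>, \<open>[\<eta>\<^sup>C, \<xi>\<^sup>V] = [\<eta>, \<xi>]\<^sup>V\<close> and \<open>[\<eta>\<^sup>C, S] = 0\<close>, the formula for the Berwald
  connection gives \<open>[\<eta>\<^sup>C, H \<xi>] = H (L \<xi>)\<close> for basic sections \<open>\<xi>\<close>; the difference of the two sides is
  \<open>C\<^sup>\<infinity>(E)\<close>-linear and basic sections generate locally, so this holds for all sections of the pullback bundle.
  Splitting a section of the prolongation as \<open>i \<circ> V + H \<circ> j\<close>, we see that \<open>L\<close> intertwines \<open>[\<eta>\<^sup>C, -]\<close> with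
  \<open>V\<close> and \<open>j\<close> too, and the Jacobi identity shows that the Jacobi endomorphism and the vertical derivative
  are invariant. The other two curvatures are built from these.

  Smooth analysis enters only through bump functions, global sections extending a local frame, and the
  smoothness of vertical vector fields. In particular no description of general tangent vectors in charts is
  needed: exactness of the sequence \<open>i\<close>, \<open>j\<close> on sections follows from the existence of \<open>V\<close>, and the
  existence of complete lifts is derived from the semispray.
\<close>


section \<open>Smooth functions on inner product spaces\<close>

text \<open>Complete lifts, Lie derivatives of one-forms, preimages under \<open>i_map\<close> and
  the lift inside \<open>nabla_v\<close> are defined by \<open>THE\<close> and \<open>SOME\<close>,
  so none of them can be computed with before existence, and where it matters uniqueness, is
  settled. Fibrewise linear functions \<open>dual_hat E \<theta>\<close> give uniqueness: a vertical
  section i(t) sends such a function to the pairing of \<theta> with t, hence is determined by these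
  values, and \<open>V\<close> shows that every section killed by \<open>j_map\<close> has the form
  i(t). They also explain the formula for complete lifts. If P is projectable over X, then P applied
  to the function of \<theta> exceeds the required value exactly by the pairing of \<theta> with
  j[P, S]; adding the vertical section -J[P, S] removes the excess. Fibre operations are accessible
  only through trivializations. Identities between sections of the pullback bundle are therefore
  tested by pairing with one-forms, where they become identities of real functions. Frames and bump
  functions ensure that there are enough one-forms and that smoothness can be tested in the same
  way.\<close>

lemma Ck_on_cong:
  assumes "open S" "\<And>x. x \<in> S \<Longrightarrow> f x = g x" "Ck_on k S f"
  shows "Ck_on k S g"
  using assms
proof (induction k arbitrary: f g)
  case 0
  then show ?case by (simp cong: continuous_on_cong)
next
  case (Suc k)
  have f: "f differentiable (at x)" if "x \<in> S" for x
    using Suc.prems(3) that by simp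
  have g: "g differentiable (at x)" if x: "x \<in> S" for x
  proof -
    obtain D where "(f has_derivative D) (at x)"
      using f[OF x] unfolding differentiable_def by (elim exE)
    then have "(g has_derivative D) (at x)"
      by (rule has_derivative_transform_within_open[OF _ Suc.prems(1) x]) (rule Suc.prems(2))
    then show ?thesis by (rule differentiableI)
  qed
  have "frechet_derivative f (at x) = frechet_derivative g (at x)" if "x \<in> S" for x
    using frechet_derivative_transform_within_open[OF f[OF that] Suc.prems(1) that Suc.prems(2)] .
  then have "Ck_on k S (\<lambda>x. frechet_derivative g (at x) v)" for v
    using Suc.prems by (intro Suc.IH[of "\<lambda>x. frechet_derivative f (at x) v" "\<lambda>x. frechet_derivative g (at x) v"]) auto
  with g show ?case by simp
qed

text \<open>Lets a derivative be supplied in closed form, so that the closure properties below can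
  reuse their own induction hypothesis on its summands.\<close>

lemma Ck_on_Suc_intro:
  assumes "open S" "\<And>x. x \<in> S \<Longrightarrow> (f has_derivative f' x) (at x)" "\<And>v. Ck_on k S (\<lambda>x. f' x v)"
  shows "Ck_on (Suc k) S f"
proof -
  have "f' x v = frechet_derivative f (at x) v" if "x \<in> S" for x v
    using frechet_derivative_at[OF assms(2)[OF that]] by simp
  then have "Ck_on k S (\<lambda>x. frechet_derivative f (at x) v)" for v
    by (rule Ck_on_cong[OF assms(1) _ assms(3)[of v]])
  moreover have "\<forall>x\<in>S. f differentiable (at x)"
    using assms(2) differentiable_def by blast
  ultimately show ?thesis by simp
qed

lemma Ck_on_derivative:
  assumes "Ck_on (Suc k) S f" "x \<in> S"
  shows "(f has_derivative frechet_derivative f (at x)) (at x)"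
  using assms frechet_derivative_works by auto

lemma Ck_on_Suc_D: "Ck_on (Suc k) S f \<Longrightarrow> Ck_on k S f"
proof (induction k arbitrary: f)
  case 0
  then show ?case
    by (auto intro!: continuous_at_imp_continuous_on differentiable_imp_continuous_within)
next
  case (Suc k)
  from Suc.prems have "\<forall>v. Ck_on (Suc k) S (\<lambda>x. frechet_derivative f (at x) v)"
    by (simp del: Ck_on.simps add: Ck_on.simps(2)[of "Suc k"])
  then show ?case
    using Suc.IH Suc.prems by (simp only: Ck_on.simps(2)) blast
qed

lemma Ck_on_subset: "Ck_on k S f \<Longrightarrow> T \<subseteq> S \<Longrightarrow> Ck_on k T f"
  by (induction k arbitrary: f) (auto intro: continuous_on_subset)

lemma Ck_on_Union:
  assumes "\<And>T. T \<in> \<T> \<Longrightarrow> open T" "\<And>T. T \<in> \<T> \<Longrightarrow> Ck_on k T f"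
  shows "Ck_on k (\<Union>\<T>) f"
  using assms(2)
  by (induction k arbitrary: f) (auto intro: continuous_on_open_Union assms(1))

lemma Ck_on_const [simp]: "Ck_on k S (\<lambda>_. c)"
  by (induction k arbitrary: c) auto

lemma Ck_on_bounded_linear_comp:
  assumes "open S" "bounded_linear L" "Ck_on k S f"
  shows "Ck_on k S (\<lambda>x. L (f x))"
  using assms(3)
proof (induction k arbitrary: f)
  case 0
  then show ?case using bounded_linear.continuous_on[OF assms(2)] by auto
next
  case (Suc k)
  show ?case
    using Suc Ck_on_derivative[OF Suc.prems]
    by (intro Ck_on_Suc_intro[where f' = "\<lambda>x v. L (frechet_derivative f (at x) v)"] assms(1))
       (auto intro: bounded_linear.has_derivative[OF assms(2)])
qed

lemma Ck_on_add:
  assumes "open S" "Ck_on k S f" "Ck_on k S g"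
  shows "Ck_on k S (\<lambda>x. f x + g x)"
  using assms(2,3)
proof (induction k arbitrary: f g)
  case 0
  then show ?case by (auto intro: continuous_on_add)
next
  case (Suc k)
  show ?case
    using Suc Ck_on_derivative[OF Suc.prems(1)] Ck_on_derivative[OF Suc.prems(2)]
    by (intro Ck_on_Suc_intro[where f' = "\<lambda>x v. frechet_derivative f (at x) v + frechet_derivative g (at x) v"]
         assms(1)) (auto intro: has_derivative_add)
qed

lemma Ck_on_bilinear:
  assumes "open S" "bounded_bilinear bop" "Ck_on k S f" "Ck_on k S g"
  shows "Ck_on k S (\<lambda>x. bop (f x) (g x))"
  using assms(3,4)
proof (induction k arbitrary: f g)
  case 0
  then show ?case using bounded_bilinear.continuous_on[OF assms(2)] by auto
next
  case (Suc k)
  show ?case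
  proof (rule Ck_on_Suc_intro[where f' = "\<lambda>x v. bop (f x) (frechet_derivative g (at x) v) + bop (frechet_derivative f (at x) v) (g x)"])
    fix v
    show "Ck_on k S (\<lambda>x. bop (f x) (frechet_derivative g (at x) v) + bop (frechet_derivative f (at x) v) (g x))"
      using Suc Ck_on_Suc_D[OF Suc.prems(1)] Ck_on_Suc_D[OF Suc.prems(2)]
      by (intro Ck_on_add assms(1) Suc.IH) auto
  qed (use assms Ck_on_derivative[OF Suc.prems(1)] Ck_on_derivative[OF Suc.prems(2)] in
        \<open>auto intro: bounded_bilinear.FDERIV\<close>)
qed

lemma Ck_on_sum:
  assumes "open S" "\<And>b. b \<in> B \<Longrightarrow> Ck_on k S (f b)"
  shows "Ck_on k S (\<lambda>x. \<Sum>b\<in>B. f b x)"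
  using assms(2) by (induction B rule: infinite_finite_induct) (auto intro: Ck_on_add assms(1))

text \<open>An orthonormal basis, possibly enlarged by zero.\<close>

definition finite_frame :: "'a::real_inner set \<Rightarrow> bool" where
  "finite_frame B \<longleftrightarrow> finite B \<and> (\<forall>x. x = (\<Sum>b\<in>B. (x \<bullet> b) *\<^sub>R b))"

lemma finite_frame_exists:
  assumes "finite A" "span A = (UNIV :: 'a::real_inner set)"
  shows "\<exists>B::'a set. finite_frame B"
proof -
  from basis_orthogonal[OF assms(1)] obtain C
    where C: "finite C" "span C = span A" "pairwise orthogonal C"
    by (elim exE conjE)
  \<comment> \<open>A zero vector in \<open>C\<close> is sent to zero, since
    \<open>inverse 0 = 0\<close>. It remains in \<open>D\<close> and contributes nothing to any
    expansion, so it need not be removed.\<close>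
  define D where "D = (\<lambda>c. c /\<^sub>R norm c) ` C"
  have orth: "c \<bullet> d = 0" if "c \<in> C" "d \<in> C" "c \<noteq> d" for c d
    using C(3) that by (auto simp: pairwise_def orthogonal_def)
  have "finite D" using C(1) by (simp add: D_def)
  have DD: "b \<bullet> d = (if b = d then (if b = 0 then 0 else 1) else 0)" if bd: "b \<in> D" "d \<in> D" for b d
  proof -
    obtain c c' where c: "c \<in> C" "c' \<in> C" "b = c /\<^sub>R norm c" "d = c' /\<^sub>R norm c'"
      using bd by (auto simp: D_def)
    show ?thesis
    proof (cases "b = d")
      case True
      then show ?thesis
        using c by (auto simp: dot_square_norm power2_eq_square)
    next
      case False
      then show ?thesis using c orth[of c c'] by auto
    qed
  qed
  have "x = (\<Sum>b\<in>D. (x \<bullet> b) *\<^sub>R b)" for x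
  proof -
    have "x \<in> span C" using C(2) assms(2) by simp
    then show ?thesis
    proof (induction rule: span_induct_alt)
      case base
      then show ?case by simp
    next
      case (step a c y)
      define d where "d = c /\<^sub>R norm c"
      have d: "d \<in> D" using step by (auto simp: D_def d_def)
      have c: "c = norm c *\<^sub>R d" by (cases "c = 0") (auto simp: d_def)
      have "(\<Sum>b\<in>D. (d \<bullet> b) *\<^sub>R b) = (\<Sum>b\<in>D. if b = d then d else 0)"
        by (rule sum.cong) (use d DD in auto)
      then have dd: "(\<Sum>b\<in>D. (d \<bullet> b) *\<^sub>R b) = d"
        using d \<open>finite D\<close> by simp
      have "(\<Sum>b\<in>D. ((a *\<^sub>R c + y) \<bullet> b) *\<^sub>R b)
          = (a * norm c) *\<^sub>R (\<Sum>b\<in>D. (d \<bullet> b) *\<^sub>R b) + (\<Sum>b\<in>D. (y \<bullet> b) *\<^sub>R b)"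
        by (subst c) (simp add: inner_add_left scaleR_add_left sum.distrib scaleR_sum_right)
      also have "\<dots> = a *\<^sub>R c + y" 
        unfolding dd using step c by (metis scaleR_scaleR)
      finally show ?case by simp
    qed
  qed
  with \<open>finite D\<close> show ?thesis unfolding finite_frame_def by blast
qed

lemma finite_frame_linear:
  assumes "finite_frame B" "linear h"
  shows "h x = (\<Sum>b\<in>B. (x \<bullet> b) *\<^sub>R h b)"
proof -
  have "h x = h (\<Sum>b\<in>B. (x \<bullet> b) *\<^sub>R b)"
    using assms(1) unfolding finite_frame_def by metis
  also have "\<dots> = (\<Sum>b\<in>B. (x \<bullet> b) *\<^sub>R h b)"
    using assms(2) by (simp add: linear_sum linear_scale)
  finally show ?thesis .
qed

text \<open>In the chain rule the direction in which \<open>g\<close> is differentiated varies with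
  the point, whereas \<open>Ck_on\<close> only controls derivatives in fixed directions. Expanding
  that direction in a finite frame gives a finite sum of products of functions covered by the
  induction.\<close>

lemma Ck_on_compose:
  fixes f :: "'a::real_normed_vector \<Rightarrow> 'b::real_inner" and g :: "'b \<Rightarrow> 'c::real_normed_vector"
  assumes "finite_frame (B :: 'b set)" "open S" "open T" "f ` S \<subseteq> T"
    and "Ck_on k S f" "Ck_on k T g"
  shows "Ck_on k S (\<lambda>x. g (f x))"
  using assms(5,6)
proof (induction k arbitrary: g)
  case 0
  then show ?case using assms(4) by (auto intro: continuous_on_compose2)
next
  case (Suc k)
  let ?df = "\<lambda>x. frechet_derivative f (at x)" and ?dg = "\<lambda>x. frechet_derivative g (at x)"
  show ?case
  proof (rule Ck_on_Suc_intro[where f' = "\<lambda>x v. \<Sum>b\<in>B. (?df x v \<bullet> b) *\<^sub>R ?dg (f x) b"])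
    fix x assume x: "x \<in> S"
    then have fx: "f x \<in> T" using assms(4) by auto
    have "((\<lambda>x. g (f x)) has_derivative (\<lambda>v. ?dg (f x) (?df x v))) (at x)"
      using has_derivative_compose[OF Ck_on_derivative[OF Suc.prems(1) x] Ck_on_derivative[OF Suc.prems(2) fx]] .
    moreover have "?dg (f x) (?df x v) = (\<Sum>b\<in>B. (?df x v \<bullet> b) *\<^sub>R ?dg (f x) b)" for v
      using finite_frame_linear[OF assms(1) has_derivative_linear[OF Ck_on_derivative[OF Suc.prems(2) fx]]] .
    ultimately show "((\<lambda>x. g (f x)) has_derivative (\<lambda>v. \<Sum>b\<in>B. (?df x v \<bullet> b) *\<^sub>R ?dg (f x) b)) (at x)"
      by simp
  next
    fix v
    have "Ck_on k S (\<lambda>x. ?df x v \<bullet> b)" for b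
      using Suc.prems by (intro Ck_on_bounded_linear_comp[OF assms(2) bounded_linear_inner_left]) auto
    moreover have "Ck_on k S (\<lambda>x. ?dg (f x) b)" for b
      using Suc.prems(2) by (intro Suc.IH Ck_on_Suc_D[OF Suc.prems(1)]) auto
    ultimately show "Ck_on k S (\<lambda>x. \<Sum>b\<in>B. (?df x v \<bullet> b) *\<^sub>R ?dg (f x) b)"
      by (intro Ck_on_sum assms(2) Ck_on_bilinear[OF assms(2) bounded_bilinear_scaleR])
  qed (fact assms(2))
qed

text \<open>The derivative is built from products of \<open>inverse\<close> with itself, so the
  induction hypothesis already covers it.\<close>

lemma Ck_on_inverse: "Ck_on k (- {0::real}) inverse"
proof (induction k)
  case 0
  then show ?case by (auto intro: continuous_on_inverse continuous_on_id)
next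
  case (Suc k)
  have o: "open (- {0::real})" by auto
  show ?case
    by (rule Ck_on_Suc_intro[where f' = "\<lambda>x v. - (inverse x * inverse x) * v", OF o])
      (auto intro!: derivative_eq_intros Suc Ck_on_bilinear[OF o bounded_bilinear_mult]
        Ck_on_bounded_linear_comp[OF o bounded_linear_minus[OF bounded_linear_ident]])
qed

text \<open>For \<open>q = 1\<close> this is the classical smooth function exp(-1/x), flat at 0. The
  polynomial in 1/x makes the family closed under differentiation, so that smoothness follows by one
  induction over all \<open>q\<close>.\<close>

definition flat_exp :: "real poly \<Rightarrow> real \<Rightarrow> real" where
  "flat_exp q x = (if x > 0 then poly q (1/x) * exp (- (1/x)) else 0)"

lemma poly_times_exp_tendsto_0: "((\<lambda>y. poly q y * exp (- y)) \<longlongrightarrow> (0::real)) at_top"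
proof -
  have "((\<lambda>y. \<Sum>i\<le>degree q. coeff q i * (y ^ i / exp y)) \<longlongrightarrow> (\<Sum>i\<le>degree q. coeff q i * 0)) at_top"
    by (intro tendsto_sum tendsto_mult tendsto_const tendsto_power_div_exp_0)
  moreover have "(\<Sum>i\<le>degree q. coeff q i * (y ^ i / exp y)) = poly q y * exp (- y)" for y :: real
    by (simp add: poly_altdef sum_distrib_right exp_minus divide_inverse mult.assoc)
  ultimately show ?thesis by simp
qed

lemma flat_exp_tendsto_0: "(flat_exp q \<longlongrightarrow> 0) (at 0)"
proof -
  have "(flat_exp q \<longlongrightarrow> 0) (at_left 0)"
    by (rule tendsto_eventually) (auto simp: eventually_at_filter flat_exp_def)
  moreover have "(flat_exp q \<longlongrightarrow> 0) (at_right 0)"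
  proof -
    have "((\<lambda>x. poly q (inverse x) * exp (- inverse x)) \<longlongrightarrow> (0::real)) (at_right 0)"
      using filterlim_compose[OF poly_times_exp_tendsto_0 filterlim_inverse_at_top_right] .
    then show ?thesis
      by (rule Lim_transform_eventually)
        (auto simp: eventually_at_filter flat_exp_def divide_inverse)
  qed
  ultimately show ?thesis by (simp add: filterlim_split_at)
qed

text \<open>With y = 1/x, differentiating q(y) exp(-y) in x gives y^2 (q(y) - q'(y)) exp(-y), and
  \<open>[:0, 0, 1:]\<close> is the factor y^2.\<close>

lemma flat_exp_derivative:
  "(flat_exp q has_field_derivative flat_exp ([:0, 0, 1:] * (q - pderiv q)) x) (at x)"
proof (cases x "0::real" rule: linorder_cases)
  case less
  have "((\<lambda>_. 0) has_field_derivative flat_exp ([:0, 0, 1:] * (q - pderiv q)) x) (at x)"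
    using less by (auto simp: flat_exp_def)
  then show ?thesis
    by (rule has_field_derivative_transform_within_open[where S = "{..<0}"])
      (use less in \<open>auto simp: flat_exp_def\<close>)
next
  case equal
  \<comment> \<open>Dividing by h multiplies the polynomial by its variable 1/h, so the difference
    quotient at 0 is again a member of the family. At h = 0 both sides are 0, by the convention for
    division by zero.\<close>
  have eq: "flat_exp (pCons 0 q) = (\<lambda>h. (flat_exp q (0 + h) - flat_exp q 0) / h)"
    by (rule ext) (auto simp: flat_exp_def)
  have "((\<lambda>h. (flat_exp q (0 + h) - flat_exp q 0) / h) \<longlongrightarrow> 0) (at 0)"
    using flat_exp_tendsto_0[of "pCons 0 q"] unfolding eq .
  then show ?thesis using equal by (simp add: DERIV_def flat_exp_def)
next
  case greater
  have "((\<lambda>x. poly q (1/x) * exp (- (1/x))) has_field_derivative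
      flat_exp ([:0, 0, 1:] * (q - pderiv q)) x) (at x)"
    using greater
    by (auto intro!: derivative_eq_intros DERIV_chain2[OF poly_DERIV] simp: flat_exp_def field_simps power2_eq_square)
  then show ?thesis
    by (rule has_field_derivative_transform_within_open[where S = "{0<..}"])
      (use greater in \<open>auto simp: flat_exp_def\<close>)
qed

lemma Ck_on_flat_exp: "Ck_on k UNIV (flat_exp q)"
proof (induction k arbitrary: q)
  case 0
  then show ?case
    using DERIV_isCont[OF flat_exp_derivative] by (auto intro: continuous_at_imp_continuous_on)
next
  case (Suc k)
  show ?case
    by (rule Ck_on_Suc_intro[where f' = "\<lambda>x v. flat_exp ([:0, 0, 1:] * (q - pderiv q)) x * v"])
      (use flat_exp_derivative in \<open>auto simp: has_field_derivative_def
        intro!: Suc Ck_on_bilinear[OF open_UNIV bounded_bilinear_mult]\<close>)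
qed

text \<open>The class \<open>real_inner\<close> alone does not make balls compact. A finite frame
  encloses the ball in the set of combinations with coefficients from a fixed interval, which is
  compact as a continuous image, built up one coefficient at a time.\<close>

lemma compact_cball_finite_frame:
  fixes B :: "'a::real_inner set"
  assumes "finite_frame B"
  shows "compact (cball (x::'a) r)"
proof -
  have cmp: "compact {(\<Sum>b\<in>C. c b *\<^sub>R b) |c. \<forall>b\<in>C. c b \<in> {-s..s}}" if "finite C" for C :: "'a set" and s :: real
    using that
  proof (induction C rule: finite_induct)
    case empty
    then show ?case by simp
  next
    case (insert d C)
    let ?K = "{(\<Sum>b\<in>C. c b *\<^sub>R b) |c. \<forall>b\<in>C. c b \<in> {-s..s}}"
    have "compact ((\<lambda>(t, y). t *\<^sub>R d + y) ` ({-s..s} \<times> ?K))"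
      by (intro compact_continuous_image compact_Times insert compact_Icc)
        (auto intro!: continuous_intros simp: case_prod_beta)
    moreover have "(\<lambda>(t, y). t *\<^sub>R d + y) ` ({-s..s} \<times> ?K)
        = {(\<Sum>b\<in>insert d C. c b *\<^sub>R b) |c. \<forall>b\<in>insert d C. c b \<in> {-s..s}}" (is "?l = ?r")
    proof
      show "?r \<subseteq> ?l"
      proof
        fix y assume "y \<in> ?r"
        then obtain c where c: "y = (\<Sum>b\<in>insert d C. c b *\<^sub>R b)" "\<forall>b\<in>insert d C. c b \<in> {-s..s}" by blast
        then have "y = (case (c d, \<Sum>b\<in>C. c b *\<^sub>R b) of (t, y) \<Rightarrow> t *\<^sub>R d + y)"
          using insert by simp
        then show "y \<in> ?l" using c by blast
      qed
      show "?l \<subseteq> ?r"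
      proof
        fix y assume "y \<in> ?l"
        then obtain t c where c: "t \<in> {-s..s}" "\<forall>b\<in>C. c b \<in> {-s..s}" "y = t *\<^sub>R d + (\<Sum>b\<in>C. c b *\<^sub>R b)"
          by auto
        have "(\<Sum>b\<in>C. (c(d := t)) b *\<^sub>R b) = (\<Sum>b\<in>C. c b *\<^sub>R b)"
          by (rule sum.cong) (use insert in auto)
        then have "y = (\<Sum>b\<in>insert d C. (c(d := t)) b *\<^sub>R b)"
          using insert c by simp
        moreover have "\<forall>b\<in>insert d C. (c(d := t)) b \<in> {-s..s}" using c by auto
        ultimately show "y \<in> ?r" by blast
      qed
    qed
    ultimately show ?case by simp
  qed
  \<comment> \<open>By Cauchy-Schwarz a coefficient is at most the norm of the vector times the norm
    of the frame element. Summing all frame norms gives one bound \<open>s\<close> for every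
    coefficient.\<close>
  define m where "m = (\<Sum>b\<in>B. norm b)"
  define s where "s = (norm x + \<bar>r\<bar>) * m"
  have "cball x r \<subseteq> {(\<Sum>b\<in>B. c b *\<^sub>R b) |c. \<forall>b\<in>B. c b \<in> {-s..s}}"
  proof
    fix y assume "y \<in> cball x r"
    then have ny: "norm y \<le> norm x + \<bar>r\<bar>"
      using norm_triangle_ineq2[of y x] by (auto simp: dist_norm norm_minus_commute)
    have "y \<bullet> b \<in> {-s..s}" if "b \<in> B" for b
    proof -
      have "norm b \<le> m"
        unfolding m_def using assms that by (intro member_le_sum) (auto simp: finite_frame_def)
      have "\<bar>y \<bullet> b\<bar> \<le> norm y * norm b" by (rule Cauchy_Schwarz_ineq2)
      also have "\<dots> \<le> s" unfolding s_def
        using ny \<open>norm b \<le> m\<close> by (intro mult_mono) auto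
      finally show ?thesis by auto
    qed
    moreover have "y = (\<Sum>b\<in>B. (y \<bullet> b) *\<^sub>R b)" using assms unfolding finite_frame_def by blast
    ultimately show "y \<in> {(\<Sum>b\<in>B. c b *\<^sub>R b) |c. \<forall>b\<in>B. c b \<in> {-s..s}}" by blast
  qed
  then show ?thesis
    using closed_Int_compact[OF closed_cball[of x r] cmp[of B s]] assms
    by (simp add: finite_frame_def Int_absorb2)
qed


section \<open>Smooth functions on manifolds\<close>

lemma smooth_on_cong:
  "open S \<Longrightarrow> (\<And>x. x \<in> S \<Longrightarrow> f x = g x) \<Longrightarrow> smooth_on S f \<Longrightarrow> smooth_on S g"
  unfolding smooth_on_def using Ck_on_cong[of S f g] by blast

lemma smooth_on_subset: "smooth_on S f \<Longrightarrow> T \<subseteq> S \<Longrightarrow> smooth_on T f"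
  unfolding smooth_on_def using Ck_on_subset by blast

lemma smooth_on_Union:
  "(\<And>T. T \<in> \<T> \<Longrightarrow> open T) \<Longrightarrow> (\<And>T. T \<in> \<T> \<Longrightarrow> smooth_on T f) \<Longrightarrow> smooth_on (\<Union>\<T>) f"
  unfolding smooth_on_def using Ck_on_Union by blast

lemma smooth_on_imp_continuous_on: "smooth_on S f \<Longrightarrow> continuous_on S f"
  unfolding smooth_on_def using Ck_on.simps(1) by blast

lemma smooth_on_compose:
  assumes "finite_frame (B :: 'b::real_inner set)" "open S" "open T" "f ` S \<subseteq> T"
    and "smooth_on S (f :: _ \<Rightarrow> 'b)" "smooth_on T g"
  shows "smooth_on S (g \<circ> f)"
  using assms Ck_on_compose[OF assms(1-4)] unfolding smooth_on_def comp_def by blast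

lemma smooth_on_flat_exp: "smooth_on UNIV (flat_exp q)"
  unfolding smooth_on_def using Ck_on_flat_exp by blast

lemma smooth_on_inverse: "smooth_on (- {0::real}) inverse"
  unfolding smooth_on_def using Ck_on_inverse by blast

lemma smooth_on_derivative:
  assumes "open S" "smooth_on S f"
  shows "smooth_on S (\<lambda>x. frechet_derivative f (at x) v)"
  unfolding smooth_on_def
proof
  fix k show "Ck_on k S (\<lambda>x. frechet_derivative f (at x) v)"
    using assms(2) Ck_on.simps(2)[of k S f] unfolding smooth_on_def by blast
qed

lemma smooth_on_has_derivative:
  assumes "smooth_on S f" "x \<in> S"
  shows "(f has_derivative frechet_derivative f (at x)) (at x)"
  using assms Ck_on_derivative[of 0 S f x] unfolding smooth_on_def by blast

lemma finite_frame_real: "finite_frame {1::real}"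
  by (simp add: finite_frame_def)

text \<open>Localizes \<open>Cinf\<close> to a subset and admits vector values, so that smoothness
  can be glued over open covers and stated for chart maps and fibre coordinates themselves.\<close>

definition smooth_fun_on ::
    "('m::topological_space, 'a::real_inner) atlas \<Rightarrow> 'm set \<Rightarrow> ('m \<Rightarrow> 'c::real_normed_vector) \<Rightarrow> bool" where
  "smooth_fun_on A W f \<longleftrightarrow> (\<forall>(U, \<phi>)\<in>A. smooth_on (\<phi> ` (U \<inter> W)) (f \<circ> inv_into U \<phi>))"

lemma smooth_fun_onD: "smooth_fun_on A W f \<Longrightarrow> (U, \<phi>) \<in> A \<Longrightarrow> smooth_on (\<phi> ` (U \<inter> W)) (f \<circ> inv_into U \<phi>)"
  unfolding smooth_fun_on_def by fast

lemma smooth_fun_onI: "(\<And>U \<phi>. (U, \<phi>) \<in> A \<Longrightarrow> smooth_on (\<phi> ` (U \<inter> W)) (f \<circ> inv_into U \<phi>)) \<Longrightarrow> smooth_fun_on A W f"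
  unfolding smooth_fun_on_def by fast

lemma Cinf_iff: "f \<in> Cinf A \<longleftrightarrow> smooth_fun_on A UNIV f"
  by (simp add: Cinf_def smooth_fun_on_def)

lemma is_chart_inverse: "is_chart U \<phi> \<Longrightarrow> x \<in> U \<Longrightarrow> inv_into U \<phi> (\<phi> x) = x"
  unfolding is_chart_def using homeomorphism_apply1 by metis

lemma is_chart_continuous_on: "is_chart U \<phi> \<Longrightarrow> continuous_on U \<phi>"
  by (simp add: is_chart_def homeomorphism_def)

lemma is_chart_continuous_on_inv: "is_chart U \<phi> \<Longrightarrow> continuous_on (\<phi> ` U) (inv_into U \<phi>)"
  by (simp add: is_chart_def homeomorphism_def)

lemma is_chart_inj_on: "is_chart U \<phi> \<Longrightarrow> inj_on \<phi> U"
  using is_chart_inverse by (metis inj_onI)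

lemma is_chart_open_image:
  assumes "is_chart U \<phi>" "open W"
  shows "open (\<phi> ` (U \<inter> W))"
proof -
  have h: "homeomorphism U (\<phi> ` U) \<phi> (inv_into U \<phi>)" "open (\<phi> ` U)"
    using assms(1) unfolding is_chart_def by auto
  have "openin (top_of_set U) (U \<inter> W)" using assms(2) by (rule openin_open_Int)
  then have "openin (top_of_set (\<phi> ` U)) (\<phi> ` (U \<inter> W))"
    using homeomorphism_imp_open_map[OF h(1)] by blast
  then show ?thesis using h(2) openin_open_trans by blast
qed

context
  fixes A :: "('m::{t2_space, second_countable_topology}, 'a::real_inner) atlas"
  assumes A: "smooth_manifold A"
begin

lemma manifold_is_chart: "(U, \<phi>) \<in> A \<Longrightarrow> is_chart U \<phi>"
  using A unfolding smooth_manifold_def by fast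

lemma manifold_open: "(U, \<phi>) \<in> A \<Longrightarrow> open U"
  using manifold_is_chart by (simp add: is_chart_def)

lemma manifold_chart_at: "\<exists>U \<phi>. (U, \<phi>) \<in> A \<and> p \<in> U"
  using A unfolding smooth_manifold_def by fast

lemma manifold_frame: "\<exists>B::'a set. finite_frame B"
  using A finite_frame_exists unfolding smooth_manifold_def by metis

lemma manifold_open_image: "(U, \<phi>) \<in> A \<Longrightarrow> open W \<Longrightarrow> open (\<phi> ` (U \<inter> W))"
  using manifold_is_chart is_chart_open_image by blast

lemma smooth_fun_on_subset: "smooth_fun_on A W f \<Longrightarrow> W' \<subseteq> W \<Longrightarrow> smooth_fun_on A W' f"
  unfolding smooth_fun_on_def by (fastforce intro: smooth_on_subset)

lemma smooth_fun_on_cong: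
  assumes "open W" "\<And>x. x \<in> W \<Longrightarrow> f x = g x" "smooth_fun_on A W f"
  shows "smooth_fun_on A W g"
proof (rule smooth_fun_onI)
  fix U \<phi> assume U: "(U, \<phi>) \<in> A"
  show "smooth_on (\<phi> ` (U \<inter> W)) (g \<circ> inv_into U \<phi>)"
    by (rule smooth_on_cong[OF manifold_open_image[OF U assms(1)] _ smooth_fun_onD[OF assms(3) U]])
      (use is_chart_inverse[OF manifold_is_chart[OF U]] assms(2) in auto)
qed

lemma smooth_fun_on_local:
  assumes "\<And>p. p \<in> W \<Longrightarrow> \<exists>W'. open W' \<and> p \<in> W' \<and> smooth_fun_on A W' f"
  shows "smooth_fun_on A W f"
proof (rule smooth_fun_onI)
  fix U \<phi> assume U: "(U, \<phi>) \<in> A"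
  let ?T = "{\<phi> ` (U \<inter> W') |W'. open W' \<and> smooth_fun_on A W' f}"
  have "smooth_on (\<Union>?T) (f \<circ> inv_into U \<phi>)"
    by (rule smooth_on_Union) (use manifold_open_image[OF U] smooth_fun_onD[OF _ U] in auto)
  moreover have "\<phi> ` (U \<inter> W) \<subseteq> \<Union>?T" using assms by blast
  ultimately show "smooth_on (\<phi> ` (U \<inter> W)) (f \<circ> inv_into U \<phi>)"
    by (rule smooth_on_subset)
qed

lemma Cinf_local:
  assumes "\<And>p. \<exists>W. open W \<and> p \<in> W \<and> smooth_fun_on A W f"
  shows "f \<in> Cinf A"
  unfolding Cinf_iff by (rule smooth_fun_on_local) (rule assms)

lemma Cinf_smooth_fun_on: "f \<in> Cinf A \<Longrightarrow> smooth_fun_on A W f"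
  unfolding Cinf_iff using smooth_fun_on_subset by blast

lemma smooth_fun_on_continuous_on:
  assumes "open W" "smooth_fun_on A W f"
  shows "continuous_on W f"
proof -
  have "continuous_on (U \<inter> W) f" if U: "(U, \<phi>) \<in> A" for U \<phi>
  proof -
    have "continuous_on (\<phi> ` (U \<inter> W)) (f \<circ> inv_into U \<phi>)"
      using smooth_fun_onD[OF assms(2) U] smooth_on_imp_continuous_on by blast
    moreover have "continuous_on (U \<inter> W) \<phi>"
      by (rule continuous_on_subset[OF is_chart_continuous_on[OF manifold_is_chart[OF U]]]) simp
    ultimately have "continuous_on (U \<inter> W) ((f \<circ> inv_into U \<phi>) \<circ> \<phi>)"
      by (rule continuous_on_compose[rotated])
    then show ?thesis
      by (rule continuous_on_eq) (use is_chart_inverse[OF manifold_is_chart[OF U]] in auto)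
  qed
  then have "continuous_on (\<Union>{U \<inter> W |U \<phi>. (U, \<phi>) \<in> A}) f"
    using manifold_is_chart assms(1) by (intro continuous_on_open_Union) (auto simp: is_chart_def)
  moreover have "W \<subseteq> \<Union>{U \<inter> W |U \<phi>. (U, \<phi>) \<in> A}"
  proof
    fix p assume "p \<in> W"
    moreover obtain U \<phi> where "(U, \<phi>) \<in> A" "p \<in> U" using manifold_chart_at by blast
    ultimately show "p \<in> \<Union>{U \<inter> W |U \<phi>. (U, \<phi>) \<in> A}" by blast
  qed
  ultimately show ?thesis by (rule continuous_on_subset)
qed

lemma smooth_fun_on_compose:
  assumes "finite_frame (B :: 'b::real_inner set)" "open W" "open T" "f ` W \<subseteq> T"
    and "smooth_fun_on A W (f :: _ \<Rightarrow> 'b)" "smooth_on T g"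
  shows "smooth_fun_on A W (\<lambda>x. g (f x))"
proof (rule smooth_fun_onI)
  fix U \<phi> assume U: "(U, \<phi>) \<in> A"
  have "smooth_on (\<phi> ` (U \<inter> W)) (g \<circ> (f \<circ> inv_into U \<phi>))"
    by (rule smooth_on_compose[OF assms(1) manifold_open_image[OF U assms(2)] assms(3) _
          smooth_fun_onD[OF assms(5) U] assms(6)])
      (use assms(4) is_chart_inverse[OF manifold_is_chart[OF U]] in auto)
  then show "smooth_on (\<phi> ` (U \<inter> W)) ((\<lambda>x. g (f x)) \<circ> inv_into U \<phi>)"
    by (simp add: comp_def)
qed

lemma smooth_fun_on_const [simp]: "smooth_fun_on A W (\<lambda>_. c)"
  by (simp add: smooth_fun_on_def smooth_on_def comp_def)

lemma smooth_fun_on_add: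
  assumes "open W" "smooth_fun_on A W f" "smooth_fun_on A W g"
  shows "smooth_fun_on A W (\<lambda>x. f x + g x)"
  using assms(2,3) manifold_open_image[OF _ assms(1)] unfolding smooth_fun_on_def smooth_on_def comp_def
  by (fastforce intro: Ck_on_add)

lemma smooth_fun_on_bilinear:
  assumes "open W" "bounded_bilinear bop" "smooth_fun_on A W f" "smooth_fun_on A W g"
  shows "smooth_fun_on A W (\<lambda>x. bop (f x) (g x))"
  using assms(3,4) manifold_open_image[OF _ assms(1)] unfolding smooth_fun_on_def smooth_on_def comp_def
  by (fastforce intro: Ck_on_bilinear[OF _ assms(2)])

lemmas smooth_fun_on_mult = smooth_fun_on_bilinear[OF _ bounded_bilinear_mult]
lemmas smooth_fun_on_scaleR = smooth_fun_on_bilinear[OF _ bounded_bilinear_scaleR]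
lemmas smooth_fun_on_inner = smooth_fun_on_bilinear[OF _ bounded_bilinear_inner]

lemma smooth_fun_on_bounded_linear:
  assumes "open W" "bounded_linear L" "smooth_fun_on A W f"
  shows "smooth_fun_on A W (\<lambda>x. L (f x))"
  using assms(3) manifold_open_image[OF _ assms(1)] unfolding smooth_fun_on_def smooth_on_def comp_def
  by (fastforce intro: Ck_on_bounded_linear_comp[OF _ assms(2)])

lemmas smooth_fun_on_snd = smooth_fun_on_bounded_linear[OF _ bounded_linear_snd]

lemma smooth_fun_on_Pair:
  assumes "open W" "smooth_fun_on A W f" "smooth_fun_on A W g"
  shows "smooth_fun_on A W (\<lambda>x. (f x, g x))"
proof -
  have l: "bounded_linear (\<lambda>a. (a, 0))" "bounded_linear (\<lambda>b. (0, b))"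
    by (auto intro!: bounded_linear_Pair bounded_linear_ident bounded_linear_zero)
  have "smooth_fun_on A W (\<lambda>x. (f x, 0) + (0, g x))"
    using smooth_fun_on_bounded_linear[OF assms(1) l(1) assms(2)]
      smooth_fun_on_bounded_linear[OF assms(1) l(2) assms(3)]
    by (rule smooth_fun_on_add[OF assms(1)])
  then show ?thesis by simp
qed

lemma smooth_fun_on_sum:
  assumes "open W" "\<And>b. b \<in> B \<Longrightarrow> smooth_fun_on A W (f b)"
  shows "smooth_fun_on A W (\<lambda>x. \<Sum>b\<in>B. f b x)"
  using assms(2) by (induction B rule: infinite_finite_induct) (auto intro: smooth_fun_on_add assms(1))

lemma smooth_fun_on_inverse:
  assumes "open W" "smooth_fun_on A W f" "\<And>x. x \<in> W \<Longrightarrow> f x \<noteq> (0::real)"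
  shows "smooth_fun_on A W (\<lambda>x. inverse (f x))"
  by (rule smooth_fun_on_compose[OF finite_frame_real assms(1) _ _ assms(2) smooth_on_inverse])
    (use assms(3) in auto)

lemma Cinf_const: "(\<lambda>_. c) \<in> Cinf A"
  by (simp add: Cinf_iff)

lemma Cinf_add: "f \<in> Cinf A \<Longrightarrow> g \<in> Cinf A \<Longrightarrow> (\<lambda>x. f x + g x) \<in> Cinf A"
  by (simp add: Cinf_iff smooth_fun_on_add)

lemma Cinf_mult: "f \<in> Cinf A \<Longrightarrow> g \<in> Cinf A \<Longrightarrow> (\<lambda>x. f x * g x) \<in> Cinf A"
  by (simp add: Cinf_iff smooth_fun_on_mult)

lemma Cinf_diff: "f \<in> Cinf A \<Longrightarrow> g \<in> Cinf A \<Longrightarrow> (\<lambda>x. f x - g x) \<in> Cinf A"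
  using Cinf_add[OF _ Cinf_mult[OF Cinf_const[of "-1"]], of f g] by simp

lemma admissible_chart_is_chart: "admissible_chart A V \<psi> \<Longrightarrow> is_chart V \<psi>"
  unfolding admissible_chart_def smooth_manifold_def by fast

lemma admissible_chart_smooth:
  assumes "admissible_chart A V \<psi>"
  shows "smooth_fun_on A V \<psi>"
  using assms unfolding admissible_chart_def smooth_manifold_def smooth_fun_on_def by fast

lemma admissible_chart_inverse_smooth:
  assumes "admissible_chart A V \<psi>" "(U, \<phi>) \<in> A"
  shows "smooth_on (\<psi> ` (V \<inter> U)) (\<phi> \<circ> inv_into V \<psi>)"
  using assms unfolding admissible_chart_def smooth_manifold_def by fast

text \<open>Smoothness is tested only in the charts of the given atlas, while bundle trivializations
  provide charts of the maximal one. The passage is a composition with a transition map on each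
  overlap, glued over the atlas.\<close>

lemma smooth_fun_on_admissible_chart:
  assumes V: "admissible_chart A V \<psi>" and "open W" "smooth_fun_on A W f"
  shows "smooth_on (\<psi> ` (V \<inter> W)) (f \<circ> inv_into V \<psi>)"
proof -
  obtain B :: "'a set" where B: "finite_frame B" using manifold_frame by blast
  note V' = admissible_chart_is_chart[OF V]
  let ?T = "{\<psi> ` (V \<inter> (U \<inter> W)) |U \<phi>. (U, \<phi>) \<in> A}"
  have "smooth_on (\<Union>?T) (f \<circ> inv_into V \<psi>)"
  proof (rule smooth_on_Union)
    show "open T" if "T \<in> ?T" for T
      using that is_chart_open_image[OF V' open_Int[OF manifold_open assms(2)]] by blast
    fix T assume "T \<in> ?T"
    then obtain U \<phi> where U: "(U, \<phi>) \<in> A" and T: "T = \<psi> ` (V \<inter> (U \<inter> W))" by blast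
    note U' = manifold_is_chart[OF U]
    have oT: "open T" unfolding T
      using is_chart_open_image[OF V' open_Int[OF manifold_open[OF U] assms(2)]] .
    have sm: "smooth_on T (\<phi> \<circ> inv_into V \<psi>)"
      using admissible_chart_inverse_smooth[OF V U] by (rule smooth_on_subset) (auto simp: T)
    have "smooth_on T ((f \<circ> inv_into U \<phi>) \<circ> (\<phi> \<circ> inv_into V \<psi>))"
      by (rule smooth_on_compose[OF B oT manifold_open_image[OF U assms(2)] _ sm smooth_fun_onD[OF assms(3) U]])
        (auto simp: T is_chart_inverse[OF V'])
    then show "smooth_on T (f \<circ> inv_into V \<psi>)"
      by (rule smooth_on_cong[OF oT, rotated]) (auto simp: T is_chart_inverse[OF V'] is_chart_inverse[OF U'])
  qed
  moreover have "\<psi> ` (V \<inter> W) \<subseteq> \<Union>?T"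
  proof
    fix y assume "y \<in> \<psi> ` (V \<inter> W)"
    then obtain p where p: "y = \<psi> p" "p \<in> V \<inter> W" by blast
    obtain U \<phi> where "(U, \<phi>) \<in> A" "p \<in> U" using manifold_chart_at by blast
    with p show "y \<in> \<Union>?T" by blast
  qed
  ultimately show ?thesis by (rule smooth_on_subset)
qed

end

section \<open>Smooth maps between manifolds, and bump functions\<close>

lemma smooth_map_smooth_fun_on:
  assumes A: "smooth_manifold A" and B: "smooth_manifold B"
    and F: "smooth_map A B F" and W: "open W" and f: "smooth_fun_on B W f"
  shows "smooth_fun_on A (F -` W) (\<lambda>x. f (F x))"
proof (rule smooth_fun_onI)
  fix U \<phi> assume U: "(U, \<phi>) \<in> A"
  obtain C where C: "finite_frame (C :: 'd set)" using manifold_frame[OF B] by blast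
  note U' = manifold_is_chart[OF A U]
  have oF: "open (F -` W)" if "open W" for W
    using F that unfolding smooth_map_def by (auto intro: open_vimage)
  let ?T = "{\<phi> ` (U \<inter> F -` (V \<inter> W)) |V \<psi>. (V, \<psi>) \<in> B}"
  have "smooth_on (\<Union>?T) ((\<lambda>x. f (F x)) \<circ> inv_into U \<phi>)"
  proof (rule smooth_on_Union)
    show "open T" if "T \<in> ?T" for T
      using that is_chart_open_image[OF U' oF[OF open_Int[OF manifold_open[OF B] W]]] by blast
    fix T assume "T \<in> ?T"
    then obtain V \<psi> where V: "(V, \<psi>) \<in> B" and T: "T = \<phi> ` (U \<inter> F -` (V \<inter> W))" by blast
    note V' = manifold_is_chart[OF B V]
    have oT: "open T" unfolding T
      using is_chart_open_image[OF U' oF[OF open_Int[OF manifold_open[OF B V] W]]] .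
    have "smooth_on (\<phi> ` (U \<inter> F -` V)) (\<psi> \<circ> F \<circ> inv_into U \<phi>)"
      using F U V unfolding smooth_map_def by fast
    then have sm: "smooth_on T (\<psi> \<circ> F \<circ> inv_into U \<phi>)"
      by (rule smooth_on_subset) (auto simp: T)
    have "smooth_on T ((f \<circ> inv_into V \<psi>) \<circ> (\<psi> \<circ> F \<circ> inv_into U \<phi>))"
      by (rule smooth_on_compose[OF C oT manifold_open_image[OF B V W] _ sm smooth_fun_onD[OF f V]])
        (auto simp: T is_chart_inverse[OF U'])
    then show "smooth_on T ((\<lambda>x. f (F x)) \<circ> inv_into U \<phi>)"
      by (rule smooth_on_cong[OF oT, rotated]) (auto simp: T is_chart_inverse[OF V'] is_chart_inverse[OF U'])
  qed
  moreover have "\<phi> ` (U \<inter> F -` W) \<subseteq> \<Union>?T"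
  proof
    fix y assume "y \<in> \<phi> ` (U \<inter> F -` W)"
    then obtain p where p: "y = \<phi> p" "p \<in> U" "F p \<in> W" by blast
    obtain V \<psi> where "(V, \<psi>) \<in> B" "F p \<in> V" using manifold_chart_at[OF B] by blast
    with p show "y \<in> \<Union>?T" by blast
  qed
  ultimately show "smooth_on (\<phi> ` (U \<inter> F -` W)) ((\<lambda>x. f (F x)) \<circ> inv_into U \<phi>)"
    by (rule smooth_on_subset)
qed

lemma smooth_map_Cinf:
  assumes "smooth_manifold A" "smooth_manifold B" "smooth_map A B F" "f \<in> Cinf B"
  shows "(\<lambda>x. f (F x)) \<in> Cinf A"
  using smooth_map_smooth_fun_on[OF assms(1-3) open_UNIV] assms(4) by (simp add: Cinf_iff)

text \<open>One suitable admissible chart of the target per point suffices. Continuity of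
  \<open>F\<close>, a separate clause of \<open>smooth_map\<close>, is recovered by composing the
  smooth coordinate expression with the continuous inverse chart.\<close>

lemma smooth_mapI:
  assumes A: "smooth_manifold A" and B: "smooth_manifold B"
    and local: "\<And>p. \<exists>V \<psi> W. admissible_chart B V \<psi> \<and> open W \<and> p \<in> W \<and> F ` W \<subseteq> V \<and>
      smooth_fun_on A W (\<lambda>x. \<psi> (F x))"
  shows "smooth_map A B F"
proof -
  obtain C where C: "finite_frame (C :: 'd set)" using manifold_frame[OF B] by blast
  have cont_at: "\<exists>W. open W \<and> p \<in> W \<and> continuous_on W F" for p
  proof -
    obtain V \<psi> W where W: "admissible_chart B V \<psi>" "open W" "p \<in> W" "F ` W \<subseteq> V"
      "smooth_fun_on A W (\<lambda>x. \<psi> (F x))" using local by blast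
    note V' = admissible_chart_is_chart[OF B W(1)]
    have "continuous_on W (\<lambda>x. inv_into V \<psi> (\<psi> (F x)))"
      by (rule continuous_on_compose2[OF is_chart_continuous_on_inv[OF V'] smooth_fun_on_continuous_on[OF A W(2,5)]])
        (use W(4) in auto)
    then have "continuous_on W F"
      by (rule continuous_on_eq) (use W(4) is_chart_inverse[OF V'] in auto)
    with W show ?thesis by blast
  qed
  have "continuous_on (\<Union>{W. open W \<and> continuous_on W F}) F"
    by (rule continuous_on_open_Union) auto
  moreover have "\<Union>{W. open W \<and> continuous_on W F} = UNIV" using cont_at by blast
  ultimately have cont: "continuous_on UNIV F" by simp
  have "smooth_fun_on A (F -` V') (\<psi>' \<circ> F)" if V': "(V', \<psi>') \<in> B" for V' \<psi>'
  proof (rule smooth_fun_on_local[OF A])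
    fix p assume p: "p \<in> F -` V'"
    obtain V \<psi> W where W: "admissible_chart B V \<psi>" "open W" "p \<in> W" "F ` W \<subseteq> V"
      "smooth_fun_on A W (\<lambda>x. \<psi> (F x))" using local by blast
    note V = admissible_chart_is_chart[OF B W(1)]
    have oV': "open V'" using manifold_is_chart[OF B V'] by (simp add: is_chart_def)
    then have o: "open (W \<inter> F -` V')" using W(2) cont by (auto intro: open_vimage)
    have "smooth_fun_on A (W \<inter> F -` V') (\<lambda>x. (\<psi>' \<circ> inv_into V \<psi>) (\<psi> (F x)))"
      by (rule smooth_fun_on_compose[OF A C o is_chart_open_image[OF V oV'] _
            smooth_fun_on_subset[OF A W(5)] admissible_chart_inverse_smooth[OF B W(1) V']])
        (use W(4) in auto)
    then have "smooth_fun_on A (W \<inter> F -` V') (\<psi>' \<circ> F)"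
      by (rule smooth_fun_on_cong[OF A o, rotated]) (use W(4) is_chart_inverse[OF V] in \<open>auto simp: image_subset_iff\<close>)
    then show "\<exists>W'. open W' \<and> p \<in> W' \<and> smooth_fun_on A W' (\<psi>' \<circ> F)"
      using o p W(3) by blast
  qed
  then show ?thesis
    using cont unfolding smooth_map_def smooth_fun_on_def by (fastforce simp: comp_assoc)
qed

text \<open>The closed set \<open>K\<close> inside \<open>U\<close> is part of the conclusion
  because functions cut off by the bump are smooth for two reasons, one on \<open>U\<close> and one
  on the complement of \<open>K\<close>, and these two open sets cover the manifold.\<close>

lemma bump_function:
  fixes A :: "('m::{t2_space, second_countable_topology}, 'a::real_inner) atlas"
  assumes A: "smooth_manifold A" and U: "admissible_chart A U \<phi>" and p: "p \<in> U"
  shows "\<exists>\<beta> K. \<beta> \<in> Cinf A \<and> closed K \<and> K \<subseteq> U \<and> \<beta> p = 1 \<and> (\<forall>x. x \<notin> K \<longrightarrow> \<beta> x = 0)"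
proof -
  obtain B :: "'a set" where B: "finite_frame B" using manifold_frame[OF A] by blast
  note U' = admissible_chart_is_chart[OF A U]
  have oU: "open U" "open (\<phi> ` U)"
    using U' by (auto simp: is_chart_def)
  obtain r where r: "r > 0" "cball (\<phi> p) r \<subseteq> \<phi> ` U"
    using open_contains_cball[of "\<phi> ` U"] oU(2) p by blast
  define K where "K = inv_into U \<phi> ` cball (\<phi> p) r"
  \<comment> \<open>Compactness makes \<open>K\<close> closed in the whole Hausdorff manifold and
    not merely in \<open>U\<close>; without this the extension by zero could fail to be smooth at
    the boundary of \<open>U\<close>.\<close>
  have "compact K" unfolding K_def
    by (intro compact_continuous_image compact_cball_finite_frame[OF B]
        continuous_on_subset[OF is_chart_continuous_on_inv[OF U'] r(2)])
  then have cK: "closed K" by (rule compact_imp_closed)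
  have KU: "K \<subseteq> U" using r(2) is_chart_inverse[OF U'] by (fastforce simp: K_def)
  \<comment> \<open>In the chart, \<open>s\<close> is positive exactly on the open ball of radius
    \<open>r\<close> about the image of \<open>p\<close>, and \<open>c\<close> is the value at the
    centre, used to normalize.\<close>
  define s where "s = (\<lambda>x. r\<^sup>2 - (\<phi> x - \<phi> p) \<bullet> (\<phi> x - \<phi> p))"
  define c where "c = flat_exp 1 (r\<^sup>2)"
  define \<beta> where "\<beta> x = (if x \<in> U then flat_exp 1 (s x) / c else 0)" for x
  have c: "c > 0" using r(1) by (simp add: c_def flat_exp_def)
  have zero: "\<beta> x = 0" if "x \<notin> K" for x
  proof (cases "x \<in> U")
    case True
    have "\<phi> x \<notin> cball (\<phi> p) r"
      using that True is_chart_inverse[OF U' True] by (force simp: K_def)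
    then have "r\<^sup>2 \<le> (norm (\<phi> x - \<phi> p))\<^sup>2"
      using r(1) by (intro power_mono) (auto simp: dist_norm norm_minus_commute)
    then have "s x \<le> 0" by (simp add: s_def power2_norm_eq_inner)
    then show ?thesis by (simp add: \<beta>_def flat_exp_def)
  qed (simp add: \<beta>_def)
  have "\<beta> \<in> Cinf A"
  proof (rule Cinf_local[OF A])
    fix q
    have "smooth_fun_on A U (\<lambda>x. \<phi> x + (- \<phi> p))"
      by (intro smooth_fun_on_add[OF A oU(1)] admissible_chart_smooth[OF A U] smooth_fun_on_const[OF A])
    then have d: "smooth_fun_on A U (\<lambda>x. \<phi> x - \<phi> p)" by simp
    have "smooth_fun_on A U (\<lambda>x. r\<^sup>2 + (-1) * ((\<phi> x - \<phi> p) \<bullet> (\<phi> x - \<phi> p)))"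
      by (intro smooth_fun_on_add[OF A oU(1)] smooth_fun_on_const[OF A]
          smooth_fun_on_mult[OF A oU(1)] smooth_fun_on_inner[OF A oU(1)] d)
    then have "smooth_fun_on A U s" by (simp add: s_def)
    then have "smooth_fun_on A U (\<lambda>x. flat_exp 1 (s x))"
      by (rule smooth_fun_on_compose[OF A finite_frame_real oU(1) open_UNIV _ _ smooth_on_flat_exp, rotated]) auto
    then have "smooth_fun_on A U (\<lambda>x. flat_exp 1 (s x) * inverse c)"
      by (intro smooth_fun_on_mult[OF A oU(1)] smooth_fun_on_const[OF A])
    then have 1: "smooth_fun_on A U \<beta>"
      by (rule smooth_fun_on_cong[OF A oU(1), rotated]) (simp add: \<beta>_def divide_inverse)
    have 2: "smooth_fun_on A (- K) \<beta>"
      by (rule smooth_fun_on_cong[OF A _ _ smooth_fun_on_const[OF A, of _ 0]]) (use cK zero in auto)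
    show "\<exists>W. open W \<and> q \<in> W \<and> smooth_fun_on A W \<beta>"
      using 1 2 cK oU(1) KU by (metis Compl_iff open_Compl subsetD)
  qed
  moreover have "\<beta> p = 1" using p c by (simp add: \<beta>_def s_def c_def)
  ultimately show ?thesis using zero cK KU by blast
qed


section \<open>Frames and coframes of a vector bundle\<close>

definition trivialization :: "('m::{t2_space, second_countable_topology},
    'e::{t2_space, second_countable_topology}, 'a::real_inner, 'f::real_inner, 'z) vbundle_scheme
    \<Rightarrow> 'm set \<Rightarrow> ('m \<Rightarrow> 'a) \<Rightarrow> ('e \<Rightarrow> 'f) \<Rightarrow> bool" where
  "trivialization E U \<phi> \<Phi> \<longleftrightarrow>
     admissible_chart (base_atlas E) U \<phi> \<and>
     admissible_chart (total_atlas E) (bproj E -` U) (\<lambda>u. (\<phi> (bproj E u), \<Phi> u)) \<and>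
     (\<lambda>u. (\<phi> (bproj E u), \<Phi> u)) ` (bproj E -` U) = (\<phi> ` U) \<times> UNIV \<and>
     (\<forall>u v. bproj E u \<in> U \<longrightarrow> bproj E u = bproj E v \<longrightarrow> \<Phi> (fib_add E u v) = \<Phi> u + \<Phi> v) \<and>
     (\<forall>c u. bproj E u \<in> U \<longrightarrow> \<Phi> (fib_scale E c u) = c *\<^sub>R \<Phi> u) \<and>
     (\<forall>q\<in>U. \<Phi> (fib_zero E q) = 0)"

text \<open>Evaluates the pullback of a one-form on a section of the pullback bundle. These real
  functions separate sections, and under them the fibre operations turn into real
  arithmetic.\<close>

definition pb_pair :: "('m, 'e, 'a, 'f, 'z) vbundle_scheme \<Rightarrow> ('m \<Rightarrow> 'e \<Rightarrow> real) \<Rightarrow> 'e pb_sec \<Rightarrow> 'e \<Rightarrow> real" where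
  "pb_pair E \<theta> t = (\<lambda>u. \<theta> (bproj E u) (snd (t u)))"

locale smooth_vector_bundle =
  fixes E :: "('m::{t2_space, second_countable_topology},
    'e::{t2_space, second_countable_topology}, 'a::real_inner, 'f::real_inner, 'z) vbundle_scheme"
  assumes vbundle: "vector_bundle E"
begin

abbreviation "M \<equiv> base_atlas E"
abbreviation "T \<equiv> total_atlas E"
abbreviation "\<pi> \<equiv> bproj E"

lemma manifold_M: "smooth_manifold M" and manifold_T: "smooth_manifold T" and smooth_bproj: "smooth_map T M \<pi>"
  and bproj_add [simp]: "\<pi> u = \<pi> v \<Longrightarrow> \<pi> (fib_add E u v) = \<pi> v"
  and bproj_scale [simp]: "\<pi> (fib_scale E c u) = \<pi> u"
  and bproj_zero [simp]: "\<pi> (fib_zero E p) = p"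
  using vbundle unfolding vector_bundle_def by auto

lemma trivialization_at: "\<exists>U \<phi> \<Phi>. p \<in> U \<and> trivialization E U \<phi> \<Phi>"
  using vbundle unfolding vector_bundle_def trivialization_def by (elim conjE) (erule allE[of _ p])

lemma trivialization_open: "trivialization E U \<phi> \<Phi> \<Longrightarrow> open U"
  using admissible_chart_is_chart[OF manifold_M] unfolding trivialization_def is_chart_def by fast

lemma open_bproj_vimage: "open U \<Longrightarrow> open (\<pi> -` U)"
  using smooth_bproj unfolding smooth_map_def by (auto intro: open_vimage)

lemma trivialization_chart_M: "trivialization E U \<phi> \<Phi> \<Longrightarrow> admissible_chart M U \<phi>"
  unfolding trivialization_def by simp

lemma trivialization_chart_T:
  "trivialization E U \<phi> \<Phi> \<Longrightarrow> admissible_chart T (\<pi> -` U) (\<lambda>u. (\<phi> (\<pi> u), \<Phi> u))"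
  unfolding trivialization_def by simp

lemma trivialization_fib:
  assumes "trivialization E U \<phi> \<Phi>"
  shows "\<pi> u \<in> U \<Longrightarrow> \<pi> u = \<pi> v \<Longrightarrow> \<Phi> (fib_add E u v) = \<Phi> u + \<Phi> v"
    and "\<pi> u \<in> U \<Longrightarrow> \<Phi> (fib_scale E c u) = c *\<^sub>R \<Phi> u"
    and "q \<in> U \<Longrightarrow> \<Phi> (fib_zero E q) = 0"
  using assms unfolding trivialization_def by blast+

lemma trivialization_inj:
  assumes "trivialization E U \<phi> \<Phi>" "\<pi> u \<in> U" "\<pi> u = \<pi> v" "\<Phi> u = \<Phi> v"
  shows "u = v"
  using is_chart_inj_on[OF admissible_chart_is_chart[OF manifold_T trivialization_chart_T[OF assms(1)]]] assms(2-)
  by (auto simp: inj_on_def)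

lemma trivialization_surj:
  assumes "trivialization E U \<phi> \<Phi>" "q \<in> U"
  shows "\<exists>u. \<pi> u = q \<and> \<Phi> u = y"
proof -
  have "(\<lambda>u. (\<phi> (\<pi> u), \<Phi> u)) ` (\<pi> -` U) = (\<phi> ` U) \<times> UNIV"
    using assms(1) unfolding trivialization_def by simp
  then have "(\<phi> q, y) \<in> (\<lambda>u. (\<phi> (\<pi> u), \<Phi> u)) ` (\<pi> -` U)" using assms(2) by simp
  then obtain u where "\<pi> u \<in> U" "\<phi> (\<pi> u) = \<phi> q" "\<Phi> u = y" by auto
  then show ?thesis
    using is_chart_inj_on[OF admissible_chart_is_chart[OF manifold_M trivialization_chart_M[OF assms(1)]]] assms(2)
    unfolding inj_on_def by blast
qed

lemma trivialization_smooth: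
  assumes "trivialization E U \<phi> \<Phi>"
  shows "smooth_fun_on T (\<pi> -` U) \<Phi>"
  using smooth_fun_on_snd[OF manifold_T open_bproj_vimage[OF trivialization_open[OF assms]]
      admissible_chart_smooth[OF manifold_T trivialization_chart_T[OF assms]]] by simp

lemma smooth_map_bundleI:
  assumes N: "smooth_manifold N"
    and local: "\<And>p. \<exists>U \<phi> \<Phi> W. trivialization E U \<phi> \<Phi> \<and> open W \<and> p \<in> W \<and> F ` W \<subseteq> \<pi> -` U \<and>
      smooth_fun_on N W (\<lambda>x. \<phi> (\<pi> (F x))) \<and> smooth_fun_on N W (\<lambda>x. \<Phi> (F x))"
  shows "smooth_map N T F"
proof (rule smooth_mapI[OF N manifold_T])
  fix p
  obtain U \<phi> \<Phi> W where W: "trivialization E U \<phi> \<Phi>" "open W" "p \<in> W" "F ` W \<subseteq> \<pi> -` U"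
      "smooth_fun_on N W (\<lambda>x. \<phi> (\<pi> (F x)))" "smooth_fun_on N W (\<lambda>x. \<Phi> (F x))"
    using local by blast
  show "\<exists>V \<psi> W. admissible_chart T V \<psi> \<and> open W \<and> p \<in> W \<and> F ` W \<subseteq> V \<and> smooth_fun_on N W (\<lambda>x. \<psi> (F x))"
    using trivialization_chart_T[OF W(1)] smooth_fun_on_Pair[OF N W(2,5,6)] W(2-4) by blast
qed

lemma Cinf_bproj: "f \<in> Cinf M \<Longrightarrow> (\<lambda>u. f (\<pi> u)) \<in> Cinf T"
  by (rule smooth_map_Cinf[OF manifold_T manifold_M smooth_bproj])

lemma dual_add: "\<theta> \<in> dual_sections E \<Longrightarrow> \<pi> u = p \<Longrightarrow> \<pi> v = p \<Longrightarrow> \<theta> p (fib_add E u v) = \<theta> p u + \<theta> p v"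
  and dual_scale: "\<theta> \<in> dual_sections E \<Longrightarrow> \<pi> u = p \<Longrightarrow> \<theta> p (fib_scale E c u) = c * \<theta> p u"
  and dual_pair_Cinf: "\<theta> \<in> dual_sections E \<Longrightarrow> \<xi> \<in> sections E \<Longrightarrow> dual_pair \<theta> \<xi> \<in> Cinf M"
  unfolding dual_sections_def by auto

lemma fib_scale_0: "fib_scale E 0 u = fib_zero E (\<pi> u)"
proof -
  obtain U \<phi> \<Phi> where U: "\<pi> u \<in> U" "trivialization E U \<phi> \<Phi>" using trivialization_at by blast
  show ?thesis by (rule trivialization_inj[OF U(2)]) (use U trivialization_fib[OF U(2)] in auto)
qed

lemma dual_zero: "\<theta> \<in> dual_sections E \<Longrightarrow> \<theta> p (fib_zero E p) = 0"
  using dual_scale[of \<theta> "fib_zero E p" p 0] fib_scale_0[of "fib_zero E p"] by simp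

lemma sectionsI: "smooth_map M T \<xi> \<Longrightarrow> (\<And>p. \<pi> (\<xi> p) = p) \<Longrightarrow> \<xi> \<in> sections E"
  and sections_bproj [simp]: "\<xi> \<in> sections E \<Longrightarrow> \<pi> (\<xi> p) = p"
  and sections_smooth: "\<xi> \<in> sections E \<Longrightarrow> smooth_map M T \<xi>"
  unfolding sections_def by auto

text \<open>Pairings with sections are compositions of the fibrewise linear function with smooth
  maps, so smoothness on the total space implies smoothness as a one-form. The converse is
  \<open>dual_hat_Cinf\<close>.\<close>

lemma dual_hat_imp_dual_sections:
  assumes "\<And>u v. \<pi> u = \<pi> v \<Longrightarrow> \<theta> (\<pi> u) (fib_add E u v) = \<theta> (\<pi> u) u + \<theta> (\<pi> u) v"
    and "\<And>c u. \<theta> (\<pi> u) (fib_scale E c u) = c * \<theta> (\<pi> u) u"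
    and "\<And>p u. \<pi> u \<noteq> p \<Longrightarrow> \<theta> p u = 0"
    and "dual_hat E \<theta> \<in> Cinf T"
  shows "\<theta> \<in> dual_sections E"
proof -
  have "dual_pair \<theta> \<xi> \<in> Cinf M" if "\<xi> \<in> sections E" for \<xi>
    using smooth_map_Cinf[OF manifold_M manifold_T sections_smooth[OF that] assms(4)] that
    by (simp add: dual_hat_def dual_pair_def)
  moreover have "\<theta> p (fib_add E u v) = \<theta> p u + \<theta> p v" if "\<pi> u = p" "\<pi> v = p" for p u v
    using assms(1)[of u v] that by simp
  ultimately show ?thesis using assms(2,3) unfolding dual_sections_def by auto
qed

end

text \<open>Local frames and coframes, cut off by a bump function \<open>\<beta>\<close> so that they are global.\<close>

locale cut_off_trivialization = smooth_vector_bundle E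
  for E :: "('m::{t2_space, second_countable_topology},
    'e::{t2_space, second_countable_topology}, 'a::real_inner, 'f::real_inner, 'z) vbundle_scheme" +
  fixes U :: "'m set" and \<phi> :: "'m \<Rightarrow> 'a" and \<Phi> :: "'e \<Rightarrow> 'f" and \<beta> :: "'m \<Rightarrow> real" and K :: "'m set"
  assumes triv: "trivialization E U \<phi> \<Phi>"
    and bump: "\<beta> \<in> Cinf M" "closed K" "K \<subseteq> U" "\<And>q. q \<notin> K \<Longrightarrow> \<beta> q = 0"
begin

text \<open>The test \<open>\<pi> v = q\<close> makes the form vanish off its fibre, as membership
  in \<open>dual_sections\<close> demands.\<close>

definition coframe :: "'f \<Rightarrow> 'm \<Rightarrow> 'e \<Rightarrow> real" where
  "coframe y q v = (if \<pi> v = q \<and> q \<in> U then \<beta> q * (\<Phi> v \<bullet> y) else 0)"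

text \<open>The choice is forced, since \<Phi> is injective on fibres. The zero value off
  \<open>U\<close> agrees with the value on the part of \<open>U\<close> outside \<open>K\<close>,
  where \<beta> vanishes.\<close>

definition frame :: "'f \<Rightarrow> 'm \<Rightarrow> 'e" where
  "frame y q = (if q \<in> U then (SOME u. \<pi> u = q \<and> \<Phi> u = \<beta> q *\<^sub>R y) else fib_zero E q)"

lemma frame: "\<pi> (frame y q) = q" "q \<in> U \<Longrightarrow> \<Phi> (frame y q) = \<beta> q *\<^sub>R y"
proof -
  have "\<pi> (frame y q) = q \<and> \<Phi> (frame y q) = \<beta> q *\<^sub>R y" if q: "q \<in> U"
    unfolding frame_def using someI_ex[OF trivialization_surj[OF triv q, of "\<beta> q *\<^sub>R y"]] q by simp
  then show "\<pi> (frame y q) = q" "q \<in> U \<Longrightarrow> \<Phi> (frame y q) = \<beta> q *\<^sub>R y"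
    by (auto simp: frame_def)
qed

lemma frame_outside: "q \<notin> K \<Longrightarrow> frame y q = fib_zero E q"
proof (cases "q \<in> U")
  case True
  assume "q \<notin> K"
  then show ?thesis
    using trivialization_inj[OF triv, of "frame y q" "fib_zero E q"] frame True bump(4)
      trivialization_fib(3)[OF triv True] by simp
qed (simp add: frame_def)

lemma open_U: "open U" and open_U': "open (\<pi> -` U)" and open_K': "open (\<pi> -` (- K))"
  using trivialization_open[OF triv] open_bproj_vimage bump(2) by auto

lemma coframe_hat_Cinf: "dual_hat E (coframe y) \<in> Cinf T"
proof (rule Cinf_local[OF manifold_T])
  fix u
  have "smooth_fun_on T (\<pi> -` U) (\<lambda>u. \<beta> (\<pi> u) * (\<Phi> u \<bullet> y))"
    by (intro smooth_fun_on_mult[OF manifold_T open_U'] smooth_fun_on_inner[OF manifold_T open_U']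
        Cinf_smooth_fun_on[OF manifold_T Cinf_bproj[OF bump(1)]] trivialization_smooth[OF triv]
        smooth_fun_on_const[OF manifold_T])
  then have 1: "smooth_fun_on T (\<pi> -` U) (dual_hat E (coframe y))"
    by (rule smooth_fun_on_cong[OF manifold_T open_U', rotated]) (simp add: dual_hat_def coframe_def)
  have 2: "smooth_fun_on T (\<pi> -` (- K)) (dual_hat E (coframe y))"
    by (rule smooth_fun_on_cong[OF manifold_T open_K' _ smooth_fun_on_const[OF manifold_T, of _ 0]])
      (use bump(4) in \<open>auto simp: dual_hat_def coframe_def\<close>)
  show "\<exists>W. open W \<and> u \<in> W \<and> smooth_fun_on T W (dual_hat E (coframe y))"
  proof (cases "\<pi> u \<in> U")
    case True then show ?thesis using 1 open_U' by blast
  next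
    case False then show ?thesis using 2 open_K' bump(3) by blast
  qed
qed

lemma coframe_dual: "coframe y \<in> dual_sections E"
  by (rule dual_hat_imp_dual_sections)
    (auto simp: coframe_def trivialization_fib[OF triv] inner_add_left algebra_simps coframe_hat_Cinf)

lemma frame_section: "frame y \<in> sections E"
proof (rule sectionsI[OF smooth_map_bundleI[OF manifold_M] frame(1)])
  fix q
  show "\<exists>U \<phi> \<Phi> W. trivialization E U \<phi> \<Phi> \<and> open W \<and> q \<in> W \<and> frame y ` W \<subseteq> \<pi> -` U \<and>
      smooth_fun_on M W (\<lambda>x. \<phi> (\<pi> (frame y x))) \<and> smooth_fun_on M W (\<lambda>x. \<Phi> (frame y x))"
  proof (cases "q \<in> U")
    case True
    have "smooth_fun_on M U (\<lambda>x. \<beta> x *\<^sub>R y)"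
      by (intro smooth_fun_on_scaleR[OF manifold_M open_U] smooth_fun_on_const[OF manifold_M]
          Cinf_smooth_fun_on[OF manifold_M bump(1)])
    then have "smooth_fun_on M U (\<lambda>x. \<Phi> (frame y x))"
      by (rule smooth_fun_on_cong[OF manifold_M open_U, rotated]) (simp add: frame)
    moreover have "smooth_fun_on M U (\<lambda>x. \<phi> (\<pi> (frame y x)))"
      using admissible_chart_smooth[OF manifold_M trivialization_chart_M[OF triv]] by (simp add: frame)
    ultimately show ?thesis using triv open_U True frame(1) by (metis image_subsetI vimageI)
  next
    case False
    \<comment> \<open>Off \<open>U\<close> the given trivialization says nothing. Smoothness is
      checked in another one, restricted to the complement of \<open>K\<close>, where the frame is
      the zero section.\<close>
    obtain V \<psi> \<Psi> where V: "q \<in> V" "trivialization E V \<psi> \<Psi>" using trivialization_at by blast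
    let ?W = "V \<inter> - K"
    have o: "open ?W" using trivialization_open[OF V(2)] bump(2) by auto
    have "smooth_fun_on M ?W (\<lambda>x. \<Psi> (frame y x))"
      by (rule smooth_fun_on_cong[OF manifold_M o _ smooth_fun_on_const[OF manifold_M, of _ 0]])
        (use frame_outside trivialization_fib(3)[OF V(2)] in auto)
    moreover have "smooth_fun_on M ?W (\<lambda>x. \<psi> (\<pi> (frame y x)))"
      using smooth_fun_on_subset[OF manifold_M
          admissible_chart_smooth[OF manifold_M trivialization_chart_M[OF V(2)]], of ?W] by (simp add: frame)
    moreover have "q \<in> ?W" "frame y ` ?W \<subseteq> \<pi> -` V" using V(1) False bump(3) frame(1) by auto
    ultimately show ?thesis using V(2) o by blast
  qed
qed

text \<open>Duality of frame and coframe. Each carries one factor \<beta>, hence the square; off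
  \<open>U\<close> both sides vanish, so the identity is global. The frame \<open>B\<close> lives in
  the model space of \<open>T\<close>; by applying it to vectors with first component 0, its second
  components expand the typical fibre.\<close>

lemma frame_expansion:
  assumes B: "finite_frame (B :: ('a \<times> 'f) set)" and \<zeta>: "\<zeta> \<in> dual_sections E"
  shows "(\<beta> (\<pi> v))\<^sup>2 * \<zeta> (\<pi> v) v = (\<Sum>b\<in>B. coframe (snd b) (\<pi> v) v * \<zeta> (\<pi> v) (frame (snd b) (\<pi> v)))"
proof (cases "\<pi> v \<in> U")
  case True
  define q where "q = \<pi> v"
  \<comment> \<open>\<open>pt\<close> inverts \<Phi> on the fibre over \<open>q\<close>, so that
    \<zeta> becomes a linear functional \<open>g\<close> to which the finite frame applies.\<close>
  define pt where "pt y = (SOME u. \<pi> u = q \<and> \<Phi> u = y)" for y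
  have q: "q \<in> U" using True by (simp add: q_def)
  have pt: "\<pi> (pt y) = q" "\<Phi> (pt y) = y" for y
    unfolding pt_def using someI_ex[OF trivialization_surj[OF triv q, of y]] by auto
  have pt_eq: "w = pt (\<Phi> w)" if "\<pi> w = q" for w
    using trivialization_inj[OF triv, of w "pt (\<Phi> w)"] that q pt by simp
  define g where "g x = \<zeta> q (pt (snd x))" for x :: "'a \<times> 'f"
  have "linear g"
  proof (rule linearI)
    fix x y :: "'a \<times> 'f" and c :: real
    have "fib_add E (pt (snd x)) (pt (snd y)) = pt (snd (x + y))"
      using pt_eq[of "fib_add E (pt (snd x)) (pt (snd y))"] pt q by (simp add: trivialization_fib[OF triv])
    then show "g (x + y) = g x + g y" unfolding g_def
      using dual_add[OF \<zeta>, of "pt (snd x)" q "pt (snd y)"] pt by simp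
    have "fib_scale E c (pt (snd x)) = pt (snd (c *\<^sub>R x))"
      using pt_eq[of "fib_scale E c (pt (snd x))"] pt q by (simp add: trivialization_fib[OF triv])
    then show "g (c *\<^sub>R x) = c *\<^sub>R g x" unfolding g_def
      using dual_scale[OF \<zeta>, of "pt (snd x)" q c] pt by simp
  qed
  have fr: "\<zeta> q (frame (snd b) q) = \<beta> q * g b" for b
  proof -
    have "frame (snd b) q = fib_scale E (\<beta> q) (pt (snd b))"
      by (rule trivialization_inj[OF triv]) (use q pt in \<open>auto simp: frame trivialization_fib[OF triv]\<close>)
    then show ?thesis using dual_scale[OF \<zeta> pt(1)] by (simp add: g_def)
  qed
  have "\<zeta> q v = g (0, \<Phi> v)" using pt_eq[of v] by (simp add: g_def q_def)
  also have "\<dots> = (\<Sum>b\<in>B. (\<Phi> v \<bullet> snd b) * g b)"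
    using finite_frame_linear[OF B \<open>linear g\<close>, of "(0, \<Phi> v)"] by (simp add: inner_prod_def)
  finally have "(\<beta> q)\<^sup>2 * \<zeta> q v = (\<Sum>b\<in>B. (\<beta> q * (\<Phi> v \<bullet> snd b)) * (\<beta> q * g b))"
    by (simp add: sum_distrib_left power2_eq_square mult_ac)
  then show ?thesis using q fr by (simp add: q_def coframe_def)
qed (use bump in \<open>auto simp: coframe_def\<close>)

text \<open>Where \<beta> is nonzero, the coframe functions recover the fibre coordinate. This is
  what reduces smoothness of maps into the bundle to smoothness of real functions.\<close>

lemma trivialization_expansion:
  assumes B: "finite_frame (B :: ('a \<times> 'f) set)" and "\<pi> v \<in> U"
  shows "\<beta> (\<pi> v) *\<^sub>R \<Phi> v = (\<Sum>b\<in>B. coframe (snd b) (\<pi> v) v *\<^sub>R snd b)"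
proof -
  have "linear (snd :: 'a \<times> 'f \<Rightarrow> 'f)" by (rule linear_snd)
  from finite_frame_linear[OF B this, of "(0, \<Phi> v)"]
  have "\<Phi> v = (\<Sum>b\<in>B. (\<Phi> v \<bullet> snd b) *\<^sub>R snd b)" by (simp add: inner_prod_def)
  then have "\<beta> (\<pi> v) *\<^sub>R \<Phi> v = \<beta> (\<pi> v) *\<^sub>R (\<Sum>b\<in>B. (\<Phi> v \<bullet> snd b) *\<^sub>R snd b)" by (rule arg_cong)
  then show ?thesis
    using assms(2) by (simp add: coframe_def scaleR_sum_right)
qed

end

section \<open>Testing sections and smoothness by pairings with one-forms\<close>

context smooth_vector_bundle
begin

lemma cut_off_at:
  "\<exists>U \<phi> \<Phi> \<beta> K. cut_off_trivialization E U \<phi> \<Phi> \<beta> K \<and> p \<in> U \<and> \<beta> p = 1"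
proof -
  obtain U \<phi> \<Phi> where U: "p \<in> U" "trivialization E U \<phi> \<Phi>" using trivialization_at by blast
  obtain \<beta> K where "\<beta> \<in> Cinf M" "closed K" "K \<subseteq> U" "\<beta> p = 1" "\<forall>x. x \<notin> K \<longrightarrow> \<beta> x = 0"
    using bump_function[OF manifold_M trivialization_chart_M[OF U(2)] U(1)] by blast
  then have "cut_off_trivialization E U \<phi> \<Phi> \<beta> K" using U vbundle by unfold_locales auto
  then show ?thesis using U \<open>\<beta> p = 1\<close> by blast
qed

text \<open>A one-form is known to be smooth only through its pairings with sections. Where \<beta>
  is nonzero, dividing the frame expansion by its square expresses the fibrewise linear function
  through such pairings and the coframe functions.\<close>

lemma dual_hat_Cinf:
  assumes \<zeta>: "\<zeta> \<in> dual_sections E"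
  shows "dual_hat E \<zeta> \<in> Cinf T"
proof (rule Cinf_local[OF manifold_T])
  fix u
  obtain U \<phi> \<Phi> \<beta> K where c: "cut_off_trivialization E U \<phi> \<Phi> \<beta> K" and u: "\<pi> u \<in> U" "\<beta> (\<pi> u) = 1"
    using cut_off_at[of "\<pi> u"] by blast
  interpret cut_off_trivialization E U \<phi> \<Phi> \<beta> K by (rule c)
  obtain B where B: "finite_frame (B :: ('a \<times> 'f) set)" using manifold_frame[OF manifold_T] by blast
  let ?W = "(\<lambda>u. \<beta> (\<pi> u)) -` (- {0})"
  have s: "smooth_fun_on T W (\<lambda>u. \<beta> (\<pi> u))" for W
    by (rule Cinf_smooth_fun_on[OF manifold_T Cinf_bproj[OF bump(1)]])
  have o: "open ?W"
    using smooth_fun_on_continuous_on[OF manifold_T open_UNIV s] by (auto intro: open_vimage)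
  have cf: "smooth_fun_on T ?W (\<lambda>u. coframe y (\<pi> u) u)" for y
    using Cinf_smooth_fun_on[OF manifold_T coframe_hat_Cinf] by (simp add: dual_hat_def)
  have fr: "smooth_fun_on T ?W (\<lambda>u. \<zeta> (\<pi> u) (frame y (\<pi> u)))" for y
    using Cinf_smooth_fun_on[OF manifold_T Cinf_bproj[OF dual_pair_Cinf[OF \<zeta> frame_section]]]
    by (simp add: dual_pair_def)
  have "smooth_fun_on T ?W (\<lambda>v. inverse (\<beta> (\<pi> v)) * (inverse (\<beta> (\<pi> v)) *
      (\<Sum>b\<in>B. coframe (snd b) (\<pi> v) v * \<zeta> (\<pi> v) (frame (snd b) (\<pi> v)))))"
    by (intro smooth_fun_on_mult[OF manifold_T o] smooth_fun_on_inverse[OF manifold_T o s]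
        smooth_fun_on_sum[OF manifold_T o] cf fr) auto
  then have "smooth_fun_on T ?W (dual_hat E \<zeta>)"
    by (rule smooth_fun_on_cong[OF manifold_T o, rotated])
      (auto simp: frame_expansion[OF B \<zeta>, symmetric] dual_hat_def power2_eq_square field_simps)
  moreover have "u \<in> ?W" using u by simp
  ultimately show "\<exists>W. open W \<and> u \<in> W \<and> smooth_fun_on T W (dual_hat E \<zeta>)" using o by blast
qed

text \<open>The pairings with the coframe determine the fibre coordinate wherever \<beta> is
  nonzero; the base coordinate is smooth by the second hypothesis.\<close>

lemma smooth_map_bundle_pairingI:
  assumes N: "smooth_manifold N" and base: "smooth_map N M (\<lambda>x. \<pi> (F x))"
    and pair: "\<And>\<theta>. \<theta> \<in> dual_sections E \<Longrightarrow> (\<lambda>x. dual_hat E \<theta> (F x)) \<in> Cinf N"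
  shows "smooth_map N T F"
proof (rule smooth_map_bundleI[OF N])
  fix p
  obtain U \<phi> \<Phi> \<beta> K where c: "cut_off_trivialization E U \<phi> \<Phi> \<beta> K" and p: "\<pi> (F p) \<in> U" "\<beta> (\<pi> (F p)) = 1"
    using cut_off_at[of "\<pi> (F p)"] by blast
  interpret cut_off_trivialization E U \<phi> \<Phi> \<beta> K by (rule c)
  obtain B where B: "finite_frame (B :: ('a \<times> 'f) set)" using manifold_frame[OF manifold_T] by blast
  have s: "smooth_fun_on N W (\<lambda>x. \<beta> (\<pi> (F x)))" for W
    by (rule Cinf_smooth_fun_on[OF N smooth_map_Cinf[OF N manifold_M base bump(1)]])
  define W where "W = (\<lambda>x. \<beta> (\<pi> (F x))) -` (- {0})"
  have o: "open W" unfolding W_def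
    using smooth_fun_on_continuous_on[OF N open_UNIV s] by (auto intro: open_vimage)
  have WU: "\<pi> (F x) \<in> U" if "x \<in> W" for x using that bump(3,4) by (auto simp: W_def)
  have \<phi>: "smooth_fun_on N W (\<lambda>x. \<phi> (\<pi> (F x)))"
    using smooth_map_smooth_fun_on[OF N manifold_M base open_U
        admissible_chart_smooth[OF manifold_M trivialization_chart_M[OF triv]]]
    by (rule smooth_fun_on_subset[OF N]) (use WU in auto)
  have "smooth_fun_on N W (\<lambda>x. inverse (\<beta> (\<pi> (F x))) *\<^sub>R (\<Sum>b\<in>B. dual_hat E (coframe (snd b)) (F x) *\<^sub>R snd b))"
    by (intro smooth_fun_on_scaleR[OF N o] smooth_fun_on_sum[OF N o] smooth_fun_on_inverse[OF N o s]
        Cinf_smooth_fun_on[OF N pair[OF coframe_dual]] smooth_fun_on_const[OF N])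
      (auto simp: W_def)
  then have "smooth_fun_on N W (\<lambda>x. \<Phi> (F x))"
    by (rule smooth_fun_on_cong[OF N o, rotated])
      (auto simp: dual_hat_def trivialization_expansion[OF B WU, symmetric] W_def)
  moreover have "p \<in> W" using p by (simp add: W_def)
  ultimately show "\<exists>U \<phi> \<Phi> W. trivialization E U \<phi> \<Phi> \<and> open W \<and> p \<in> W \<and> F ` W \<subseteq> \<pi> -` U \<and>
      smooth_fun_on N W (\<lambda>x. \<phi> (\<pi> (F x))) \<and> smooth_fun_on N W (\<lambda>x. \<Phi> (F x))"
    using triv o \<phi> WU by (metis image_subsetI vimageI)
qed

text \<open>Where \<beta> is 1, the coframe returns the inner products of \<Phi> with all vectors,
  and \<Phi> is injective on fibres.\<close>

lemma dual_separates:
  assumes "\<pi> u = \<pi> v" "\<And>\<theta>. \<theta> \<in> dual_sections E \<Longrightarrow> \<theta> (\<pi> v) u = \<theta> (\<pi> v) v"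
  shows "u = v"
proof -
  obtain U \<phi> \<Phi> \<beta> K where c: "cut_off_trivialization E U \<phi> \<Phi> \<beta> K" and p: "\<pi> v \<in> U" "\<beta> (\<pi> v) = 1"
    using cut_off_at[of "\<pi> v"] by blast
  interpret cut_off_trivialization E U \<phi> \<Phi> \<beta> K by (rule c)
  have "\<Phi> u \<bullet> y = \<Phi> v \<bullet> y" for y
    using assms(2)[OF coframe_dual[of y]] assms(1) p by (simp add: coframe_def)
  then have "\<Phi> u = \<Phi> v" by (metis vector_eq_rdot)
  then show ?thesis using trivialization_inj[OF triv] assms(1) p by simp
qed

lemma section_through: "\<exists>\<xi>\<in>sections E. \<xi> (\<pi> v) = v"
proof -
  obtain U \<phi> \<Phi> \<beta> K where c: "cut_off_trivialization E U \<phi> \<Phi> \<beta> K" and p: "\<pi> v \<in> U" "\<beta> (\<pi> v) = 1"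
    using cut_off_at[of "\<pi> v"] by blast
  interpret cut_off_trivialization E U \<phi> \<Phi> \<beta> K by (rule c)
  have "frame (\<Phi> v) (\<pi> v) = v"
    by (rule trivialization_inj[OF triv]) (use p in \<open>auto simp: frame\<close>)
  then show ?thesis using frame_section by blast
qed

text \<open>Hides trivializations from here on; \<psi> is the square of the bump function. A list is
  used instead of a set because different members of the frame of the model space may share their
  second component, and each then contributes a term.\<close>

lemma global_frame:
  "\<exists>L \<psi>. set L \<subseteq> sections E \<times> dual_sections E \<and> \<psi> \<in> Cinf M \<and> \<psi> p = 1 \<and>
     (\<forall>\<zeta>\<in>dual_sections E. \<forall>v. \<psi> (\<pi> v) * \<zeta> (\<pi> v) v = (\<Sum>(e, \<theta>)\<leftarrow>L. \<theta> (\<pi> v) v * \<zeta> (\<pi> v) (e (\<pi> v))))"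
proof -
  obtain U \<phi> \<Phi> \<beta> K where c: "cut_off_trivialization E U \<phi> \<Phi> \<beta> K" and p: "p \<in> U" "\<beta> p = 1"
    using cut_off_at by blast
  interpret cut_off_trivialization E U \<phi> \<Phi> \<beta> K by (rule c)
  obtain B where B: "finite_frame (B :: ('a \<times> 'f) set)" using manifold_frame[OF manifold_T] by blast
  then obtain bs where bs: "set bs = B" "distinct bs"
    using finite_distinct_list unfolding finite_frame_def by blast
  define L where "L = map (\<lambda>b. (frame (snd b), coframe (snd b))) bs"
  have "\<forall>\<zeta>\<in>dual_sections E. \<forall>v. (\<beta> (\<pi> v))\<^sup>2 * \<zeta> (\<pi> v) v = (\<Sum>(e, \<theta>)\<leftarrow>L. \<theta> (\<pi> v) v * \<zeta> (\<pi> v) (e (\<pi> v)))"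
    using frame_expansion[OF B] bs(1)
    by (simp add: L_def o_def case_prod_beta sum_list_distinct_conv_sum_set[OF bs(2)])
  moreover have "set L \<subseteq> sections E \<times> dual_sections E"
    using frame_section coframe_dual by (auto simp: L_def)
  moreover have "(\<lambda>q. (\<beta> q)\<^sup>2) \<in> Cinf M" "(\<beta> p)\<^sup>2 = 1"
    using Cinf_mult[OF manifold_M bump(1) bump(1)] p by (auto simp: power2_eq_square)
  ultimately show ?thesis by blast
qed

lemma sections_pairingI:
  assumes "\<And>p. \<pi> (\<xi> p) = p" "\<And>\<theta>. \<theta> \<in> dual_sections E \<Longrightarrow> dual_pair \<theta> \<xi> \<in> Cinf M"
  shows "\<xi> \<in> sections E"
proof (rule sectionsI[OF smooth_map_bundle_pairingI[OF manifold_M] assms(1)])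
  show "smooth_map M M (\<lambda>x. \<pi> (\<xi> x))"
  proof (rule smooth_mapI[OF manifold_M manifold_M])
    fix p
    obtain U \<phi> where U: "(U, \<phi>) \<in> M" "p \<in> U" using manifold_chart_at[OF manifold_M] by blast
    then have "admissible_chart M U \<phi>" using manifold_M by (simp add: admissible_chart_def insert_absorb)
    then show "\<exists>V \<psi> W. admissible_chart M V \<psi> \<and> open W \<and> p \<in> W \<and> (\<lambda>x. \<pi> (\<xi> x)) ` W \<subseteq> V \<and>
        smooth_fun_on M W (\<lambda>x. \<psi> (\<pi> (\<xi> x)))"
      using admissible_chart_smooth[OF manifold_M, of U \<phi>] manifold_open[OF manifold_M U(1)] U(2) assms(1)
      by (intro exI[of _ U] exI[of _ \<phi>]) auto
  qed
qed (use assms in \<open>simp add: dual_hat_def dual_pair_def\<close>)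

lemma dual_pair_add:
  "\<theta> \<in> dual_sections E \<Longrightarrow> \<xi> \<in> sections E \<Longrightarrow> \<zeta> \<in> sections E \<Longrightarrow>
    dual_pair \<theta> (sec_add E \<xi> \<zeta>) = (\<lambda>p. dual_pair \<theta> \<xi> p + dual_pair \<theta> \<zeta> p)"
  by (auto simp: dual_pair_def sec_add_def dual_add)

lemma dual_pair_scale:
  "\<theta> \<in> dual_sections E \<Longrightarrow> \<xi> \<in> sections E \<Longrightarrow>
    dual_pair \<theta> (sec_scale E f \<xi>) = (\<lambda>p. f p * dual_pair \<theta> \<xi> p)"
  by (auto simp: dual_pair_def sec_scale_def dual_scale)

lemma sec_add_sections: "\<xi> \<in> sections E \<Longrightarrow> \<zeta> \<in> sections E \<Longrightarrow> sec_add E \<xi> \<zeta> \<in> sections E"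
  by (rule sections_pairingI)
    (auto simp: dual_pair_add intro: Cinf_add manifold_M dual_pair_Cinf, simp add: sec_add_def)

lemma sec_scale_sections: "f \<in> Cinf M \<Longrightarrow> \<xi> \<in> sections E \<Longrightarrow> sec_scale E f \<xi> \<in> sections E"
  by (rule sections_pairingI)
    (auto simp: dual_pair_scale intro: Cinf_mult manifold_M dual_pair_Cinf, simp add: sec_scale_def)

lemma zero_section: "fib_zero E \<in> sections E"
  by (rule sections_pairingI) (auto simp: dual_pair_def dual_zero intro: Cinf_const[OF manifold_M])

lemma sections_eqI:
  assumes "\<xi> \<in> sections E" "\<zeta> \<in> sections E" "\<And>\<theta> p. \<theta> \<in> dual_sections E \<Longrightarrow> dual_pair \<theta> \<xi> p = dual_pair \<theta> \<zeta> p"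
  shows "\<xi> = \<zeta>"
proof
  fix p show "\<xi> p = \<zeta> p" by (rule dual_separates) (use assms in \<open>auto simp: dual_pair_def\<close>)
qed

text \<open>The global section \<psi>\<xi> is the sum of the e with smooth coefficients
  \<theta>(\<xi>). Applying \<Lambda>, whose scaling rule evaluates coefficients at \<open>p\<close>
  where \<psi> is 1, leaves an expression in the value of \<xi> at \<open>p\<close> alone.\<close>

lemma sections_tensorial:
  fixes \<Lambda> :: "('m \<Rightarrow> 'e) \<Rightarrow> real"
  assumes add: "\<And>\<xi> \<zeta>. \<xi> \<in> sections E \<Longrightarrow> \<zeta> \<in> sections E \<Longrightarrow> \<Lambda> (sec_add E \<xi> \<zeta>) = \<Lambda> \<xi> + \<Lambda> \<zeta>"
    and scale: "\<And>f \<xi>. f \<in> Cinf M \<Longrightarrow> \<xi> \<in> sections E \<Longrightarrow> \<Lambda> (sec_scale E f \<xi>) = f p * \<Lambda> \<xi>"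
    and \<xi>: "\<xi> \<in> sections E" "\<xi>' \<in> sections E" "\<xi> p = \<xi>' p"
  shows "\<Lambda> \<xi> = \<Lambda> \<xi>'"
proof -
  obtain L \<psi> where L: "set L \<subseteq> sections E \<times> dual_sections E" "\<psi> \<in> Cinf M" "\<psi> p = 1"
     and expand: "\<And>\<zeta> v. \<zeta> \<in> dual_sections E \<Longrightarrow> \<psi> (\<pi> v) * \<zeta> (\<pi> v) v = (\<Sum>(e, \<theta>)\<leftarrow>L. \<theta> (\<pi> v) v * \<zeta> (\<pi> v) (e (\<pi> v)))"
    using global_frame[of p] by blast
  have "\<Lambda> \<xi> = (\<Sum>(e, \<theta>)\<leftarrow>L. \<theta> p (\<xi> p) * \<Lambda> e)" if \<xi>: "\<xi> \<in> sections E" for \<xi>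
  proof -
    define sm where "sm L = foldr (\<lambda>(e, \<theta>). sec_add E (sec_scale E (dual_pair \<theta> \<xi>) e)) L (fib_zero E)" for L
    have "sm L \<in> sections E \<and> \<Lambda> (sm L) = (\<Sum>(e, \<theta>)\<leftarrow>L. \<theta> p (\<xi> p) * \<Lambda> e) \<and>
      (\<forall>\<zeta>\<in>dual_sections E. \<forall>q. dual_pair \<zeta> (sm L) q = (\<Sum>(e, \<theta>)\<leftarrow>L. \<theta> q (\<xi> q) * \<zeta> q (e q)))"
      using L(1)
    proof (induction L)
      case Nil
      have "fib_zero E = sec_scale E (\<lambda>_. 0) (fib_zero E)"
        by (rule ext) (use fib_scale_0 in \<open>simp add: sec_scale_def\<close>)
      then have "\<Lambda> (fib_zero E) = 0"
        using scale[OF Cinf_const[OF manifold_M] zero_section, of 0] by simp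
      then show ?case by (simp add: sm_def zero_section dual_pair_def dual_zero)
    next
      case (Cons a L)
      obtain e \<theta> where a: "a = (e, \<theta>)" "e \<in> sections E" "\<theta> \<in> dual_sections E" using Cons.prems by auto
      have s: "sec_scale E (dual_pair \<theta> \<xi>) e \<in> sections E"
        by (intro sec_scale_sections dual_pair_Cinf a \<xi>)
      have sm: "sm (a # L) = sec_add E (sec_scale E (dual_pair \<theta> \<xi>) e) (sm L)"
        by (simp add: sm_def a)
      show ?case
        unfolding sm using Cons s a
        by (simp add: sec_add_sections add scale dual_pair_Cinf \<xi> dual_pair_add dual_pair_scale)
          (simp add: dual_pair_def)
    qed
    moreover have "sm L = sec_scale E \<psi> \<xi>"
    proof (rule sections_eqI)
      fix \<zeta> q assume \<zeta>: "\<zeta> \<in> dual_sections E"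
      show "dual_pair \<zeta> (sm L) q = dual_pair \<zeta> (sec_scale E \<psi> \<xi>) q"
        using calculation \<zeta> expand[OF \<zeta>, of "\<xi> q"] \<xi> by (simp add: dual_pair_scale) (simp add: dual_pair_def)
    qed (use calculation sec_scale_sections L \<xi> in auto)
    ultimately show ?thesis using scale[OF L(2) \<xi>] L(3) by simp
  qed
  from this[OF \<xi>(1)] this[OF \<xi>(2)] show ?thesis using \<xi>(3) by simp
qed

section \<open>Sections of the pullback bundle\<close>

lemma pb_sections_pairingI:
  assumes "\<And>u. fst (t u) = u" "\<And>u. \<pi> (snd (t u)) = \<pi> u"
    and "\<And>\<theta>. \<theta> \<in> dual_sections E \<Longrightarrow> pb_pair E \<theta> t \<in> Cinf T"
  shows "t \<in> pb_sections E"
proof -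
  have "smooth_map T T (\<lambda>x. snd (t x))"
    by (rule smooth_map_bundle_pairingI[OF manifold_T])
      (use assms smooth_bproj in \<open>auto simp: dual_hat_def pb_pair_def\<close>)
  then show ?thesis using assms(1,2) by (simp add: pb_sections_def comp_def)
qed

lemma pb_sections_fst [simp]: "t \<in> pb_sections E \<Longrightarrow> fst (t u) = u"
  and pb_sections_bproj [simp]: "t \<in> pb_sections E \<Longrightarrow> \<pi> (snd (t u)) = \<pi> u"
  and pb_sections_smooth: "t \<in> pb_sections E \<Longrightarrow> smooth_map T T (\<lambda>u. snd (t u))"
  by (auto simp: pb_sections_def comp_def)

lemma pb_pair_Cinf:
  assumes "t \<in> pb_sections E" "\<theta> \<in> dual_sections E"
  shows "pb_pair E \<theta> t \<in> Cinf T"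
  using smooth_map_Cinf[OF manifold_T manifold_T pb_sections_smooth[OF assms(1)] dual_hat_Cinf[OF assms(2)]] assms(1)
  by (simp add: dual_hat_def pb_pair_def)

lemma pb_eqI:
  assumes "s \<in> pb_sections E" "t \<in> pb_sections E"
    "\<And>\<theta> u. \<theta> \<in> dual_sections E \<Longrightarrow> pb_pair E \<theta> s u = pb_pair E \<theta> t u"
  shows "s = t"
proof
  fix u
  have "snd (s u) = snd (t u)"
    by (rule dual_separates) (use assms in \<open>auto simp: pb_pair_def\<close>)
  then show "s u = t u" using assms(1,2) by (simp add: prod_eq_iff)
qed

lemma pb_pair_add [simp]:
  "\<theta> \<in> dual_sections E \<Longrightarrow> s \<in> pb_sections E \<Longrightarrow> t \<in> pb_sections E \<Longrightarrow>
    pb_pair E \<theta> (pb_add E s t) = (\<lambda>u. pb_pair E \<theta> s u + pb_pair E \<theta> t u)"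
  by (auto simp: pb_pair_def pb_add_def dual_add)

lemma pb_pair_scale [simp]:
  "\<theta> \<in> dual_sections E \<Longrightarrow> s \<in> pb_sections E \<Longrightarrow>
    pb_pair E \<theta> (pb_scale E F s) = (\<lambda>u. F u * pb_pair E \<theta> s u)"
  by (auto simp: pb_pair_def pb_scale_def dual_scale)

lemma pb_pair_zero [simp]: "\<theta> \<in> dual_sections E \<Longrightarrow> pb_pair E \<theta> (pb_zero E) = (\<lambda>u. 0)"
  by (auto simp: pb_pair_def pb_zero_def dual_zero)

lemma pb_pair_hat [simp]: "pb_pair E \<theta> (hat E \<xi>) = (\<lambda>u. dual_pair \<theta> \<xi> (\<pi> u))"
  by (auto simp: pb_pair_def hat_def dual_pair_def)

lemma pb_pair_delta [simp]: "pb_pair E \<theta> pb_delta = dual_hat E \<theta>"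
  by (auto simp: pb_pair_def pb_delta_def dual_hat_def)

lemma pb_add_closed [simp]: "s \<in> pb_sections E \<Longrightarrow> t \<in> pb_sections E \<Longrightarrow> pb_add E s t \<in> pb_sections E"
  by (rule pb_sections_pairingI) (auto intro: Cinf_add[OF manifold_T] pb_pair_Cinf, auto simp: pb_add_def)

lemma pb_scale_closed [simp]: "F \<in> Cinf T \<Longrightarrow> s \<in> pb_sections E \<Longrightarrow> pb_scale E F s \<in> pb_sections E"
  by (rule pb_sections_pairingI) (auto intro: Cinf_mult[OF manifold_T] pb_pair_Cinf, auto simp: pb_scale_def)

lemma Cinf_T_const [simp]: "(\<lambda>_. c) \<in> Cinf T"
  by (rule Cinf_const[OF manifold_T])

lemma pb_zero_closed [simp]: "pb_zero E \<in> pb_sections E"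
  by (rule pb_sections_pairingI) (auto, auto simp: pb_zero_def)

lemma pb_diff_closed [simp]: "s \<in> pb_sections E \<Longrightarrow> t \<in> pb_sections E \<Longrightarrow> pb_diff E s t \<in> pb_sections E"
  by (simp add: pb_diff_def)

lemma pb_pair_diff [simp]:
  "\<theta> \<in> dual_sections E \<Longrightarrow> s \<in> pb_sections E \<Longrightarrow> t \<in> pb_sections E \<Longrightarrow>
    pb_pair E \<theta> (pb_diff E s t) = (\<lambda>u. pb_pair E \<theta> s u - pb_pair E \<theta> t u)"
  by (simp add: pb_diff_def)

lemma hat_closed [simp]: "\<xi> \<in> sections E \<Longrightarrow> hat E \<xi> \<in> pb_sections E"
  by (rule pb_sections_pairingI) (auto intro: Cinf_bproj dual_pair_Cinf, auto simp: hat_def)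

lemma pb_delta_closed [simp]: "pb_delta \<in> pb_sections E"
  by (rule pb_sections_pairingI) (auto intro: dual_hat_Cinf, auto simp: pb_delta_def)

text \<open>Sections of the pullback bundle are locally generated by the sections \<open>hat E \<xi>\<close>.\<close>

lemma pb_linear_vanishes:
  fixes \<Lambda> :: "'e pb_sec \<Rightarrow> real"
  assumes add: "\<And>s t. s \<in> pb_sections E \<Longrightarrow> t \<in> pb_sections E \<Longrightarrow> \<Lambda> (pb_add E s t) = \<Lambda> s + \<Lambda> t"
    and scale: "\<And>F s. F \<in> Cinf T \<Longrightarrow> s \<in> pb_sections E \<Longrightarrow> \<Lambda> (pb_scale E F s) = F u * \<Lambda> s"
    and hat: "\<And>\<xi>. \<xi> \<in> sections E \<Longrightarrow> \<Lambda> (hat E \<xi>) = 0"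
    and t: "t \<in> pb_sections E"
  shows "\<Lambda> t = 0"
proof -
  obtain L \<psi> where L: "set L \<subseteq> sections E \<times> dual_sections E" "\<psi> \<in> Cinf M" "\<psi> (\<pi> u) = 1"
     and expand: "\<And>\<zeta> v. \<zeta> \<in> dual_sections E \<Longrightarrow> \<psi> (\<pi> v) * \<zeta> (\<pi> v) v = (\<Sum>(e, \<theta>)\<leftarrow>L. \<theta> (\<pi> v) v * \<zeta> (\<pi> v) (e (\<pi> v)))"
    using global_frame[of "\<pi> u"] by blast
  define sm where "sm L = foldr (\<lambda>(e, \<theta>). pb_add E (pb_scale E (pb_pair E \<theta> t) (hat E e))) L (pb_zero E)" for L
  have sm: "sm L \<in> pb_sections E \<and> \<Lambda> (sm L) = 0 \<and>
    (\<forall>\<zeta>\<in>dual_sections E. \<forall>v. pb_pair E \<zeta> (sm L) v = (\<Sum>(e, \<theta>)\<leftarrow>L. pb_pair E \<theta> t v * \<zeta> (\<pi> v) (e (\<pi> v))))"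
    using L(1)
  proof (induction L)
    case Nil
    have "pb_zero E = pb_scale E (\<lambda>_. 0) (pb_zero E)"
      by (rule pb_eqI) auto
    then have "\<Lambda> (pb_zero E) = 0"
      using scale[of "\<lambda>_. 0" "pb_zero E"] by simp
    then show ?case by (simp add: sm_def)
  next
    case (Cons a L)
    obtain e \<theta> where a: "a = (e, \<theta>)" "e \<in> sections E" "\<theta> \<in> dual_sections E" using Cons.prems by auto
    have sm: "sm (a # L) = pb_add E (pb_scale E (pb_pair E \<theta> t) (hat E e)) (sm L)"
      by (simp add: sm_def a)
    show ?case
      unfolding sm using Cons a by (simp add: add scale hat pb_pair_Cinf t) (simp add: dual_pair_def)
  qed
  have "sm L = pb_scale E (\<lambda>v. \<psi> (\<pi> v)) t"
  proof (rule pb_eqI)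
    fix \<zeta> v assume \<zeta>: "\<zeta> \<in> dual_sections E"
    show "pb_pair E \<zeta> (sm L) v = pb_pair E \<zeta> (pb_scale E (\<lambda>v. \<psi> (\<pi> v)) t) v"
      using sm \<zeta> expand[OF \<zeta>, of "snd (t v)"] t by simp (simp add: pb_pair_def)
  qed (use sm t Cinf_bproj[OF L(2)] in auto)
  then show ?thesis using sm scale[OF Cinf_bproj[OF L(2)] t] L(3) by simp
qed

end


section \<open>Sections of the prolongation\<close>

text \<open>The derivation part of \<open>i_map\<close> before it is cut off by
  \<open>restrict0\<close>; on smooth functions \<open>deriv\<close> is backed by an actual
  derivative.\<close>

definition vert_deriv :: "('m, 'e, 'a, 'f, 'z) vbundle_scheme \<Rightarrow> 'e \<Rightarrow> 'e \<Rightarrow> ('e \<Rightarrow> real) \<Rightarrow> real" where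
  "vert_deriv E u v f = deriv (\<lambda>t. f (fib_add E u (fib_scale E t v))) 0"

locale smooth_lie_algebroid =
  fixes E :: "('m::{t2_space, second_countable_topology},
    'e::{t2_space, second_countable_topology}, 'a::real_inner, 'f::real_inner, 'z) lie_algd_scheme"
  assumes algebroid: "lie_algebroid E"

sublocale smooth_lie_algebroid \<subseteq> smooth_vector_bundle E
  using algebroid by unfold_locales (simp add: lie_algebroid_def)

section \<open>Differentiation along the fibres\<close>

context smooth_vector_bundle
begin

lemma fib_add_scale_0: "\<pi> u = \<pi> v \<Longrightarrow> fib_add E u (fib_scale E 0 v) = u"
  by (rule dual_separates) (auto simp: dual_add dual_scale)

text \<open>A trivialization is linear on fibres, so it maps the curve u + tv to a straight line in
  direction (0, \<Phi> v), and the chain rule applies.\<close>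

lemma DERIV_vertical_trivialization:
  assumes f: "f \<in> Cinf T" and uv: "\<pi> u = \<pi> v" and U: "trivialization E U \<phi> \<Phi>" "\<pi> u \<in> U"
  shows "((\<lambda>t. f (fib_add E u (fib_scale E t v))) has_field_derivative
     frechet_derivative (f \<circ> inv_into (\<pi> -` U) (\<lambda>u. (\<phi> (\<pi> u), \<Phi> u))) (at (\<phi> (\<pi> u), \<Phi> u)) (0, \<Phi> v)) (at 0)"
proof -
  define \<kappa> where "\<kappa> = (\<lambda>u. (\<phi> (\<pi> u), \<Phi> u))"
  define g where "g = f \<circ> inv_into (\<pi> -` U) \<kappa>"
  have \<kappa>: "admissible_chart T (\<pi> -` U) \<kappa>" using trivialization_chart_T[OF U(1)] by (simp add: \<kappa>_def)
  have "smooth_on (\<kappa> ` (\<pi> -` U \<inter> UNIV)) g"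
    unfolding g_def using f
    by (intro smooth_fun_on_admissible_chart[OF manifold_T \<kappa> open_UNIV]) (simp add: Cinf_iff)
  then have g: "(g has_derivative frechet_derivative g (at (\<kappa> u))) (at (\<kappa> u))"
    by (rule smooth_on_has_derivative) (use U in auto)
  have "((\<lambda>t::real. \<kappa> u + t *\<^sub>R y) has_derivative (\<lambda>t. 0 + t *\<^sub>R y)) (at 0)" for y
    by (intro has_derivative_add has_derivative_const has_derivative_scaleR_left has_derivative_ident)
  then have "((\<lambda>t::real. \<kappa> u + t *\<^sub>R (0, \<Phi> v)) has_derivative (\<lambda>t. t *\<^sub>R (0, \<Phi> v))) (at 0)"
    by (simp only: add_0)
  then have "((\<lambda>t. g (\<kappa> u + t *\<^sub>R (0, \<Phi> v))) has_derivative
      (\<lambda>t. frechet_derivative g (at (\<kappa> u)) (t *\<^sub>R (0, \<Phi> v)))) (at 0)"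
    by (rule has_derivative_compose) (use g in \<open>simp add: zero_prod_def[symmetric]\<close>)
  moreover have "f (fib_add E u (fib_scale E t v)) = g (\<kappa> u + t *\<^sub>R (0, \<Phi> v))" for t
  proof -
    have "\<kappa> u + t *\<^sub>R (0, \<Phi> v) = \<kappa> (fib_add E u (fib_scale E t v))"
      using uv U by (simp add: \<kappa>_def trivialization_fib[OF U(1)])
    then show ?thesis
      using is_chart_inverse[OF admissible_chart_is_chart[OF manifold_T \<kappa>], of "fib_add E u (fib_scale E t v)"] uv U(2)
      by (simp add: g_def)
  qed
  moreover have "frechet_derivative g (at (\<kappa> u)) (t *\<^sub>R (0, \<Phi> v)) = t * frechet_derivative g (at (\<kappa> u)) (0, \<Phi> v)" for t
    using linear_scale[OF has_derivative_linear[OF g], of t "(0, \<Phi> v)"] by (simp only: real_scaleR_def)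
  ultimately have "((\<lambda>t. f (fib_add E u (fib_scale E t v))) has_derivative
      (\<lambda>t. t * frechet_derivative g (at (\<kappa> u)) (0, \<Phi> v))) (at 0)" by simp
  then show ?thesis
    by (simp add: has_field_derivative_def g_def \<kappa>_def mult.commute[of _ "frechet_derivative _ _ _"])
qed

lemma vert_deriv_trivialization:
  assumes "f \<in> Cinf T" "\<pi> u = \<pi> v" "trivialization E U \<phi> \<Phi>" "\<pi> u \<in> U"
  shows "vert_deriv E u v f =
     frechet_derivative (f \<circ> inv_into (\<pi> -` U) (\<lambda>u. (\<phi> (\<pi> u), \<Phi> u))) (at (\<phi> (\<pi> u), \<Phi> u)) (0, \<Phi> v)"
  unfolding vert_deriv_def by (rule DERIV_imp_deriv[OF DERIV_vertical_trivialization[OF assms]])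

lemma DERIV_vert_deriv:
  assumes "f \<in> Cinf T" "\<pi> u = \<pi> v"
  shows "((\<lambda>t. f (fib_add E u (fib_scale E t v))) has_field_derivative vert_deriv E u v f) (at 0)"
proof -
  obtain U \<phi> \<Phi> where "\<pi> u \<in> U" "trivialization E U \<phi> \<Phi>" using trivialization_at by blast
  then show ?thesis
    using DERIV_vertical_trivialization[OF assms, of U \<phi> \<Phi>] vert_deriv_trivialization[OF assms, of U \<phi> \<Phi>] by simp
qed

lemma vert_deriv_linear:
  assumes f: "f \<in> Cinf T" and uv: "\<pi> u = \<pi> v" "\<pi> u = \<pi> w"
  shows "vert_deriv E u (fib_add E v w) f = vert_deriv E u v f + vert_deriv E u w f"
    and "vert_deriv E u (fib_scale E c v) f = c * vert_deriv E u v f"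
proof -
  obtain U \<phi> \<Phi> where U: "\<pi> u \<in> U" "trivialization E U \<phi> \<Phi>" using trivialization_at by blast
  define \<kappa> where "\<kappa> = (\<lambda>u. (\<phi> (\<pi> u), \<Phi> u))"
  define g where "g = f \<circ> inv_into (\<pi> -` U) \<kappa>"
  have \<kappa>: "admissible_chart T (\<pi> -` U) \<kappa>" using trivialization_chart_T[OF U(2)] by (simp add: \<kappa>_def)
  have "smooth_on (\<kappa> ` (\<pi> -` U \<inter> UNIV)) g"
    unfolding g_def using f
    by (intro smooth_fun_on_admissible_chart[OF manifold_T \<kappa> open_UNIV]) (simp add: Cinf_iff)
  then have "(g has_derivative frechet_derivative g (at (\<kappa> u))) (at (\<kappa> u))"
    by (rule smooth_on_has_derivative) (use U in auto)
  then have lin: "linear (frechet_derivative g (at (\<kappa> u)))" by (rule has_derivative_linear)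
  have vd: "vert_deriv E u x f = frechet_derivative g (at (\<kappa> u)) (0, \<Phi> x)" if "\<pi> u = \<pi> x" for x
    unfolding g_def \<kappa>_def by (rule vert_deriv_trivialization[OF f that U(2,1)])
  have "\<pi> u = \<pi> (fib_add E v w)" using uv by simp
  moreover have "(0, \<Phi> (fib_add E v w)) = (0, \<Phi> v) + (0::'a, \<Phi> w)"
    using uv U trivialization_fib(1)[OF U(2), of v w] by (metis add_0 add_Pair)
  ultimately show "vert_deriv E u (fib_add E v w) f = vert_deriv E u v f + vert_deriv E u w f"
    using vd[of "fib_add E v w"] vd[OF uv(1)] vd[OF uv(2)] linear_add[OF lin] by (simp only:)
  have "(0, \<Phi> (fib_scale E c v)) = c *\<^sub>R (0::'a, \<Phi> v)"
    using uv U trivialization_fib(2)[OF U(2), of v] by simp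
  then show "vert_deriv E u (fib_scale E c v) f = c * vert_deriv E u v f"
    using vd[OF uv(1)] vd[of "fib_scale E c v"] uv(1) linear_scale[OF lin, of c "(0, \<Phi> v)"] by (metis bproj_scale real_scaleR_def)
qed

text \<open>The direction (0, \<Phi>(t x)) depends on the point. Expanding it in a finite frame
  leaves derivatives in constant directions, which are smooth, with smooth coefficients.\<close>

lemma vert_deriv_Cinf:
  assumes f: "f \<in> Cinf T" and t: "t \<in> pb_sections E"
  shows "(\<lambda>u. vert_deriv E u (snd (t u)) f) \<in> Cinf T"
proof (rule Cinf_local[OF manifold_T])
  fix u
  obtain U \<phi> \<Phi> where U: "\<pi> u \<in> U" "trivialization E U \<phi> \<Phi>" using trivialization_at by blast
  obtain B where B: "finite_frame (B :: ('a \<times> 'f) set)" using manifold_frame[OF manifold_T] by blast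
  define \<kappa> where "\<kappa> = (\<lambda>u. (\<phi> (\<pi> u), \<Phi> u))"
  define g where "g = f \<circ> inv_into (\<pi> -` U) \<kappa>"
  let ?W = "\<pi> -` U"
  have o: "open ?W" using open_bproj_vimage[OF trivialization_open[OF U(2)]] .
  have \<kappa>: "admissible_chart T ?W \<kappa>" using trivialization_chart_T[OF U(2)] by (simp add: \<kappa>_def)
  have o': "open (\<kappa> ` ?W)"
    using admissible_chart_is_chart[OF manifold_T \<kappa>] by (simp add: is_chart_def)
  have "smooth_on (\<kappa> ` (?W \<inter> UNIV)) g"
    unfolding g_def using f
    by (intro smooth_fun_on_admissible_chart[OF manifold_T \<kappa> open_UNIV]) (simp add: Cinf_iff)
  then have g: "smooth_on (\<kappa> ` ?W) g" by simp
  have dg: "smooth_fun_on T ?W (\<lambda>x. frechet_derivative g (at (\<kappa> x)) b)" for b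
    using smooth_fun_on_compose[OF manifold_T B o o' _ admissible_chart_smooth[OF manifold_T \<kappa>]
        smooth_on_derivative[OF o' g, of b]] by simp
  have \<Phi>: "smooth_fun_on T ?W (\<lambda>x. \<Phi> (snd (t x)))"
    using smooth_map_smooth_fun_on[OF manifold_T manifold_T pb_sections_smooth[OF t] o trivialization_smooth[OF U(2)]] t
    by (auto simp: vimage_def)
  have "smooth_fun_on T ?W (\<lambda>x. \<Sum>b\<in>B. ((0, \<Phi> (snd (t x))) \<bullet> b) *\<^sub>R frechet_derivative g (at (\<kappa> x)) b)"
    by (intro smooth_fun_on_sum[OF manifold_T o] smooth_fun_on_scaleR[OF manifold_T o] dg
        smooth_fun_on_inner[OF manifold_T o] smooth_fun_on_Pair[OF manifold_T o] \<Phi> smooth_fun_on_const[OF manifold_T])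
  then have "smooth_fun_on T ?W (\<lambda>u. vert_deriv E u (snd (t u)) f)"
  proof (rule smooth_fun_on_cong[OF manifold_T o, rotated])
    fix x assume x: "x \<in> ?W"
    have "vert_deriv E x (snd (t x)) f = frechet_derivative g (at (\<kappa> x)) (0, \<Phi> (snd (t x)))"
      using vert_deriv_trivialization[OF f _ U(2), of x "snd (t x)"] x t by (simp add: g_def \<kappa>_def)
    moreover have "linear (frechet_derivative g (at (\<kappa> x)))"
      using smooth_on_has_derivative[OF g, of "\<kappa> x"] x has_derivative_linear by blast
    ultimately show "(\<Sum>b\<in>B. ((0, \<Phi> (snd (t x))) \<bullet> b) *\<^sub>R frechet_derivative g (at (\<kappa> x)) b)
        = vert_deriv E x (snd (t x)) f"
      using finite_frame_linear[OF B] by metis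
  qed
  then show "\<exists>W. open W \<and> u \<in> W \<and> smooth_fun_on T W (\<lambda>u. vert_deriv E u (snd (t u)) f)"
    using o U by blast
qed

text \<open>The function is affine in the parameter along u + tv, with slope \<theta>(v). Fibrewise
  linear functions thus detect vertical vectors completely.\<close>

lemma vert_deriv_dual_hat:
  assumes "\<theta> \<in> dual_sections E" "\<pi> u = \<pi> v"
  shows "vert_deriv E u v (dual_hat E \<theta>) = \<theta> (\<pi> u) v"
proof -
  have "dual_hat E \<theta> (fib_add E u (fib_scale E t v)) = \<theta> (\<pi> u) u + t * \<theta> (\<pi> u) v" for t
    using assms by (simp add: dual_hat_def dual_add[OF assms(1)] dual_scale[OF assms(1)])
  then show ?thesis unfolding vert_deriv_def
    by (auto intro!: DERIV_imp_deriv derivative_eq_intros)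
qed

lemma i_map_eq: "i_map E (u, v) = (fib_zero E (\<pi> u), u, restrict0 (Cinf T) (vert_deriv E u v))"
  by (simp add: i_map_def vert_deriv_def[abs_def])

lemma vert_deriv_tangent:
  assumes uv: "\<pi> u = \<pi> v"
  shows "(u, restrict0 (Cinf T) (vert_deriv E u v)) \<in> tangent_vectors T"
proof -
  have "vert_deriv E u v (\<lambda>x. f x + g x) = vert_deriv E u v f + vert_deriv E u v g"
    if "f \<in> Cinf T" "g \<in> Cinf T" for f g
    unfolding vert_deriv_def[of E u v "\<lambda>x. f x + g x"]
    by (rule DERIV_imp_deriv DERIV_add DERIV_vert_deriv that uv)+
  moreover have "vert_deriv E u v (\<lambda>x. c * f x) = c * vert_deriv E u v f" if "f \<in> Cinf T" for c f
    unfolding vert_deriv_def[of E u v "\<lambda>x. c * f x"]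
    by (rule DERIV_imp_deriv DERIV_cmult DERIV_vert_deriv that uv)+
  moreover have "vert_deriv E u v (\<lambda>x. f x * g x) = f u * vert_deriv E u v g + vert_deriv E u v f * g u"
    if "f \<in> Cinf T" "g \<in> Cinf T" for f g
    using DERIV_imp_deriv[OF DERIV_mult[OF DERIV_vert_deriv[OF that(1) uv] DERIV_vert_deriv[OF that(2) uv]]]
    unfolding vert_deriv_def[of E u v "\<lambda>x. f x * g x"] by (simp add: fib_add_scale_0[OF uv] algebra_simps)
  ultimately show ?thesis
    using Cinf_add[OF manifold_T] Cinf_mult[OF manifold_T]
    by (auto simp: tangent_vectors_def restrict0_def)
qed

lemma vert_deriv_bproj:
  assumes "\<pi> u = \<pi> v"
  shows "vert_deriv E u v (\<lambda>x. f (\<pi> x)) = 0"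
  using assms by (simp add: vert_deriv_def)

end

section \<open>The maps i and j on sections of the prolongation\<close>

context smooth_lie_algebroid
begin

lemma anchor_tangent: "la_anchor E u \<in> tangent_vectors M" and fst_anchor [simp]: "fst (la_anchor E u) = \<pi> u"
  and anchor_add: "\<pi> u = \<pi> v \<Longrightarrow> la_anchor E (fib_add E u v) = tan_add (la_anchor E u) (la_anchor E v)"
  and anchor_scale: "la_anchor E (fib_scale E c u) = tan_scale c (la_anchor E u)"
  and anchor_smooth: "f \<in> Cinf M \<Longrightarrow> (\<lambda>u. snd (la_anchor E u) f) \<in> Cinf T"
  and la_bracket_on: "lie_bracket_on (Cinf M) (sections E) (sec_add E) (sec_scale E) (fib_zero E)
       (anchor_deriv E) (la_bracket E)"
  using algebroid unfolding lie_algebroid_def by blast+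

lemma anchor_zero: "la_anchor E (fib_zero E p) = tan_zero p"
  using anchor_scale[of 0 "fib_zero E p"] fib_scale_0[of "fib_zero E p"]
  by (simp add: tan_scale_def tan_zero_def)

lemma pushforward_add:
  "fst z = fst w \<Longrightarrow> pushforward M \<pi> (tan_add z w) = tan_add (pushforward M \<pi> z) (pushforward M \<pi> w)"
  by (auto simp: pushforward_def tan_add_def restrict0_def)

lemma pushforward_scale: "pushforward M \<pi> (tan_scale c z) = tan_scale c (pushforward M \<pi> z)"
  by (auto simp: pushforward_def tan_scale_def restrict0_def)

lemma tangent_add: "z \<in> tangent_vectors T \<Longrightarrow> w \<in> tangent_vectors T \<Longrightarrow> fst z = fst w \<Longrightarrow> tan_add z w \<in> tangent_vectors T"
  unfolding tangent_vectors_def tan_add_def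
  by (cases z, cases w) (simp add: distrib_left distrib_right)

lemma tangent_scale: "z \<in> tangent_vectors T \<Longrightarrow> tan_scale c z \<in> tangent_vectors T"
  unfolding tangent_vectors_def tan_scale_def
  by (cases z) (simp add: distrib_left)

lemma pr_sectionsD:
  assumes "s \<in> pr_sections E"
  shows "fst (snd (s v)) = v" "snd (s v) \<in> tangent_vectors T"
    "la_anchor E (fst (s v)) = pushforward M \<pi> (snd (s v))" "\<pi> (fst (s v)) = \<pi> v"
    "snd \<circ> s \<in> vector_fields T"
proof -
  have "s v \<in> prolongation E" "fst (snd (s v)) = v" "snd \<circ> s \<in> vector_fields T"
    using assms unfolding pr_sections_def by auto
  then show *: "fst (snd (s v)) = v" "snd (s v) \<in> tangent_vectors T"
    "la_anchor E (fst (s v)) = pushforward M \<pi> (snd (s v))" "snd \<circ> s \<in> vector_fields T"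
    by (auto simp: prolongation_def)
  have "fst (la_anchor E (fst (s v))) = fst (pushforward M \<pi> (snd (s v)))" using *(3) by simp
  then show "\<pi> (fst (s v)) = \<pi> v" using *(1) by (simp add: pushforward_def)
qed

lemma j_map_apply: "j_map (s u) = (fst (snd (s u)), fst (s u))"
  by (simp add: j_map_def case_prod_beta)

lemma j_closed [simp]: "s \<in> pr_sections E \<Longrightarrow> j_map \<circ> s \<in> pb_sections E"
  using pr_sectionsD(1,4)[of s] unfolding pb_sections_def
  by (auto simp: j_map_apply o_def pr_sections_def)

lemma pr_sectionsI:
  assumes "j_map \<circ> s \<in> pb_sections E" "\<And>v. snd (s v) \<in> tangent_vectors T"
    "\<And>v. la_anchor E (fst (s v)) = pushforward M \<pi> (snd (s v))"
    "\<And>f. f \<in> Cinf T \<Longrightarrow> pr_deriv s f \<in> Cinf T"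
  shows "s \<in> pr_sections E"
proof -
  have 1: "fst (snd (s v)) = v" for v
    using pb_sections_fst[OF assms(1), of v] by (simp add: j_map_apply)
  have "smooth_map T T (fst \<circ> s)"
    using pb_sections_smooth[OF assms(1)] by (simp add: j_map_apply o_def)
  moreover have "snd \<circ> s \<in> vector_fields T"
    using assms(2,4) 1 by (simp add: vector_fields_def pr_deriv_def)
  ultimately show ?thesis
    using 1 assms(2,3) by (auto simp: pr_sections_def prolongation_def case_prod_beta)
qed

lemma pr_deriv_Cinf: "s \<in> pr_sections E \<Longrightarrow> f \<in> Cinf T \<Longrightarrow> pr_deriv s f \<in> Cinf T"
  using pr_sectionsD(5)[of s] by (simp add: vector_fields_def pr_deriv_def)

lemma pr_deriv_apply: "pr_deriv s f u = snd (snd (s u)) f"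
  by (simp add: pr_deriv_def vf_apply_def)

lemma pr_deriv_fun_add:
  "s \<in> pr_sections E \<Longrightarrow> f \<in> Cinf T \<Longrightarrow> g \<in> Cinf T \<Longrightarrow>
    pr_deriv s (\<lambda>x. f x + g x) u = pr_deriv s f u + pr_deriv s g u"
  and pr_deriv_fun_mult:
  "s \<in> pr_sections E \<Longrightarrow> f \<in> Cinf T \<Longrightarrow> g \<in> Cinf T \<Longrightarrow>
    pr_deriv s (\<lambda>x. f x * g x) u = f u * pr_deriv s g u + pr_deriv s f u * g u"
  using pr_sectionsD(1,2)[of s u] by (auto simp: pr_deriv_apply tangent_vectors_def)

lemma pr_deriv_bproj:
  assumes "s \<in> pr_sections E" "f \<in> Cinf M"
  shows "pr_deriv s (\<lambda>u. f (\<pi> u)) v = snd (la_anchor E (fst (s v))) f"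
  using pr_sectionsD(3)[OF assms(1), of v] assms(2)
  by (simp add: pr_deriv_apply pushforward_def restrict0_def o_def)

text \<open>Tangent vectors vanish on nonsmooth functions by definition, so testing derivations on
  smooth functions is enough. Foot points agree automatically, and \<open>j_map\<close> takes care
  of the component in E.\<close>

lemma pr_eqI:
  assumes "s \<in> pr_sections E" "t \<in> pr_sections E" "j_map \<circ> s = j_map \<circ> t"
    "\<And>f u. f \<in> Cinf T \<Longrightarrow> pr_deriv s f u = pr_deriv t f u"
  shows "s = t"
proof
  fix u
  have "fst (s u) = fst (t u)"
    using fun_cong[OF assms(3), of u] by (simp add: j_map_apply)
  moreover have "snd (snd (s u)) f = snd (snd (t u)) f" for f
  proof (cases "f \<in> Cinf T")
    case True then show ?thesis using assms(4)[of f u] by (simp add: pr_deriv_apply)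
  next
    case False
    then show ?thesis using pr_sectionsD(2)[OF assms(1), of u] pr_sectionsD(2)[OF assms(2), of u]
      by (auto simp: tangent_vectors_def)
  qed
  ultimately show "s u = t u"
    using pr_sectionsD(1)[OF assms(1), of u] pr_sectionsD(1)[OF assms(2), of u]
    by (auto simp: prod_eq_iff)
qed

lemma j_add [simp]: "s \<in> pr_sections E \<Longrightarrow> j_map \<circ> pr_add E s t = pb_add E (j_map \<circ> s) (j_map \<circ> t)"
  by (rule ext) (simp add: j_map_def pr_add_def pb_add_def tan_add_def case_prod_beta pr_sectionsD)

lemma j_scale [simp]: "s \<in> pr_sections E \<Longrightarrow> j_map \<circ> pr_scale E F s = pb_scale E F (j_map \<circ> s)"
  by (rule ext) (simp add: j_map_def pr_scale_def pb_scale_def tan_scale_def case_prod_beta pr_sectionsD)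

lemma j_zero [simp]: "j_map \<circ> pr_zero E = pb_zero E"
  by (rule ext) (simp add: j_map_def pr_zero_def pb_zero_def tan_zero_def)

lemma pr_deriv_add [simp]: "pr_deriv (pr_add E s t) f = (\<lambda>u. pr_deriv s f u + pr_deriv t f u)"
  by (rule ext) (simp add: pr_deriv_apply pr_add_def tan_add_def)

lemma pr_deriv_scale [simp]: "pr_deriv (pr_scale E F s) f = (\<lambda>u. F u * pr_deriv s f u)"
  by (rule ext) (simp add: pr_deriv_apply pr_scale_def tan_scale_def)

lemma pr_deriv_zero [simp]: "pr_deriv (pr_zero E) f = (\<lambda>u. 0)"
  by (rule ext) (simp add: pr_deriv_apply pr_zero_def tan_zero_def)

lemma pr_add_closed [simp]:
  assumes "s \<in> pr_sections E" "t \<in> pr_sections E"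
  shows "pr_add E s t \<in> pr_sections E"
proof (rule pr_sectionsI)
  fix v
  note s = pr_sectionsD(1-4)[OF assms(1), of v] and t = pr_sectionsD(1-4)[OF assms(2), of v]
  show "snd (pr_add E s t v) \<in> tangent_vectors T"
    using s t by (simp add: pr_add_def tangent_add)
  show "la_anchor E (fst (pr_add E s t v)) = pushforward M \<pi> (snd (pr_add E s t v))"
    using s t by (simp add: pr_add_def anchor_add pushforward_add)
qed (use assms in \<open>auto intro: Cinf_add[OF manifold_T] pr_deriv_Cinf\<close>)

lemma pr_scale_closed [simp]:
  assumes "F \<in> Cinf T" "s \<in> pr_sections E"
  shows "pr_scale E F s \<in> pr_sections E"
proof (rule pr_sectionsI)
  fix v
  note s = pr_sectionsD(1-4)[OF assms(2), of v]
  show "snd (pr_scale E F s v) \<in> tangent_vectors T"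
    using s by (simp add: pr_scale_def tangent_scale)
  show "la_anchor E (fst (pr_scale E F s v)) = pushforward M \<pi> (snd (pr_scale E F s v))"
    using s by (simp add: pr_scale_def anchor_scale pushforward_scale)
qed (use assms in \<open>auto intro: Cinf_mult[OF manifold_T] pr_deriv_Cinf\<close>)

lemma i_apply: "t \<in> pb_sections E \<Longrightarrow>
    i_map E (t u) = (fib_zero E (\<pi> u), u, restrict0 (Cinf T) (vert_deriv E u (snd (t u))))"
  using i_map_eq[of u "snd (t u)"] by (metis pb_sections_fst prod.collapse)

lemma pr_deriv_i:
  "t \<in> pb_sections E \<Longrightarrow> f \<in> Cinf T \<Longrightarrow> pr_deriv (i_map E \<circ> t) f u = vert_deriv E u (snd (t u)) f"
  by (simp add: pr_deriv_apply restrict0_def i_apply)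

lemma j_i [simp]: "t \<in> pb_sections E \<Longrightarrow> j_map \<circ> (i_map E \<circ> t) = pb_zero E"
  by (rule ext) (simp add: i_apply j_map_def pb_zero_def)

lemma i_closed [simp]:
  assumes t: "t \<in> pb_sections E"
  shows "i_map E \<circ> t \<in> pr_sections E"
proof (rule pr_sectionsI)
  fix v
  show "snd ((i_map E \<circ> t) v) \<in> tangent_vectors T"
    using t by (simp add: i_apply vert_deriv_tangent)
  \<comment> \<open>Functions pulled back from the base are constant along u + tv, so the
    pushforward is zero, which matches the anchor of the zero vector.\<close>
  have "restrict0 (Cinf M) (\<lambda>f. restrict0 (Cinf T) (vert_deriv E v (snd (t v))) (f \<circ> \<pi>)) = (\<lambda>_. 0)"
    using vert_deriv_bproj[of v "snd (t v)"] t by (auto simp: restrict0_def o_def)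
  then show "la_anchor E (fst ((i_map E \<circ> t) v)) = pushforward M \<pi> (snd ((i_map E \<circ> t) v))"
    using t by (simp add: i_apply anchor_zero pushforward_def tan_zero_def)
next
  fix f assume f: "f \<in> Cinf T"
  have "pr_deriv (i_map E \<circ> t) f = (\<lambda>u. vert_deriv E u (snd (t u)) f)"
    by (rule ext) (rule pr_deriv_i[OF t f])
  then show "pr_deriv (i_map E \<circ> t) f \<in> Cinf T" using vert_deriv_Cinf[OF f t] by simp
qed (use t in simp)

text \<open>Reads off t from i(t); this is how sections of the pullback bundle are identified once
  they are known only through their image under i.\<close>

lemma pr_deriv_i_dual_hat:
  "t \<in> pb_sections E \<Longrightarrow> \<theta> \<in> dual_sections E \<Longrightarrow> pr_deriv (i_map E \<circ> t) (dual_hat E \<theta>) u = pb_pair E \<theta> t u"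
  using pr_deriv_i[OF _ dual_hat_Cinf] by (simp add: vert_deriv_dual_hat pb_pair_def)

lemma i_add:
  assumes "s \<in> pb_sections E" "t \<in> pb_sections E"
  shows "i_map E \<circ> pb_add E s t = pr_add E (i_map E \<circ> s) (i_map E \<circ> t)"
proof (rule pr_eqI)
  show "j_map \<circ> (i_map E \<circ> pb_add E s t) = j_map \<circ> pr_add E (i_map E \<circ> s) (i_map E \<circ> t)"
    using assms by simp (rule pb_eqI, auto)
  fix f u assume f: "f \<in> Cinf T"
  show "pr_deriv (i_map E \<circ> pb_add E s t) f u = pr_deriv (pr_add E (i_map E \<circ> s) (i_map E \<circ> t)) f u"
    using assms f by (simp add: pr_deriv_i) (simp add: pb_add_def vert_deriv_linear)
qed (use assms in auto)

lemma i_scale: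
  assumes "F \<in> Cinf T" "s \<in> pb_sections E"
  shows "i_map E \<circ> pb_scale E F s = pr_scale E F (i_map E \<circ> s)"
proof (rule pr_eqI)
  show "j_map \<circ> (i_map E \<circ> pb_scale E F s) = j_map \<circ> pr_scale E F (i_map E \<circ> s)"
    using assms by simp (rule pb_eqI, auto)
  fix f u assume f: "f \<in> Cinf T"
  show "pr_deriv (i_map E \<circ> pb_scale E F s) f u = pr_deriv (pr_scale E F (i_map E \<circ> s)) f u"
    using assms f by (simp add: pr_deriv_i) (simp add: pb_scale_def vert_deriv_linear)
qed (use assms in auto)

lemma pr_zero_eq: "s \<in> pr_sections E \<Longrightarrow> pr_scale E (\<lambda>_. 0) s = pr_zero E"
  by (rule ext) (simp add: pr_scale_def pr_zero_def fib_scale_0 pr_sectionsD tan_scale_def tan_zero_def)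

lemma pr_zero_closed [simp]: "pr_zero E \<in> pr_sections E"
  using pr_zero_eq[OF i_closed[OF pb_zero_closed]] pr_scale_closed[OF Cinf_T_const i_closed[OF pb_zero_closed]]
  by metis

end


section \<open>Complete lifts\<close>

text \<open>The Berwald formula mentions complete lifts, so their existence is settled first, from
  an Ehresmann connection with its vertical map and a semispray.\<close>

locale spray_connection = smooth_lie_algebroid E
  for E :: "('m::{t2_space, second_countable_topology},
    'e::{t2_space, second_countable_topology}, 'a::real_inner, 'f::real_inner, 'z) lie_algd_scheme" +
  fixes br :: "'e pr_sec \<Rightarrow> 'e pr_sec \<Rightarrow> 'e pr_sec" and S :: "'e pr_sec"
    and H :: "'e pb_sec \<Rightarrow> 'e pr_sec" and V :: "'e pr_sec \<Rightarrow> 'e pb_sec"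
  assumes bracket: "prolongation_bracket E br"
    and semispray: "semispray E S"
    and ehresmann: "ehresmann_connection E H"
    and vertical: "vertical_map E H V"

section \<open>Bracket algebra on E and Lie derivatives of one-forms\<close>

context smooth_lie_algebroid
begin

lemma anchor_deriv_apply: "anchor_deriv E X f p = snd (la_anchor E (X p)) f"
  by (simp add: anchor_deriv_def vf_apply_def)

lemma anchor_deriv_Cinf:
  assumes "X \<in> sections E" "f \<in> Cinf M"
  shows "anchor_deriv E X f \<in> Cinf M"
proof -
  have "anchor_deriv E X f = (\<lambda>p. snd (la_anchor E (X p)) f)" by (rule ext) (rule anchor_deriv_apply)
  then show ?thesis
    using smooth_map_Cinf[OF manifold_M manifold_T sections_smooth[OF assms(1)] anchor_smooth[OF assms(2)]] by simp
qed

lemma anchor_deriv_fun: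
  assumes "X \<in> sections E" "f \<in> Cinf M" "g \<in> Cinf M"
  shows "anchor_deriv E X (\<lambda>x. f x + g x) p = anchor_deriv E X f p + anchor_deriv E X g p"
    and "anchor_deriv E X (\<lambda>x. f x * g x) p = f p * anchor_deriv E X g p + anchor_deriv E X f p * g p"
    and "anchor_deriv E X (\<lambda>x. c * f x) p = c * anchor_deriv E X f p"
proof -
  have "fst (la_anchor E (X p)) = p" using assms(1) by simp
  then obtain D where D: "la_anchor E (X p) = (p, D)" by (metis prod.collapse)
  then show "anchor_deriv E X (\<lambda>x. f x + g x) p = anchor_deriv E X f p + anchor_deriv E X g p"
    and "anchor_deriv E X (\<lambda>x. f x * g x) p = f p * anchor_deriv E X g p + anchor_deriv E X f p * g p"
    and "anchor_deriv E X (\<lambda>x. c * f x) p = c * anchor_deriv E X f p"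
    using anchor_tangent[of "X p"] assms(2,3)
    by (auto simp: anchor_deriv_apply tangent_vectors_def)
qed

lemma anchor_deriv_diff:
  assumes "X \<in> sections E" "f \<in> Cinf M" "g \<in> Cinf M"
  shows "anchor_deriv E X (\<lambda>x. f x - g x) p = anchor_deriv E X f p - anchor_deriv E X g p"
  using anchor_deriv_fun(1)[OF assms(1,2) Cinf_mult[OF manifold_M Cinf_const[OF manifold_M, of "-1"] assms(3)], of p]
    anchor_deriv_fun(3)[OF assms(1,3,3), of "-1" p] by simp

lemma la_closed [simp]: "X \<in> sections E \<Longrightarrow> Y \<in> sections E \<Longrightarrow> la_bracket E X Y \<in> sections E"
  and la_add_left: "X \<in> sections E \<Longrightarrow> Y \<in> sections E \<Longrightarrow> Z \<in> sections E \<Longrightarrow>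
    la_bracket E (sec_add E X Y) Z = sec_add E (la_bracket E X Z) (la_bracket E Y Z)"
  and la_add_right: "X \<in> sections E \<Longrightarrow> Y \<in> sections E \<Longrightarrow> Z \<in> sections E \<Longrightarrow>
    la_bracket E X (sec_add E Y Z) = sec_add E (la_bracket E X Y) (la_bracket E X Z)"
  and la_const_right: "X \<in> sections E \<Longrightarrow> Y \<in> sections E \<Longrightarrow>
    la_bracket E X (sec_scale E (\<lambda>_. c) Y) = sec_scale E (\<lambda>_. c) (la_bracket E X Y)"
  and la_self: "X \<in> sections E \<Longrightarrow> la_bracket E X X = fib_zero E"
  and la_jacobi: "X \<in> sections E \<Longrightarrow> Y \<in> sections E \<Longrightarrow> Z \<in> sections E \<Longrightarrow>
    sec_add E (la_bracket E X (la_bracket E Y Z))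
      (sec_add E (la_bracket E Y (la_bracket E Z X)) (la_bracket E Z (la_bracket E X Y))) = fib_zero E"
  and la_leibniz: "f \<in> Cinf M \<Longrightarrow> X \<in> sections E \<Longrightarrow> Y \<in> sections E \<Longrightarrow>
    la_bracket E X (sec_scale E f Y) = sec_add E (sec_scale E f (la_bracket E X Y)) (sec_scale E (anchor_deriv E X f) Y)"
  using la_bracket_on unfolding lie_bracket_on_def by simp_all

lemma dual_pair_zero: "\<theta> \<in> dual_sections E \<Longrightarrow> dual_pair \<theta> (fib_zero E) p = 0"
  by (simp add: dual_pair_def dual_zero)

lemma Cinf_M_const [simp]: "(\<lambda>_. c) \<in> Cinf M"
  by (rule Cinf_const[OF manifold_M])

text \<open>Polarization of \<open>la_self\<close>. The sign rules for the bracket are stated under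
  a pairing, where negation is that of the reals.\<close>

lemma la_anti:
  assumes X: "X \<in> sections E" and Y: "Y \<in> sections E" and \<theta>: "\<theta> \<in> dual_sections E"
  shows "dual_pair \<theta> (la_bracket E X Y) p = - dual_pair \<theta> (la_bracket E Y X) p"
proof -
  have "0 = dual_pair \<theta> (la_bracket E (sec_add E X Y) (sec_add E X Y)) p"
    using la_self[OF sec_add_sections[OF X Y]] dual_pair_zero[OF \<theta>] by simp
  also have "\<dots> = dual_pair \<theta> (la_bracket E X Y) p + dual_pair \<theta> (la_bracket E Y X) p"
    unfolding la_add_left[OF X Y sec_add_sections[OF X Y]]
    using X Y \<theta> by (simp add: la_add_right sec_add_sections dual_pair_add la_self dual_pair_zero zero_section)
  finally show ?thesis by simp
qed

lemma la_neg_right: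
  assumes X: "X \<in> sections E" and Y: "Y \<in> sections E" and Z: "Z \<in> sections E" and \<theta>: "\<theta> \<in> dual_sections E"
  shows "dual_pair \<theta> (la_bracket E X (la_bracket E Y Z)) p = - dual_pair \<theta> (la_bracket E X (la_bracket E Z Y)) p"
proof -
  have "la_bracket E Y Z = sec_scale E (\<lambda>_. -1) (la_bracket E Z Y)"
    by (rule sections_eqI) (use assms in \<open>auto simp: dual_pair_scale sec_scale_sections la_anti[OF Y Z]\<close>)
  then show ?thesis using assms by (simp add: la_const_right dual_pair_scale)
qed

lemma la_jacobi_pair:
  assumes X: "X \<in> sections E" and Y: "Y \<in> sections E" and Z: "Z \<in> sections E" and \<theta>: "\<theta> \<in> dual_sections E"
  shows "dual_pair \<theta> (la_bracket E (la_bracket E X Y) Z) p =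
    dual_pair \<theta> (la_bracket E X (la_bracket E Y Z)) p - dual_pair \<theta> (la_bracket E Y (la_bracket E X Z)) p"
proof -
  have "dual_pair \<theta> (sec_add E (la_bracket E X (la_bracket E Y Z))
      (sec_add E (la_bracket E Y (la_bracket E Z X)) (la_bracket E Z (la_bracket E X Y)))) p = 0"
    using la_jacobi[OF X Y Z] dual_pair_zero[OF \<theta>] by simp
  moreover have "dual_pair \<theta> (la_bracket E Z (la_bracket E X Y)) p = - dual_pair \<theta> (la_bracket E (la_bracket E X Y) Z) p"
    by (intro la_anti la_closed assms)
  ultimately show ?thesis
    using assms la_neg_right[OF Y Z X \<theta>, of p] by (simp add: dual_pair_add sec_add_sections)
qed

lemma la_zero_right: "X \<in> sections E \<Longrightarrow> la_bracket E X (fib_zero E) = fib_zero E"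
proof -
  have z: "sec_scale E (\<lambda>_. 0) Y = fib_zero E" if "Y \<in> sections E" for Y
    by (rule ext) (use that in \<open>simp add: sec_scale_def fib_scale_0\<close>)
  assume X: "X \<in> sections E"
  then show ?thesis
    using la_const_right[OF X zero_section, of 0] z[OF zero_section] z[OF la_closed[OF X zero_section]] by simp
qed

text \<open>In the defining formula the terms that differentiate a factor f cancel between anchor
  and bracket. What remains is linear over the smooth functions, hence depends only on the value of
  the section and defines a functional on each fibre.\<close>

lemma dual_lie_ex:
  assumes X: "X \<in> sections E" and \<theta>: "\<theta> \<in> dual_sections E"
  shows "\<exists>\<theta>'. \<theta>' \<in> dual_sections E \<and> (\<forall>\<xi>\<in>sections E. \<forall>p. dual_pair \<theta>' \<xi> p =
        anchor_deriv E X (dual_pair \<theta> \<xi>) p - dual_pair \<theta> (la_bracket E X \<xi>) p)"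
proof -
  define A where "A p \<xi> = anchor_deriv E X (dual_pair \<theta> \<xi>) p - dual_pair \<theta> (la_bracket E X \<xi>) p" for p \<xi>
  \<comment> \<open>Any section through \<open>v\<close> gives the same value, by
    \<open>sections_tensorial\<close>; off the fibre the value 0 is prescribed by
    \<open>dual_sections\<close>.\<close>
  define \<theta>' where "\<theta>' p v = (if \<pi> v = p then A p (SOME \<xi>. \<xi> \<in> sections E \<and> \<xi> p = v) else 0)" for p v
  have add: "A p (sec_add E \<xi> \<zeta>) = A p \<xi> + A p \<zeta>" if "\<xi> \<in> sections E" "\<zeta> \<in> sections E" for p \<xi> \<zeta>
    using that X \<theta> by (simp add: A_def dual_pair_add dual_pair_Cinf anchor_deriv_fun la_add_right)
  have scale: "A p (sec_scale E f \<xi>) = f p * A p \<xi>" if "f \<in> Cinf M" "\<xi> \<in> sections E" for p f \<xi>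
    using that X \<theta>
    by (simp add: A_def dual_pair_add dual_pair_scale dual_pair_Cinf anchor_deriv_fun anchor_deriv_Cinf
        la_leibniz sec_scale_sections algebra_simps)
  have A: "\<theta>' p (\<xi> p) = A p \<xi>" if "\<xi> \<in> sections E" for p \<xi>
  proof -
    have "\<exists>\<zeta>. \<zeta> \<in> sections E \<and> \<zeta> p = \<xi> p" using that by blast
    from someI_ex[OF this] have "A p (SOME \<zeta>. \<zeta> \<in> sections E \<and> \<zeta> p = \<xi> p) = A p \<xi>"
      by (intro sections_tensorial[where p = p, OF add scale]) (use that in auto)
    then show ?thesis using that by (simp add: \<theta>'_def)
  qed
  have "\<theta>' \<in> dual_sections E"
    unfolding dual_sections_def
  proof (intro CollectI conjI allI impI ballI)
    fix p u v assume uv: "\<pi> u = p" "\<pi> v = p"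
    obtain \<xi> where "\<xi> \<in> sections E" "\<xi> p = u" using section_through[of u] uv(1) by blast
    moreover obtain \<zeta> where "\<zeta> \<in> sections E" "\<zeta> p = v" using section_through[of v] uv(2) by blast
    ultimately show "\<theta>' p (fib_add E u v) = \<theta>' p u + \<theta>' p v"
      using A[of \<xi> p] A[of \<zeta> p] A[OF sec_add_sections, of \<xi> \<zeta> p] add by (simp add: sec_add_def)
  next
    fix p c u assume u: "\<pi> u = p"
    obtain \<xi> where "\<xi> \<in> sections E" "\<xi> p = u" using section_through[of u] u by blast
    then show "\<theta>' p (fib_scale E c u) = c * \<theta>' p u"
      using A[of \<xi> p] A[OF sec_scale_sections, of "\<lambda>_. c" \<xi> p] scale by (simp add: sec_scale_def)
  next
    fix p u assume "\<pi> u \<noteq> p" then show "\<theta>' p u = 0" by (simp add: \<theta>'_def)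
  next
    fix \<xi> assume \<xi>: "\<xi> \<in> sections E"
    have "(\<lambda>p. A p \<xi>) \<in> Cinf M"
      unfolding A_def using \<xi> X \<theta>
      by (intro Cinf_diff[OF manifold_M] anchor_deriv_Cinf dual_pair_Cinf la_closed)
    then show "dual_pair \<theta>' \<xi> \<in> Cinf M" using A[OF \<xi>] by (simp add: dual_pair_def)
  qed
  then show ?thesis using A by (intro exI[of _ \<theta>']) (simp add: dual_pair_def A_def)
qed

lemma dual_sections_eqI:
  assumes "\<theta> \<in> dual_sections E" "\<theta>' \<in> dual_sections E"
    "\<And>\<xi> p. \<xi> \<in> sections E \<Longrightarrow> dual_pair \<theta> \<xi> p = dual_pair \<theta>' \<xi> p"
  shows "\<theta> = \<theta>'"
proof (intro ext)
  fix p v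
  show "\<theta> p v = \<theta>' p v"
  proof (cases "\<pi> v = p")
    case True
    then obtain \<xi> where "\<xi> \<in> sections E" "\<xi> p = v" using section_through[of v] by blast
    then show ?thesis using assms(3)[of \<xi> p] by (simp add: dual_pair_def)
  qed (use assms(1,2) in \<open>auto simp: dual_sections_def\<close>)
qed

lemma dual_lie:
  assumes "X \<in> sections E" "\<theta> \<in> dual_sections E"
  shows "dual_lie E X \<theta> \<in> dual_sections E"
    and "\<xi> \<in> sections E \<Longrightarrow> dual_pair (dual_lie E X \<theta>) \<xi> p =
        anchor_deriv E X (dual_pair \<theta> \<xi>) p - dual_pair \<theta> (la_bracket E X \<xi>) p"
proof -
  have "\<exists>!\<theta>'. \<theta>' \<in> dual_sections E \<and> (\<forall>\<xi>\<in>sections E. \<forall>p. dual_pair \<theta>' \<xi> p =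
        anchor_deriv E X (dual_pair \<theta> \<xi>) p - dual_pair \<theta> (la_bracket E X \<xi>) p)"
    using dual_lie_ex[OF assms] by (auto intro!: ex_ex1I dual_sections_eqI)
  from theI'[OF this] show "dual_lie E X \<theta> \<in> dual_sections E"
    and "\<xi> \<in> sections E \<Longrightarrow> dual_pair (dual_lie E X \<theta>) \<xi> p =
        anchor_deriv E X (dual_pair \<theta> \<xi>) p - dual_pair \<theta> (la_bracket E X \<xi>) p"
    by (auto simp: dual_lie_def)
qed

end

section \<open>Calculus of the prolongation bracket and the splitting by a connection\<close>

context spray_connection
begin

lemma br_closed [simp]: "s \<in> pr_sections E \<Longrightarrow> t \<in> pr_sections E \<Longrightarrow> br s t \<in> pr_sections E"
  and br_add_left: "r \<in> pr_sections E \<Longrightarrow> s \<in> pr_sections E \<Longrightarrow> t \<in> pr_sections E \<Longrightarrow>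
    br (pr_add E r s) t = pr_add E (br r t) (br s t)"
  and br_add_right: "r \<in> pr_sections E \<Longrightarrow> s \<in> pr_sections E \<Longrightarrow> t \<in> pr_sections E \<Longrightarrow>
    br r (pr_add E s t) = pr_add E (br r s) (br r t)"
  and br_const_left: "s \<in> pr_sections E \<Longrightarrow> t \<in> pr_sections E \<Longrightarrow>
    br (pr_scale E (\<lambda>_. c) s) t = pr_scale E (\<lambda>_. c) (br s t)"
  and br_const_right: "s \<in> pr_sections E \<Longrightarrow> t \<in> pr_sections E \<Longrightarrow>
    br s (pr_scale E (\<lambda>_. c) t) = pr_scale E (\<lambda>_. c) (br s t)"
  and br_self: "s \<in> pr_sections E \<Longrightarrow> br s s = pr_zero E"
  and br_jacobi: "r \<in> pr_sections E \<Longrightarrow> s \<in> pr_sections E \<Longrightarrow> t \<in> pr_sections E \<Longrightarrow>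
    pr_add E (br r (br s t)) (pr_add E (br s (br t r)) (br t (br r s))) = pr_zero E"
  and br_leibniz: "F \<in> Cinf T \<Longrightarrow> s \<in> pr_sections E \<Longrightarrow> t \<in> pr_sections E \<Longrightarrow>
    br s (pr_scale E F t) = pr_add E (pr_scale E F (br s t)) (pr_scale E (pr_deriv s F) t)"
  using bracket unfolding prolongation_bracket_def lie_bracket_on_def by simp_all

lemma pr_sum_zero_imp:
  assumes "s \<in> pr_sections E" "t \<in> pr_sections E" "pr_add E s t = pr_zero E"
  shows "s = pr_scale E (\<lambda>_. -1) t"
proof (rule pr_eqI)
  show "j_map \<circ> s = j_map \<circ> pr_scale E (\<lambda>_. - 1) t"
  proof (rule pb_eqI)
    fix \<theta> u assume \<theta>: "\<theta> \<in> dual_sections E"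
    have "pb_pair E \<theta> (j_map \<circ> pr_add E s t) u = 0" unfolding assms(3) using \<theta> by simp
    then show "pb_pair E \<theta> (j_map \<circ> s) u = pb_pair E \<theta> (j_map \<circ> pr_scale E (\<lambda>_. - 1) t) u"
      using assms(1,2) \<theta> by simp
  qed (use assms in auto)
  fix f u
  have "pr_deriv (pr_add E s t) f u = 0" unfolding assms(3) by simp
  then show "pr_deriv s f u = pr_deriv (pr_scale E (\<lambda>_. - 1) t) f u" by simp
qed (use assms in auto)

lemma pr_add_zero [simp]: "s \<in> pr_sections E \<Longrightarrow> pr_add E s (pr_zero E) = s"
  and pr_zero_add [simp]: "s \<in> pr_sections E \<Longrightarrow> pr_add E (pr_zero E) s = s"
  by (rule pr_eqI; simp; rule pb_eqI; simp)+

lemma br_anti: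
  assumes s: "s \<in> pr_sections E" and t: "t \<in> pr_sections E"
  shows "br s t = pr_scale E (\<lambda>_. -1) (br t s)"
proof (rule pr_sum_zero_imp)
  have "pr_zero E = br (pr_add E s t) (pr_add E s t)" using s t by (simp add: br_self)
  also have "\<dots> = pr_add E (br s t) (br t s)"
    unfolding br_add_left[OF s t pr_add_closed[OF s t]] using s t by (simp add: br_add_right br_self)
  finally show "pr_add E (br s t) (br t s) = pr_zero E" by (rule sym)
qed (use s t in auto)

text \<open>The form of the Jacobi identity in which bracketing with a fixed section passes through
  nested brackets, one entry at a time.\<close>

lemma br_derivation:
  assumes r: "r \<in> pr_sections E" and s: "s \<in> pr_sections E" and t: "t \<in> pr_sections E"
  shows "br r (br s t) = pr_add E (br (br r s) t) (br s (br r t))"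
proof -
  have 1: "br s (br t r) = pr_scale E (\<lambda>_. -1) (br s (br r t))"
    using br_anti[OF t r] br_const_right[of s "br r t" "-1"] r s t by simp
  have 2: "br t (br r s) = pr_scale E (\<lambda>_. -1) (br (br r s) t)"
    using br_anti[of t "br r s"] r s t by simp
  have "br r (br s t) = pr_scale E (\<lambda>_. -1) (pr_add E (br s (br t r)) (br t (br r s)))"
    by (rule pr_sum_zero_imp) (use br_jacobi[OF r s t] r s t in auto)
  also have "\<dots> = pr_add E (br (br r s) t) (br s (br r t))"
    unfolding 1 2 by (rule pr_eqI; (rule pb_eqI)?) (use r s t in auto)
  finally show ?thesis .
qed

lemma br_zero_right: "s \<in> pr_sections E \<Longrightarrow> br s (pr_zero E) = pr_zero E"
  using br_const_right[of s "pr_zero E" 0] pr_zero_eq[OF pr_zero_closed] pr_zero_eq[of "br s (pr_zero E)"] by simp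

lemma br_zero_left: "s \<in> pr_sections E \<Longrightarrow> br (pr_zero E) s = pr_zero E"
  using br_const_left[of "pr_zero E" s 0] pr_zero_eq[OF pr_zero_closed] pr_zero_eq[of "br (pr_zero E) s"] by simp

lemma H_closed [simp]: "t \<in> pb_sections E \<Longrightarrow> H t \<in> pr_sections E"
  and j_H [simp]: "t \<in> pb_sections E \<Longrightarrow> j_map \<circ> H t = t"
  and H_add: "s \<in> pb_sections E \<Longrightarrow> t \<in> pb_sections E \<Longrightarrow> H (pb_add E s t) = pr_add E (H s) (H t)"
  and H_scale: "F \<in> Cinf T \<Longrightarrow> t \<in> pb_sections E \<Longrightarrow> H (pb_scale E F t) = pr_scale E F (H t)"
  using ehresmann unfolding ehresmann_connection_def by blast+

lemma V_closed [simp]: "s \<in> pr_sections E \<Longrightarrow> V s \<in> pb_sections E"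
  and V_add: "s \<in> pr_sections E \<Longrightarrow> t \<in> pr_sections E \<Longrightarrow> V (pr_add E s t) = pb_add E (V s) (V t)"
  and V_scale: "F \<in> Cinf T \<Longrightarrow> s \<in> pr_sections E \<Longrightarrow> V (pr_scale E F s) = pb_scale E F (V s)"
  and V_i [simp]: "r \<in> pb_sections E \<Longrightarrow> V (i_map E \<circ> r) = r"
  and ker_V: "{s \<in> pr_sections E. V s = pb_zero E} = H ` pb_sections E"
  using vertical unfolding vertical_map_def by blast+

lemma V_H [simp]: "t \<in> pb_sections E \<Longrightarrow> V (H t) = pb_zero E"
  using ker_V by blast

lemma H_zero: "H (pb_zero E) = pr_zero E"
proof -
  have "pb_zero E = pb_scale E (\<lambda>_. 0) (pb_zero E)" by (rule pb_eqI) auto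
  then have "H (pb_zero E) = pr_scale E (\<lambda>_. 0) (H (pb_zero E))" by (metis H_scale Cinf_T_const pb_zero_closed)
  then show ?thesis by (simp add: pr_zero_eq)
qed

text \<open>Subtracting i(V s) from s leaves a section in the kernel of \<open>V\<close>, hence a
  horizontal one H(t). Applying \<open>j_map\<close>, which annihilates the image of i, identifies t
  as j(s).\<close>

lemma decomposition:
  assumes s: "s \<in> pr_sections E"
  shows "s = pr_add E (i_map E \<circ> V s) (H (j_map \<circ> s))"
proof -
  define d where "d = pr_add E s (pr_scale E (\<lambda>_. -1) (i_map E \<circ> V s))"
  have d: "d \<in> pr_sections E" using s by (simp add: d_def)
  have "V d = pb_zero E"
    by (rule pb_eqI) (use s in \<open>auto simp: d_def V_add V_scale\<close>)
  then obtain t where t: "t \<in> pb_sections E" "d = H t" using ker_V d by blast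
  have "j_map \<circ> d = j_map \<circ> s"
    by (rule pb_eqI) (use s in \<open>auto simp: d_def\<close>)
  then have "d = H (j_map \<circ> s)" using t by simp
  moreover have "s = pr_add E (i_map E \<circ> V s) d"
    unfolding d_def by (rule pr_eqI; (rule pb_eqI)?) (use s in auto)
  ultimately show ?thesis by simp
qed

text \<open>Exactness at the middle term, on sections, with \<open>V\<close> as an explicit
  preimage; through it \<open>i_inv\<close> becomes computable.\<close>

lemma vertical_eq:
  assumes "s \<in> pr_sections E" "j_map \<circ> s = pb_zero E"
  shows "i_map E \<circ> V s = s"
  using decomposition[OF assms(1)] assms by (simp add: H_zero)

lemma i_inv_eq:
  assumes "s \<in> pr_sections E" "j_map \<circ> s = pb_zero E"
  shows "i_inv E s = V s"
  unfolding i_inv_def using vertical_eq[OF assms] assms(1) by (intro the_equality) auto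

lemma S_closed [simp]: "S \<in> pr_sections E"
  using semispray unfolding semispray_def by simp

text \<open>The semispray condition equates two images under i, and i is injective on sections
  because \<open>V\<close> is a left inverse.\<close>

lemma j_S: "j_map \<circ> S = pb_delta"
proof -
  have "i_map E \<circ> (j_map \<circ> S) = i_map E \<circ> pb_delta"
    using semispray unfolding semispray_def liouville_def by (simp add: comp_assoc)
  then show ?thesis using V_i[OF j_closed[OF S_closed]] V_i[OF pb_delta_closed] by simp
qed

lemma hat_zero: "hat E (fib_zero E) = pb_zero E"
  by (simp add: hat_def pb_zero_def)

text \<open>The bracket has an explicit formula only on projectable sections. Complete lifts,
  horizontal lifts of basic sections and all vertical sections are of this kind, the latter over the
  zero section.\<close>

lemma projectable_bracket:
  assumes X: "X \<in> sections E" and Y: "Y \<in> sections E" and s: "s \<in> pr_sections E" "j_map \<circ> s = hat E X"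
    and t: "t \<in> pr_sections E" "j_map \<circ> t = hat E Y"
  shows "j_map \<circ> br s t = hat E (la_bracket E X Y)"
    and "f \<in> Cinf T \<Longrightarrow> pr_deriv (br s t) f u = pr_deriv s (pr_deriv t f) u - pr_deriv t (pr_deriv s f) u"
proof -
  have fs: "fst (s v) = X (\<pi> v)" and ft: "fst (t v) = Y (\<pi> v)" for v
    using fun_cong[OF s(2), of v] fun_cong[OF t(2), of v] by (auto simp: j_map_apply hat_def)
  have es: "s = (\<lambda>v. (X (\<pi> v), (snd \<circ> s) v))" and et: "t = (\<lambda>v. (Y (\<pi> v), (snd \<circ> t) v))"
    using fs ft by (auto simp: prod_eq_iff)
  have "pushforward M \<pi> ((snd \<circ> s) v) = la_anchor E (X (\<pi> v))"
    "pushforward M \<pi> ((snd \<circ> t) v) = la_anchor E (Y (\<pi> v))" for v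
    using pr_sectionsD(3)[OF s(1), of v] pr_sectionsD(3)[OF t(1), of v] fs ft by auto
  then have "br (\<lambda>v. (X (\<pi> v), (snd \<circ> s) v)) (\<lambda>v. (Y (\<pi> v), (snd \<circ> t) v)) =
      (\<lambda>v. (la_bracket E X Y (\<pi> v), vf_bracket T (snd \<circ> s) (snd \<circ> t) v))"
    using bracket X Y pr_sectionsD(5)[OF s(1)] pr_sectionsD(5)[OF t(1)]
    unfolding prolongation_bracket_def by blast
  then have b: "br s t = (\<lambda>v. (la_bracket E X Y (\<pi> v), vf_bracket T (snd \<circ> s) (snd \<circ> t) v))"
    using es et by simp
  show "j_map \<circ> br s t = hat E (la_bracket E X Y)"
    by (rule ext) (simp add: b j_map_def hat_def vf_bracket_def)
  show "pr_deriv (br s t) f u = pr_deriv s (pr_deriv t f) u - pr_deriv t (pr_deriv s f) u" if "f \<in> Cinf T"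
    using that unfolding b by (simp add: pr_deriv_apply vf_bracket_def restrict0_def) (simp add: pr_deriv_def)
qed

text \<open>A vertical section is projectable over zero, so the bracket is projectable over [X, 0] =
  0.\<close>

lemma j_bracket_vertical:
  assumes X: "X \<in> sections E" and s: "s \<in> pr_sections E" "j_map \<circ> s = hat E X" and t: "t \<in> pb_sections E"
  shows "j_map \<circ> br s (i_map E \<circ> t) = pb_zero E"
  using projectable_bracket(1)[OF X zero_section s, of "i_map E \<circ> t"] t X
  by (simp add: hat_zero la_zero_right)

lemma pr_deriv_projectable:
  assumes "X \<in> sections E" "s \<in> pr_sections E" "j_map \<circ> s = hat E X" "f \<in> Cinf M"
  shows "pr_deriv s (\<lambda>u. f (\<pi> u)) v = anchor_deriv E X f (\<pi> v)"
  using pr_deriv_bproj[OF assms(2,4), of v] fun_cong[OF assms(3), of v]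
  by (simp add: anchor_deriv_apply j_map_apply hat_def)

text \<open>Both sides are \<open>C\<^sup>\<infinity>(E)\<close>-linear in \<open>t\<close> up to the same derivation term.\<close>

lemma projectable_dual_lie:
  assumes X: "X \<in> sections E" and s: "s \<in> pr_sections E" "j_map \<circ> s = hat E X"
    and \<theta>: "\<theta> \<in> dual_sections E" and t: "t \<in> pb_sections E"
  shows "pr_deriv s (pb_pair E \<theta> t) u = pb_pair E \<theta> (j_map \<circ> br s (H t)) u + pb_pair E (dual_lie E X \<theta>) t u"
proof -
  note L = dual_lie[OF X \<theta>]
  have "pr_deriv s (pb_pair E \<theta> t) u - pb_pair E \<theta> (j_map \<circ> br s (H t)) u - pb_pair E (dual_lie E X \<theta>) t u = 0"
  proof (rule pb_linear_vanishes[OF _ _ _ t, of "\<lambda>t. pr_deriv s (pb_pair E \<theta> t) u - pb_pair E \<theta> (j_map \<circ> br s (H t)) u -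
      pb_pair E (dual_lie E X \<theta>) t u"])
    fix r t assume "r \<in> pb_sections E" "t \<in> pb_sections E"
    then show "pr_deriv s (pb_pair E \<theta> (pb_add E r t)) u - pb_pair E \<theta> (j_map \<circ> br s (H (pb_add E r t))) u
        - pb_pair E (dual_lie E X \<theta>) (pb_add E r t) u =
      pr_deriv s (pb_pair E \<theta> r) u - pb_pair E \<theta> (j_map \<circ> br s (H r)) u - pb_pair E (dual_lie E X \<theta>) r u +
      (pr_deriv s (pb_pair E \<theta> t) u - pb_pair E \<theta> (j_map \<circ> br s (H t)) u - pb_pair E (dual_lie E X \<theta>) t u)"
      using s \<theta> L(1) by (simp add: H_add br_add_right pr_deriv_fun_add pb_pair_Cinf)
  next
    fix F t assume "F \<in> Cinf T" "t \<in> pb_sections E"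
    then show "pr_deriv s (pb_pair E \<theta> (pb_scale E F t)) u - pb_pair E \<theta> (j_map \<circ> br s (H (pb_scale E F t))) u
        - pb_pair E (dual_lie E X \<theta>) (pb_scale E F t) u =
      F u * (pr_deriv s (pb_pair E \<theta> t) u - pb_pair E \<theta> (j_map \<circ> br s (H t)) u - pb_pair E (dual_lie E X \<theta>) t u)"
      using s \<theta> L(1)
      by (simp add: H_scale br_leibniz pr_deriv_fun_mult pb_pair_Cinf pr_deriv_Cinf algebra_simps)
  next
    fix \<xi> assume \<xi>: "\<xi> \<in> sections E"
    show "pr_deriv s (pb_pair E \<theta> (hat E \<xi>)) u - pb_pair E \<theta> (j_map \<circ> br s (H (hat E \<xi>))) u
        - pb_pair E (dual_lie E X \<theta>) (hat E \<xi>) u = 0"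
      using pr_deriv_projectable[OF X s dual_pair_Cinf[OF \<theta> \<xi>], of u]
        projectable_bracket(1)[OF X \<xi> s, of "H (hat E \<xi>)"] \<xi> L(2)[OF \<xi>] by simp
  qed
  then show ?thesis by simp
qed

text \<open>The difference of two candidates is killed by \<open>j_map\<close>, hence of the form
  i(t), and its vanishing on all fibrewise linear functions forces t to be zero.\<close>

lemma complete_lift_unique:
  assumes X: "X \<in> sections E" and c: "c \<in> pr_sections E" "j_map \<circ> c = hat E X"
    and c': "c' \<in> pr_sections E" "j_map \<circ> c' = hat E X"
    and dual: "\<And>\<theta> u. \<theta> \<in> dual_sections E \<Longrightarrow> pr_deriv c (dual_hat E \<theta>) u = pr_deriv c' (dual_hat E \<theta>) u"
  shows "c = c'"
proof -
  define d where "d = pr_add E c (pr_scale E (\<lambda>_. -1) c')"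
  have d: "d \<in> pr_sections E" using c c' by (simp add: d_def)
  have "j_map \<circ> d = pb_zero E"
    by (rule pb_eqI) (use c c' X in \<open>auto simp: d_def\<close>)
  from vertical_eq[OF d this] have iV: "i_map E \<circ> V d = d" .
  have "V d = pb_zero E"
  proof (rule pb_eqI)
    fix \<theta> u assume \<theta>: "\<theta> \<in> dual_sections E"
    show "pb_pair E \<theta> (V d) u = pb_pair E \<theta> (pb_zero E) u"
      using pr_deriv_i_dual_hat[OF V_closed[OF d] \<theta>, of u] dual[OF \<theta>] \<theta> unfolding iV by (simp add: d_def)
  qed (use d in auto)
  moreover have "i_map E \<circ> pb_zero E = pr_zero E"
    using i_scale[of "\<lambda>_. 0" "pb_zero E"] pr_zero_eq[of "i_map E \<circ> pb_zero E"]
      pb_eqI[of "pb_zero E" "pb_scale E (\<lambda>_. 0) (pb_zero E)"] by simp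
  ultimately have "d = pr_zero E" using iV by simp
  then have "pr_deriv d f u = 0" for f u by simp
  then have "pr_deriv c f u = pr_deriv c' f u" for f u by (simp add: d_def)
  then show ?thesis by (intro pr_eqI) (use c c' in auto)
qed

text \<open>Eliminates the \<open>THE\<close> in the complete lift: its three conditions become
  conditions on a section of the prolongation, to which the uniqueness result applies.\<close>

lemma complete_lift_eqI:
  assumes X: "X \<in> sections E" and c: "c \<in> pr_sections E" "j_map \<circ> c = hat E X"
    and dual: "\<And>\<theta> u. \<theta> \<in> dual_sections E \<Longrightarrow> pr_deriv c (dual_hat E \<theta>) u = dual_hat E (dual_lie E X \<theta>) u"
  shows "complete_lift E X = c"
proof -
  have fc: "fst (c v) = X (\<pi> v)" for v
    using fun_cong[OF c(2), of v] by (auto simp: j_map_apply hat_def)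
  have "complete_lift_vf E X = snd \<circ> c"
    unfolding complete_lift_vf_def
  proof (rule the_equality)
    show "snd \<circ> c \<in> vector_fields T \<and> (\<forall>u. pushforward M \<pi> ((snd \<circ> c) u) = la_anchor E (X (\<pi> u))) \<and>
        (\<forall>\<theta>\<in>dual_sections E. vf_apply (snd \<circ> c) (dual_hat E \<theta>) = dual_hat E (dual_lie E X \<theta>))"
      using pr_sectionsD(3,5)[OF c(1)] fc dual by (auto simp: pr_deriv_def)
    fix Z assume Z: "Z \<in> vector_fields T \<and> (\<forall>u. pushforward M \<pi> (Z u) = la_anchor E (X (\<pi> u))) \<and>
        (\<forall>\<theta>\<in>dual_sections E. vf_apply Z (dual_hat E \<theta>) = dual_hat E (dual_lie E X \<theta>))"
    \<comment> \<open>A competing vector field, paired with X along \<pi>, is itself a section of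
      the prolongation and can be compared with \<open>c\<close>.\<close>
    define c' where "c' = (\<lambda>v. (X (\<pi> v), Z v))"
    have Z': "Z v \<in> tangent_vectors T" "fst (Z v) = v" for v using Z by (auto simp: vector_fields_def)
    have j: "j_map \<circ> c' = hat E X" using Z' by (auto simp: c'_def j_map_def hat_def)
    have "c' \<in> pr_sections E"
      by (rule pr_sectionsI) (use X Z Z' j in \<open>auto simp: c'_def vector_fields_def pr_deriv_def comp_def\<close>)
    moreover have "pr_deriv c' (dual_hat E \<theta>) u = dual_hat E (dual_lie E X \<theta>) u" if "\<theta> \<in> dual_sections E" for \<theta> u
      using Z that by (auto simp: c'_def pr_deriv_def comp_def)
    ultimately have "c' = c" using complete_lift_unique[OF X _ j c] dual by simp
    then show "Z = snd \<circ> c" by (auto simp: c'_def)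
  qed
  then show ?thesis using fc by (auto simp: complete_lift_def prod_eq_iff)
qed

text \<open>Existence: if \<open>P\<close> is any projectable section over \<open>X\<close>, the complete lift is \<open>P - J[P, S]\<close>.\<close>

lemma complete_lift:
  assumes X: "X \<in> sections E"
  shows "complete_lift E X \<in> pr_sections E" "j_map \<circ> complete_lift E X = hat E X"
    "\<theta> \<in> dual_sections E \<Longrightarrow> pr_deriv (complete_lift E X) (dual_hat E \<theta>) = dual_hat E (dual_lie E X \<theta>)"
proof -
  define P where "P = H (hat E X)"
  \<comment> \<open>The correction -j[P, S], computed with P = H(X) as the projectable section at
    hand.\<close>
  define w where "w = pb_scale E (\<lambda>_. -1) (j_map \<circ> br P S)"
  define c where "c = pr_add E P (i_map E \<circ> w)"
  have P: "P \<in> pr_sections E" "j_map \<circ> P = hat E X" using X by (auto simp: P_def)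
  have w: "w \<in> pb_sections E" using P by (simp add: w_def)
  have c: "c \<in> pr_sections E" using P w by (simp add: c_def)
  have jc: "j_map \<circ> c = hat E X"
    by (rule pb_eqI) (use c P w X in \<open>auto simp: c_def\<close>)
  have dual: "pr_deriv c (dual_hat E \<theta>) u = dual_hat E (dual_lie E X \<theta>) u" if \<theta>: "\<theta> \<in> dual_sections E" for \<theta> u
  proof -
    \<comment> \<open>Up to its vertical part, whose bracket with P is invisible to
      \<open>j_map\<close>, the semispray is H(\<delta>). This makes
      \<open>projectable_dual_lie\<close> applicable with t = \<delta>, where the pairing with
      \<theta> is precisely the fibrewise linear function.\<close>
    have S: "S = pr_add E (i_map E \<circ> V S) (H pb_delta)" using decomposition[OF S_closed] j_S by simp
    have "j_map \<circ> br P S = pb_add E (j_map \<circ> br P (i_map E \<circ> V S)) (j_map \<circ> br P (H pb_delta))"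
      by (subst S) (use P in \<open>simp add: br_add_right\<close>)
    also have "j_map \<circ> br P (i_map E \<circ> V S) = pb_zero E" by (rule j_bracket_vertical[OF X P]) simp
    finally have e: "j_map \<circ> br P S = pb_add E (pb_zero E) (j_map \<circ> br P (H pb_delta))" .
    have "pb_pair E \<theta> (j_map \<circ> br P S) u = pb_pair E \<theta> (j_map \<circ> br P (H pb_delta)) u"
      unfolding e using P \<theta> by simp
    then show ?thesis
      using projectable_dual_lie[OF X P \<theta> pb_delta_closed, of u] P w \<theta>
      by (simp add: c_def pr_deriv_i_dual_hat) (simp add: w_def)
  qed
  have "complete_lift E X = c" by (rule complete_lift_eqI[OF X c jc dual])
  then show "complete_lift E X \<in> pr_sections E" "j_map \<circ> complete_lift E X = hat E X"
    "\<theta> \<in> dual_sections E \<Longrightarrow> pr_deriv (complete_lift E X) (dual_hat E \<theta>) = dual_hat E (dual_lie E X \<theta>)"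
    using c jc dual by auto
qed

lemma projectable_complete_lift: "X \<in> sections E \<Longrightarrow> projectable E (complete_lift E X)"
  unfolding projectable_def by (intro conjI bexI[of _ X] complete_lift(1)) (auto simp: complete_lift_def)

section \<open>Brackets of complete and vertical lifts\<close>

lemma anchor_bracket:
  assumes X: "X \<in> sections E" and Y: "Y \<in> sections E" and f: "f \<in> Cinf M"
  shows "anchor_deriv E (la_bracket E X Y) f p =
    anchor_deriv E X (anchor_deriv E Y f) p - anchor_deriv E Y (anchor_deriv E X f) p"
proof -
  \<comment> \<open>That the anchor preserves brackets is extracted from the prolongation: its
    bracket acts as a commutator of vector fields, and on functions from the base projectable
    sections act through the anchor.\<close>
  define s t where "s = H (hat E X)" and "t = H (hat E Y)"
  have s: "s \<in> pr_sections E" "j_map \<circ> s = hat E X" and t: "t \<in> pr_sections E" "j_map \<circ> t = hat E Y"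
    using X Y by (auto simp: s_def t_def)
  have fs: "pr_deriv s (\<lambda>u. f (\<pi> u)) = (\<lambda>u. anchor_deriv E X f (\<pi> u))"
    and ft: "pr_deriv t (\<lambda>u. f (\<pi> u)) = (\<lambda>u. anchor_deriv E Y f (\<pi> u))"
    using pr_deriv_projectable[OF X s f] pr_deriv_projectable[OF Y t f] by auto
  \<comment> \<open>Any point over \<open>p\<close> would serve for the evaluation; the zero vector
    is a canonical one.\<close>
  have "pr_deriv (br s t) (\<lambda>u. f (\<pi> u)) (fib_zero E p) = anchor_deriv E (la_bracket E X Y) f p"
    using pr_deriv_projectable[OF la_closed[OF X Y] br_closed[OF s(1) t(1)] projectable_bracket(1)[OF X Y s t] f] by simp
  then show ?thesis
    using projectable_bracket(2)[OF X Y s t Cinf_bproj[OF f], of "fib_zero E p"] fs ft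
      pr_deriv_projectable[OF X s anchor_deriv_Cinf[OF Y f]] pr_deriv_projectable[OF Y t anchor_deriv_Cinf[OF X f]]
    by simp
qed

text \<open>The mixed terms, where one section differentiates and the other is bracketed with \<xi>,
  are symmetric in X and Y and cancel. The others are matched by \<open>anchor_bracket\<close> and
  the Jacobi identity.\<close>

lemma dual_lie_bracket:
  assumes X: "X \<in> sections E" and Y: "Y \<in> sections E" and \<theta>: "\<theta> \<in> dual_sections E"
  shows "dual_hat E (dual_lie E (la_bracket E X Y) \<theta>) u =
    dual_hat E (dual_lie E X (dual_lie E Y \<theta>)) u - dual_hat E (dual_lie E Y (dual_lie E X \<theta>)) u"
proof -
  \<comment> \<open>\<open>dual_lie\<close> is characterized by pairings with sections only, so its
    value on \<open>u\<close> is reached through a section passing through \<open>u\<close>.\<close>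
  obtain \<xi> where \<xi>: "\<xi> \<in> sections E" "\<xi> (\<pi> u) = u" using section_through[of u] by blast
  have h: "dual_hat E \<zeta> u = dual_pair \<zeta> \<xi> (\<pi> u)" for \<zeta> using \<xi> by (simp add: dual_hat_def dual_pair_def)
  have L: "dual_pair (dual_lie E Z \<theta>) \<xi> =
      (\<lambda>p. anchor_deriv E Z (dual_pair \<theta> \<xi>) p - dual_pair \<theta> (la_bracket E Z \<xi>) p)"
    if "Z \<in> sections E" for Z using dual_lie(2)[OF that \<theta> \<xi>(1)] by auto
  have "anchor_deriv E W (dual_pair (dual_lie E Z \<theta>) \<xi>) p = anchor_deriv E W (anchor_deriv E Z (dual_pair \<theta> \<xi>)) p
      - anchor_deriv E W (dual_pair \<theta> (la_bracket E Z \<xi>)) p" if "Z \<in> sections E" "W \<in> sections E" for Z W p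
    unfolding L[OF that(1)] using that \<theta> \<xi>
    by (intro anchor_deriv_diff dual_pair_Cinf anchor_deriv_Cinf la_closed)
  then show ?thesis
    using X Y \<theta> \<xi> dual_lie(1) by (simp add: h dual_lie(2) anchor_bracket la_jacobi_pair dual_pair_Cinf)
qed

text \<open>Both sides are vertical, so it is enough to compare them on fibrewise linear functions.
  There the commutator of the two derivations is the defining formula of the Lie derivative of
  \<theta>, solved for the bracket term.\<close>

lemma complete_vertical_bracket:
  assumes X: "X \<in> sections E" and Y: "Y \<in> sections E"
  shows "br (complete_lift E X) (i_map E \<circ> hat E Y) = i_map E \<circ> hat E (la_bracket E X Y)"
proof -
  let ?c = "complete_lift E X" and ?v = "i_map E \<circ> hat E Y"
  note c = complete_lift[OF X]
  have v: "?v \<in> pr_sections E" "j_map \<circ> ?v = hat E (fib_zero E)" using Y by (auto simp: hat_zero)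
  have b: "br ?c ?v \<in> pr_sections E" using c v by simp
  have iV: "i_map E \<circ> V (br ?c ?v) = br ?c ?v"
    by (rule vertical_eq[OF b j_bracket_vertical[OF X c(1,2)]]) (use Y in simp)
  have "V (br ?c ?v) = hat E (la_bracket E X Y)"
  proof (rule pb_eqI)
    fix \<theta> u assume \<theta>: "\<theta> \<in> dual_sections E"
    have 1: "pr_deriv ?v (dual_hat E \<theta>') = (\<lambda>u. dual_pair \<theta>' Y (\<pi> u))" if "\<theta>' \<in> dual_sections E" for \<theta>'
      using pr_deriv_i_dual_hat[OF hat_closed[OF Y] that] by auto
    have "pb_pair E \<theta> (V (br ?c ?v)) u = pr_deriv (br ?c ?v) (dual_hat E \<theta>) u"
      using pr_deriv_i_dual_hat[OF V_closed[OF b] \<theta>, of u] unfolding iV by simp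
    also have "\<dots> = pr_deriv ?c (\<lambda>u. dual_pair \<theta> Y (\<pi> u)) u - pr_deriv ?v (dual_hat E (dual_lie E X \<theta>)) u"
      using projectable_bracket(2)[OF X zero_section c(1,2) v dual_hat_Cinf[OF \<theta>], of u] 1[OF \<theta>] c(3)[OF \<theta>] by simp
    also have "\<dots> = anchor_deriv E X (dual_pair \<theta> Y) (\<pi> u) - dual_pair (dual_lie E X \<theta>) Y (\<pi> u)"
      using pr_deriv_projectable[OF X c(1,2) dual_pair_Cinf[OF \<theta> Y]] 1[OF dual_lie(1)[OF X \<theta>]] by simp
    also have "\<dots> = dual_pair \<theta> (la_bracket E X Y) (\<pi> u)" using dual_lie(2)[OF X \<theta> Y] by simp
    finally show "pb_pair E \<theta> (V (br ?c ?v)) u = pb_pair E \<theta> (hat E (la_bracket E X Y)) u" by simp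
  qed (use b X Y in auto)
  then show ?thesis using iV by simp
qed

text \<open>By the characterization of complete lifts only the action on fibrewise linear functions
  has to be checked, and there the claim is \<open>dual_lie_bracket\<close>.\<close>

lemma complete_complete_bracket:
  assumes X: "X \<in> sections E" and Y: "Y \<in> sections E"
  shows "br (complete_lift E X) (complete_lift E Y) = complete_lift E (la_bracket E X Y)"
proof (rule complete_lift_eqI[symmetric, OF la_closed[OF X Y]])
  note c = complete_lift[OF X] and d = complete_lift[OF Y]
  show "br (complete_lift E X) (complete_lift E Y) \<in> pr_sections E" using c d by simp
  show "j_map \<circ> br (complete_lift E X) (complete_lift E Y) = hat E (la_bracket E X Y)"
    by (rule projectable_bracket(1)[OF X Y c(1,2) d(1,2)])
  fix \<theta> u assume \<theta>: "\<theta> \<in> dual_sections E"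
  show "pr_deriv (br (complete_lift E X) (complete_lift E Y)) (dual_hat E \<theta>) u = dual_hat E (dual_lie E (la_bracket E X Y) \<theta>) u"
    using projectable_bracket(2)[OF X Y c(1,2) d(1,2) dual_hat_Cinf[OF \<theta>], of u]
      c(3) d(3) dual_lie(1)[OF X \<theta>] dual_lie(1)[OF Y \<theta>] \<theta> dual_lie_bracket[OF X Y \<theta>, of u] by simp
qed

end


section \<open>Invariance of the curvature tensors\<close>

locale spray_symmetry = spray_connection E br S H V
  for E :: "('m::{t2_space, second_countable_topology},
    'e::{t2_space, second_countable_topology}, 'a::real_inner, 'f::real_inner, 'z) lie_algd_scheme"
    and br S H V +
  fixes \<eta> :: "'m \<Rightarrow> 'e"
  assumes berwald: "berwald_connection E br S H"
    and \<eta>: "\<eta> \<in> sections E"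
    and symmetry: "lie_symmetry E br S \<eta>"

section \<open>The vertical derivative and the curvature tensors in explicit form\<close>

context spray_connection
begin

abbreviation K :: "'e pb_sec \<Rightarrow> 'e pb_sec" where
  "K t \<equiv> jacobi_endomorphism br S H V [t]"

abbreviation DK :: "'e pb_sec \<Rightarrow> 'e pb_sec \<Rightarrow> 'e pb_sec" where
  "DK s t \<equiv> vert_differential E br (jacobi_endomorphism br S H V) [s, t]"

abbreviation R :: "'e pb_sec \<Rightarrow> 'e pb_sec \<Rightarrow> 'e pb_sec" where
  "R s t \<equiv> fundamental_affine_curvature E br S H V [s, t]"

abbreviation nab :: "'e pb_sec \<Rightarrow> 'e pb_sec \<Rightarrow> 'e pb_sec" where
  "nab \<equiv> nabla_v E br"

lemma pb_add_zero [simp]: "s \<in> pb_sections E \<Longrightarrow> pb_add E s (pb_zero E) = s"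
  by (rule pb_eqI) auto

lemma pb_zero_add [simp]: "s \<in> pb_sections E \<Longrightarrow> pb_add E (pb_zero E) s = s"
  by (rule pb_eqI) auto

text \<open>Two lifts of t differ by a vertical section, and the bracket of two vertical sections is
  vertical, hence killed by \<open>j_map\<close>. The unspecified lift may therefore be replaced by
  H(t).\<close>

lemma nabla_v_eq:
  assumes s: "s \<in> pb_sections E" and t: "t \<in> pb_sections E"
  shows "nab s t = j_map \<circ> br (i_map E \<circ> s) (H t)"
proof -
  define \<sigma> where "\<sigma> = (SOME \<sigma>. \<sigma> \<in> pr_sections E \<and> j_map \<circ> \<sigma> = t)"
  have "\<exists>\<sigma>. \<sigma> \<in> pr_sections E \<and> j_map \<circ> \<sigma> = t" using t by (intro exI[of _ "H t"]) simp
  then have \<sigma>: "\<sigma> \<in> pr_sections E" "j_map \<circ> \<sigma> = t"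
    unfolding \<sigma>_def by (auto dest!: someI_ex)
  have d: "\<sigma> = pr_add E (i_map E \<circ> V \<sigma>) (H t)" using decomposition[OF \<sigma>(1)] \<sigma>(2) by simp
  have z: "j_map \<circ> br (i_map E \<circ> s) (i_map E \<circ> V \<sigma>) = pb_zero E"
    by (rule j_bracket_vertical[OF zero_section]) (use s \<sigma> in \<open>auto simp: hat_zero\<close>)
  have "br (i_map E \<circ> s) \<sigma> = pr_add E (br (i_map E \<circ> s) (i_map E \<circ> V \<sigma>)) (br (i_map E \<circ> s) (H t))"
    using s t \<sigma>(1) by (subst d) (simp add: br_add_right)
  then have "j_map \<circ> br (i_map E \<circ> s) \<sigma> =
      pb_add E (j_map \<circ> br (i_map E \<circ> s) (i_map E \<circ> V \<sigma>)) (j_map \<circ> br (i_map E \<circ> s) (H t))"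
    using s t \<sigma>(1) by simp
  then show ?thesis
    using s t unfolding nabla_v_def \<sigma>_def[symmetric] z by simp
qed

lemma nab_closed [simp]: "s \<in> pb_sections E \<Longrightarrow> t \<in> pb_sections E \<Longrightarrow> nab s t \<in> pb_sections E"
  by (simp add: nabla_v_eq)

lemma nab_add_left: "r \<in> pb_sections E \<Longrightarrow> s \<in> pb_sections E \<Longrightarrow> t \<in> pb_sections E \<Longrightarrow>
    nab (pb_add E r s) t = pb_add E (nab r t) (nab s t)"
  by (simp add: nabla_v_eq i_add br_add_left)

lemma nab_add_right: "r \<in> pb_sections E \<Longrightarrow> s \<in> pb_sections E \<Longrightarrow> t \<in> pb_sections E \<Longrightarrow>
    nab r (pb_add E s t) = pb_add E (nab r s) (nab r t)"
  by (simp add: nabla_v_eq H_add br_add_right)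

lemma K_closed [simp]: "t \<in> pb_sections E \<Longrightarrow> K t \<in> pb_sections E"
  by (simp add: jacobi_endomorphism_def)

text \<open>The Leibniz rules for the Lie derivation put sums into the arguments of the curvature
  tensors. Additivity, here and for the tensors below, is what splits them again.\<close>

lemma K_add: "s \<in> pb_sections E \<Longrightarrow> t \<in> pb_sections E \<Longrightarrow> K (pb_add E s t) = pb_add E (K s) (K t)"
  by (simp add: jacobi_endomorphism_def H_add br_add_right V_add)

lemma DK_eq:
  "s \<in> pb_sections E \<Longrightarrow> t \<in> pb_sections E \<Longrightarrow> DK s t = pb_diff E (nab s (K t)) (K (nab s t))"
  by (simp add: vert_differential_def tensor_deriv_def pb_sum_list_def)

lemma DK_closed [simp]: "s \<in> pb_sections E \<Longrightarrow> t \<in> pb_sections E \<Longrightarrow> DK s t \<in> pb_sections E"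
  by (simp add: DK_eq)

lemma DK_add_left: "r \<in> pb_sections E \<Longrightarrow> s \<in> pb_sections E \<Longrightarrow> t \<in> pb_sections E \<Longrightarrow>
    DK (pb_add E r s) t = pb_add E (DK r t) (DK s t)"
  by (rule pb_eqI) (auto simp: DK_eq nab_add_left K_add)

lemma DK_add_right: "r \<in> pb_sections E \<Longrightarrow> s \<in> pb_sections E \<Longrightarrow> t \<in> pb_sections E \<Longrightarrow>
    DK r (pb_add E s t) = pb_add E (DK r s) (DK r t)"
  by (rule pb_eqI) (auto simp: DK_eq nab_add_right K_add)

lemma R_eq: "R s t = pb_scale E (\<lambda>_. 1/3) (pb_diff E (DK t s) (DK s t))"
  by (simp add: fundamental_affine_curvature_def)

lemma R_closed [simp]: "s \<in> pb_sections E \<Longrightarrow> t \<in> pb_sections E \<Longrightarrow> R s t \<in> pb_sections E"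
  by (simp add: R_eq)

lemma R_add_left: "r \<in> pb_sections E \<Longrightarrow> s \<in> pb_sections E \<Longrightarrow> t \<in> pb_sections E \<Longrightarrow>
    R (pb_add E r s) t = pb_add E (R r t) (R s t)"
  by (rule pb_eqI) (auto simp: R_eq DK_add_left DK_add_right algebra_simps)

lemma R_add_right: "r \<in> pb_sections E \<Longrightarrow> s \<in> pb_sections E \<Longrightarrow> t \<in> pb_sections E \<Longrightarrow>
    R r (pb_add E s t) = pb_add E (R r s) (R r t)"
  by (rule pb_eqI) (auto simp: R_eq DK_add_left DK_add_right algebra_simps)

lemma affine_curvature_eq:
  "r \<in> pb_sections E \<Longrightarrow> s \<in> pb_sections E \<Longrightarrow> t \<in> pb_sections E \<Longrightarrow>
    affine_curvature E br S H V [r, s, t] = pb_diff E (nab t (R r s)) (pb_add E (R (nab t r) s) (R r (nab t s)))"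
  by (simp add: affine_curvature_def vert_differential_def tensor_deriv_def pb_sum_list_def numeral_2_eq_2)

end

section \<open>Commutation of the Lie derivation with the connection and the curvatures\<close>

context spray_symmetry
begin

abbreviation c :: "'e pr_sec" where "c \<equiv> complete_lift E \<eta>"
abbreviation L :: "'e pb_sec \<Rightarrow> 'e pb_sec" where "L \<equiv> lie_pb E br c"

lemmas c = complete_lift[OF \<eta>]

lemma c_closed [simp]: "c \<in> pr_sections E"
  by (rule c(1))

lemma br_c_S: "br c S = pr_zero E"
proof -
  have "br S c = pr_zero E" using symmetry by (simp add: lie_symmetry_def)
  then have "br c S = pr_scale E (\<lambda>_. -1) (pr_zero E)" using br_anti[of c S] by simp
  also have "\<dots> = pr_zero E" by (rule pr_eqI; (rule pb_eqI)?) auto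
  finally show ?thesis .
qed

text \<open>Evaluates \<open>i_inv\<close>: the complete lift is projectable, so its bracket with a
  vertical section is vertical again.\<close>

lemma L_eq: "t \<in> pb_sections E \<Longrightarrow> L t = V (br c (i_map E \<circ> t))"
  unfolding lie_pb_def by (rule i_inv_eq) (use j_bracket_vertical[OF \<eta> c(1,2)] in auto)

lemma L_closed [simp]: "t \<in> pb_sections E \<Longrightarrow> L t \<in> pb_sections E"
  by (simp add: L_eq)

lemma i_L: "t \<in> pb_sections E \<Longrightarrow> i_map E \<circ> L t = br c (i_map E \<circ> t)"
  unfolding L_eq by (rule vertical_eq) (use j_bracket_vertical[OF \<eta> c(1,2)] in auto)

lemma L_add: "s \<in> pb_sections E \<Longrightarrow> t \<in> pb_sections E \<Longrightarrow> L (pb_add E s t) = pb_add E (L s) (L t)"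
  by (simp add: L_eq i_add br_add_right V_add)

lemma L_scale: "F \<in> Cinf T \<Longrightarrow> t \<in> pb_sections E \<Longrightarrow>
    L (pb_scale E F t) = pb_add E (pb_scale E F (L t)) (pb_scale E (pr_deriv c F) t)"
  by (simp add: L_eq i_scale br_leibniz V_add V_scale pr_deriv_Cinf)

lemma L_const: "t \<in> pb_sections E \<Longrightarrow> L (pb_scale E (\<lambda>_. a) t) = pb_scale E (\<lambda>_. a) (L t)"
  by (simp add: L_eq i_scale br_const_right V_scale)

lemma L_diff: "s \<in> pb_sections E \<Longrightarrow> t \<in> pb_sections E \<Longrightarrow> L (pb_diff E s t) = pb_diff E (L s) (L t)"
  by (simp add: pb_diff_def L_add L_const)

lemma L_hat: "\<xi> \<in> sections E \<Longrightarrow> L (hat E \<xi>) = hat E (la_bracket E \<eta> \<xi>)"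
  using \<eta> by (simp add: L_eq complete_vertical_bracket)

lemma br_c_H_hat:
  assumes \<xi>: "\<xi> \<in> sections E"
  shows "br c (H (hat E \<xi>)) = H (hat E (la_bracket E \<eta> \<xi>))"
proof -
  have B: "H (hat E \<zeta>) = pr_scale E (\<lambda>_. 1/2) (pr_add E (complete_lift E \<zeta>) (br (i_map E \<circ> hat E \<zeta>) S))"
    if "\<zeta> \<in> sections E" for \<zeta>
    using berwald that unfolding berwald_connection_def vertical_lift_def by blast
  let ?v = "i_map E \<circ> hat E \<xi>"
  have "br c (br ?v S) = pr_add E (br (br c ?v) S) (br ?v (br c S))"
    using \<xi> by (intro br_derivation) auto
  also have "\<dots> = br (i_map E \<circ> hat E (la_bracket E \<eta> \<xi>)) S"
    using \<xi> \<eta> by (simp add: br_c_S br_zero_right complete_vertical_bracket[OF \<eta> \<xi>])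
  finally have e: "br c (br ?v S) = br (i_map E \<circ> hat E (la_bracket E \<eta> \<xi>)) S" .
  show ?thesis
    unfolding B[OF \<xi>] B[OF la_closed[OF \<eta> \<xi>]]
    using \<xi> \<eta> complete_lift(1)[OF \<xi>]
    by (simp add: br_const_right br_add_right e complete_complete_bracket)
qed

lemma br_c_H:
  assumes t: "t \<in> pb_sections E"
  shows "br c (H t) = H (L t)"
proof (rule pr_eqI)
  show "j_map \<circ> br c (H t) = j_map \<circ> H (L t)"
  proof (rule pb_eqI)
    fix \<theta> u assume \<theta>: "\<theta> \<in> dual_sections E"
    \<comment> \<open>Replacing t by F t adds the same term, the derivative of F along
      \<open>c\<close> times t, to both sides. It cancels in the difference, which is therefore
      linear over smooth functions.\<close>
    have "pb_pair E \<theta> (j_map \<circ> br c (H t)) u - pb_pair E \<theta> (L t) u = 0"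
      by (rule pb_linear_vanishes[OF _ _ _ t, of "\<lambda>t. pb_pair E \<theta> (j_map \<circ> br c (H t)) u - pb_pair E \<theta> (L t) u" u])
        (use \<theta> \<eta> in \<open>auto simp: H_add H_scale L_add L_scale br_add_right br_leibniz pr_deriv_Cinf L_hat br_c_H_hat algebra_simps\<close>)
    then show "pb_pair E \<theta> (j_map \<circ> br c (H t)) u = pb_pair E \<theta> (j_map \<circ> H (L t)) u"
      using t by simp
  qed (use t in auto)
  fix f u assume "f \<in> Cinf T"
  \<comment> \<open>The same argument for the tangent component; here the common extra term is the
    derivative of F along \<open>c\<close> times H(t).\<close>
  have "pr_deriv (br c (H t)) f u - pr_deriv (H (L t)) f u = 0"
    by (rule pb_linear_vanishes[OF _ _ _ t, of "\<lambda>t. pr_deriv (br c (H t)) f u - pr_deriv (H (L t)) f u" u])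
      (use \<eta> in \<open>auto simp: H_add H_scale L_add L_scale br_add_right br_leibniz pr_deriv_Cinf L_hat br_c_H_hat algebra_simps\<close>)
  then show "pr_deriv (br c (H t)) f u = pr_deriv (H (L t)) f u" by simp
qed (use t in auto)

lemma br_c_decomposition:
  assumes s: "s \<in> pr_sections E"
  shows "br c s = pr_add E (i_map E \<circ> L (V s)) (H (L (j_map \<circ> s)))"
  by (subst decomposition[OF s]) (use s in \<open>simp add: br_add_right i_L br_c_H\<close>)

lemma V_br_c: "s \<in> pr_sections E \<Longrightarrow> V (br c s) = L (V s)"
  by (simp add: br_c_decomposition V_add)

lemma j_br_c: "s \<in> pr_sections E \<Longrightarrow> j_map \<circ> br c s = L (j_map \<circ> s)"
  by (simp add: br_c_decomposition)

text \<open>The Jacobi endomorphism is \<open>V\<close> after bracketing with \<open>S\<close> after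
  \<open>H\<close>. The first and last are intertwined with the Lie derivation, and the derivation
  rule passes through the bracket because [c, S] = 0.\<close>

lemma L_K:
  assumes t: "t \<in> pb_sections E"
  shows "L (K t) = K (L t)"
proof -
  have "br c (br S (H t)) = br S (H (L t))"
    using t br_derivation[of c S "H t"] by (simp add: br_c_S br_zero_left br_c_H)
  then show ?thesis
    using V_br_c[of "br S (H t)"] t by (simp add: jacobi_endomorphism_def)
qed

text \<open>In j[i s, H t] the derivation rule distributes \<open>br c\<close> over the two entries,
  and i, H and j each turn it into the Lie derivation.\<close>

lemma L_nab:
  assumes s: "s \<in> pb_sections E" and t: "t \<in> pb_sections E"
  shows "L (nab s t) = pb_add E (nab (L s) t) (nab s (L t))"
  using j_br_c[of "br (i_map E \<circ> s) (H t)"] br_derivation[of c "i_map E \<circ> s" "H t"] s t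
  by (simp add: nabla_v_eq i_L br_c_H)

lemma L_DK:
  assumes s: "s \<in> pb_sections E" and t: "t \<in> pb_sections E"
  shows "L (DK s t) = pb_add E (DK (L s) t) (DK s (L t))"
  by (rule pb_eqI) (use s t in \<open>auto simp: DK_eq L_diff L_nab L_K K_add\<close>)

lemma L_R:
  assumes s: "s \<in> pb_sections E" and t: "t \<in> pb_sections E"
  shows "L (R s t) = pb_add E (R (L s) t) (R s (L t))"
  by (rule pb_eqI) (use s t in \<open>auto simp: R_eq L_const L_diff L_DK algebra_simps\<close>)

lemma collineation_K: "curvature_collineation E br 1 (jacobi_endomorphism br S H V) c"
  unfolding curvature_collineation_def
proof (intro conjI allI impI)
  fix ss assume "length ss = 1" "set ss \<subseteq> pb_sections E"
  then obtain t where t: "ss = [t]" "t \<in> pb_sections E" by (cases ss) auto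
  have e: "tensor_deriv E L (jacobi_endomorphism br S H V) ss = pb_diff E (L (K t)) (K (L t))"
    using t by (simp add: tensor_deriv_def pb_sum_list_def)
  show "tensor_deriv E L (jacobi_endomorphism br S H V) ss = pb_zero E"
    unfolding e by (rule pb_eqI) (use t in \<open>auto simp: L_K\<close>)
qed (use projectable_complete_lift[OF \<eta>] in auto)

lemma collineation_R: "curvature_collineation E br 2 (fundamental_affine_curvature E br S H V) c"
  unfolding curvature_collineation_def
proof (intro conjI allI impI)
  fix ss assume "length ss = 2" "set ss \<subseteq> pb_sections E"
  then obtain s t where t: "ss = [s, t]" "s \<in> pb_sections E" "t \<in> pb_sections E"
    by (auto simp: numeral_2_eq_2 length_Suc_conv)
  have e: "tensor_deriv E L (fundamental_affine_curvature E br S H V) ss =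
      pb_diff E (L (R s t)) (pb_add E (R (L s) t) (R s (L t)))"
    using t by (simp add: tensor_deriv_def pb_sum_list_def)
  show "tensor_deriv E L (fundamental_affine_curvature E br S H V) ss = pb_zero E"
    unfolding e by (rule pb_eqI) (use t in \<open>auto simp: L_R\<close>)
qed (use projectable_complete_lift[OF \<eta>] in auto)

lemma collineation_H: "curvature_collineation E br 3 (affine_curvature E br S H V) c"
  unfolding curvature_collineation_def
proof (intro conjI allI impI)
  let ?A = "affine_curvature E br S H V"
  fix ss assume "length ss = 3" "set ss \<subseteq> pb_sections E"
  then obtain r s t where t: "ss = [r, s, t]" "r \<in> pb_sections E" "s \<in> pb_sections E" "t \<in> pb_sections E"
    by (auto simp: numeral_3_eq_3 length_Suc_conv)
  have e: "tensor_deriv E L ?A ss =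
      pb_diff E (L (?A [r, s, t])) (pb_add E (?A [L r, s, t]) (pb_add E (?A [r, L s, t]) (?A [r, s, L t])))"
    using t by (simp add: tensor_deriv_def pb_sum_list_def affine_curvature_eq numeral_3_eq_3 numeral_2_eq_2 upt_rec)
  show "tensor_deriv E L ?A ss = pb_zero E"
    unfolding e
    \<comment> \<open>The Leibniz rules move the Lie derivation onto one of the three arguments at a
      time. Terms in which it meets a vertical derivative are separated by additivity and cancel
      against the three subtracted tensors.\<close>
    by (rule pb_eqI) (use t in \<open>auto simp: affine_curvature_eq L_diff L_add L_nab L_R nab_add_right R_add_left R_add_right\<close>)
qed (use projectable_complete_lift[OF \<eta>] in auto)

end

theorem theorem4p4:
  fixes E :: "('m::{t2_space, second_countable_topology}, 'e::{t2_space, second_countable_topology},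
                'a::real_inner, 'f::real_inner) lie_algd"
    and br :: "'e pr_sec \<Rightarrow> 'e pr_sec \<Rightarrow> 'e pr_sec"
    and S :: "'e pr_sec"
    and H :: "'e pb_sec \<Rightarrow> 'e pr_sec"
    and V :: "'e pr_sec \<Rightarrow> 'e pb_sec"
    and \<eta> :: "'m \<Rightarrow> 'e"
  assumes "lie_algebroid E"
    and "prolongation_bracket E br"
    and "spray E br S"
    and "berwald_connection E br S H"
    and "vertical_map E H V"
    and "\<eta> \<in> sections E"
    and "lie_symmetry E br S \<eta>"
  shows "curvature_collineation E br 1 (jacobi_endomorphism br S H V) (complete_lift E \<eta>) \<and>
         curvature_collineation E br 2 (fundamental_affine_curvature E br S H V) (complete_lift E \<eta>) \<and>
         curvature_collineation E br 3 (affine_curvature E br S H V) (complete_lift E \<eta>)"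
proof -
  interpret spray_symmetry E br S H V \<eta>
    using assms by unfold_locales (auto simp: spray_def berwald_connection_def)
  show ?thesis using collineation_K collineation_R collineation_H by blast
qed

end
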